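(* Let $(M^{2n+s}, \phi, \xi_i, \eta_j, g)$ be an $\mathcal{S}$-manifold endowed with its characteristic connection $\nabla$. Then $M^{2n+s}$ is $\mathrm{Ric}^{\nabla}$-flat (that is, $\mathrm{Ric}^\nabla\equiv0$) if and only if $M^{2n+s}$ is transverse Kähler-Einstein with Einstein constant $\lambda=4s$.
   Context: A metric $f$-manifold $(M^{2n+s},\phi,\xi_i,\eta_j,g)$ is a smooth connected manifold of dimension $2n+s$ with an endomorphism $\phi$ of $TM$ of constant rank $2n$, global vector fields $\xi_1,\dots,\xi_s$, 1-forms $\eta_1,\dots,\eta_s$ and a Riemannian metric $g$ such that $\mathrm{Ker}(\phi)=\langle\xi_1,\dots,\xi_s\rangle$, $\eta_i(\xi_j)=\delta_{ij}$, $\eta_i\circ\phi=0$, $\phi^2=-\mathrm{Id}+\sum_{i=1}^s\eta_i\otimes\xi_i$, and $g(\phi X,\phi Y)=g(X,Y)-\sum_{i=1}^s\eta_i(X)\eta_i(Y)$. Set $F(X,Y)=g(X,\phi Y)$ and $N^{(1)}=N_\phi+\sum_i d\eta_i\otimes\xi_i$, where $N_\phi(X,Y)=[\phi X,\phi Y]+\phi^2[X,Y]-\phi[X,\phi Y]-\phi[\phi X,Y]$ and $d\eta(X,Y)=X\eta(Y)-Y\eta(X)-\eta([X,Y])$. It is an $\mathcal{S}$-manifold if $s\ge1$, $2F=d\eta_j$ for all $j$, and $N^{(1)}=0$. Put $\mathcal{D}=\mathrm{Im}(\phi)=\bigcap_i\mathrm{Ker}(\eta_i)$ and $\mathcal{D}^\perp=\mathrm{Ker}(\phi)$,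 so $TM=\mathcal{D}\oplus\mathcal{D}^\perp$. The characteristic connection of an $\mathcal{S}$-manifold is the metric connection $\nabla=\nabla^g+\frac12T$, where $\nabla^g$ is the Levi-Civita connection, i.e. $\nabla_XY=\nabla^g_XY+\frac12T(X,Y)$, with totally skew-symmetric torsion $T=\sum_{i}\eta_i\wedge d\eta_i$, equivalently $T(X,Y)=2\sum_{i}\{F(X,Y)\xi_i-\eta_i(X)\phi(Y)+\eta_i(Y)\phi(X)\}$. It is the unique metric connection with skew-torsion satisfying $\nabla\phi=0$, $\nabla\xi_i=0$, $\nabla\eta_j=0$, and it satisfies $\nabla T=0$. Its curvature is $R^\nabla(X,Y)Z=\nabla_X\nabla_YZ-\nabla_Y\nabla_XZ-\nabla_{[X,Y]}Z$ and its Ricci tensor is $\mathrm{Ric}^\nabla(U,V)=\sum_{a=1}^{2n+s}g(R^\nabla(U,e_a)e_a,V)$ for a local $g$-orthonormal frame $\{e_a\}$. The transverse metric is $\check g=g|_{\mathcal{D}\times\mathcal{D}}$. The transverse Levi-Civita connection $\check\nabla$ on $\mathcal{D}$ is $\check\nabla_XY=(\nabla^g_XY)_{\mathcal{D}}$ for $X,Y\in\mathcal{D}$ and $\check\nabla_XY=[X,Y]_{\mathcal{D}}$ for $X\in\mathcal{D}^\perp,Y\in\mathcal{D}$. Its curvature is $\check R(X,Y)Z=\check\nabla_X\check\nabla_YZ-\check\nabla_Y\check\nabla_XZ-\check\nabla_{[X,Y]}Z$, and the transverse Ricci tensor is $\mathrm{Ric}^{\check g}(X,Y)=\sum_{a=1}^{2n}\check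 g(\check R(X,e_a)e_a,Y)$ for $X,Y\in\mathcal{D}$, with $\{e_a\}_{a=1}^{2n}$ a $g$-orthonormal basis of $\mathcal{D}$. The $\mathcal{S}$-manifold is transverse Kähler-Einstein with Einstein constant $\lambda$ if $\mathrm{Ric}^{\check g}=\lambda\,\check g$ for a real constant $\lambda$. *)

theory Defs
  imports "HOL-Analysis.Analysis" "HOL-Library.Function_Algebras"
begin

text \<open>
  Tangent vectors are derivations on the algebra of smooth functions, hence real functions on
  functions. The pointwise vector space structure makes \<open>span\<close>, \<open>dim\<close> and finite sums available
  for them (and for vector fields).
\<close>

instantiation "fun" :: (type, real_vector) real_vector
begin

definition scaleR_fun :: "real \<Rightarrow> ('a \<Rightarrow> 'b) \<Rightarrow> 'a \<Rightarrow> 'b" where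
  "scaleR_fun r f = (\<lambda>x. r *\<^sub>R f x)"

instance
  by standard (simp_all add: scaleR_fun_def fun_eq_iff scaleR_add_right scaleR_add_left)

end

section \<open>Smooth manifolds\<close>

primrec Ck_on :: "nat \<Rightarrow> 'e::euclidean_space set \<Rightarrow> ('e \<Rightarrow> 'f::real_normed_vector) \<Rightarrow> bool" where
  "Ck_on 0 S f \<longleftrightarrow> continuous_on S f"
| "Ck_on (Suc k) S f \<longleftrightarrow>
     f differentiable_on S \<and> (\<forall>v. Ck_on k S (\<lambda>x. frechet_derivative f (at x) v))"

text \<open>Only meant for open \<open>S\<close>.\<close>

definition smooth_on :: "'e::euclidean_space set \<Rightarrow> ('e \<Rightarrow> 'f::real_normed_vector) \<Rightarrow> bool" where
  "smooth_on S f \<longleftrightarrow> (\<forall>k. Ck_on k S f)"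

type_synonym ('a, 'e) atlas = "('a set \<times> ('a \<Rightarrow> 'e)) set"

text \<open>
  The underlying space is the whole type \<open>'a\<close>. Any smooth atlas may be given, not just a maximal
  one; the notions below depend only on the smooth structure it generates.
\<close>

definition connected_smooth_manifold ::
    "('a::{t2_space, second_countable_topology}, 'e::euclidean_space) atlas \<Rightarrow> bool" where
  "connected_smooth_manifold A \<longleftrightarrow>
     connected (UNIV :: 'a set) \<and>
     (\<Union>(U, c)\<in>A. U) = UNIV \<and>
     (\<forall>(U, c)\<in>A. open U \<and> open (c ` U) \<and> homeomorphism U (c ` U) c (inv_into U c)) \<and>
     (\<forall>(U, c)\<in>A. \<forall>(V, d)\<in>A. smooth_on (c ` (U \<inter> V)) (d \<circ> inv_into U c))"

definition smooth_functions :: "('a, 'e::euclidean_space) atlas \<Rightarrow> ('a \<Rightarrow> real) set" where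
  "smooth_functions A = {f. \<forall>(U, c)\<in>A. smooth_on (c ` U) (f \<circ> inv_into U c)}"

type_synonym 'a tvec = "('a \<Rightarrow> real) \<Rightarrow> real"
type_synonym 'a vfield = "'a \<Rightarrow> 'a tvec"

text \<open>
  The value of a tangent vector on a non-smooth function is normalised to \<open>0\<close>, so that equality
  of derivations is equality of HOL functions.
\<close>

definition tangent_space :: "('a, 'e::euclidean_space) atlas \<Rightarrow> 'a \<Rightarrow> 'a tvec set" where
  "tangent_space A p = {v.
     (\<forall>f. f \<notin> smooth_functions A \<longrightarrow> v f = 0) \<and>
     (\<forall>f\<in>smooth_functions A. \<forall>h\<in>smooth_functions A. v (\<lambda>x. f x + h x) = v f + v h) \<and>
     (\<forall>r. \<forall>f\<in>smooth_functions A. v (\<lambda>x. r * f x) = r * v f) \<and>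
     (\<forall>f\<in>smooth_functions A. \<forall>h\<in>smooth_functions A.
        v (\<lambda>x. f x * h x) = f p * v h + h p * v f)}"

definition dir_deriv :: "'a vfield \<Rightarrow> ('a \<Rightarrow> real) \<Rightarrow> 'a \<Rightarrow> real" where
  "dir_deriv X f = (\<lambda>p. X p f)"

definition vector_fields :: "('a, 'e::euclidean_space) atlas \<Rightarrow> 'a vfield set" where
  "vector_fields A = {X. (\<forall>p. X p \<in> tangent_space A p) \<and>
     (\<forall>f\<in>smooth_functions A. dir_deriv X f \<in> smooth_functions A)}"

definition fscale :: "('a \<Rightarrow> real) \<Rightarrow> 'a vfield \<Rightarrow> 'a vfield" (infixr \<open>\<cdot>\<^sub>v\<close> 75) where
  "f \<cdot>\<^sub>v X = (\<lambda>p. f p *\<^sub>R X p)"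

definition lie_bracket ::
    "('a, 'e::euclidean_space) atlas \<Rightarrow> 'a vfield \<Rightarrow> 'a vfield \<Rightarrow> 'a vfield" where
  "lie_bracket A X Y = (\<lambda>p f.
     if f \<in> smooth_functions A then X p (dir_deriv Y f) - Y p (dir_deriv X f) else 0)"

section \<open>Tensor fields\<close>

text \<open>
  Tensor fields are families of multilinear maps on the tangent spaces; such a family is smooth
  iff it maps smooth vector fields to smooth vector fields or functions. Their values outside the
  tangent spaces are irrelevant.
\<close>

definition on_fields :: "('a \<Rightarrow> 'a tvec \<Rightarrow> 'a tvec) \<Rightarrow> 'a vfield \<Rightarrow> 'a vfield" where
  "on_fields \<phi> X = (\<lambda>p. \<phi> p (X p))"

definition form_on_fields :: "('a \<Rightarrow> 'a tvec \<Rightarrow> real) \<Rightarrow> 'a vfield \<Rightarrow> 'a \<Rightarrow> real" where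
  "form_on_fields \<alpha> X = (\<lambda>p. \<alpha> p (X p))"

definition bilin_on_fields ::
    "('a \<Rightarrow> 'a tvec \<Rightarrow> 'a tvec \<Rightarrow> real) \<Rightarrow> 'a vfield \<Rightarrow> 'a vfield \<Rightarrow> 'a \<Rightarrow> real" where
  "bilin_on_fields b X Y = (\<lambda>p. b p (X p) (Y p))"

definition endomorphism_field ::
    "('a, 'e::euclidean_space) atlas \<Rightarrow> ('a \<Rightarrow> 'a tvec \<Rightarrow> 'a tvec) \<Rightarrow> bool" where
  "endomorphism_field A \<phi> \<longleftrightarrow>
     (\<forall>p. \<forall>u\<in>tangent_space A p. \<phi> p u \<in> tangent_space A p) \<and>
     (\<forall>p. \<forall>u\<in>tangent_space A p. \<forall>v\<in>tangent_space A p. \<phi> p (u + v) = \<phi> p u + \<phi> p v) \<and>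
     (\<forall>p r. \<forall>u\<in>tangent_space A p. \<phi> p (r *\<^sub>R u) = r *\<^sub>R \<phi> p u) \<and>
     (\<forall>X\<in>vector_fields A. on_fields \<phi> X \<in> vector_fields A)"

definition one_form ::
    "('a, 'e::euclidean_space) atlas \<Rightarrow> ('a \<Rightarrow> 'a tvec \<Rightarrow> real) \<Rightarrow> bool" where
  "one_form A \<alpha> \<longleftrightarrow>
     (\<forall>p. \<forall>u\<in>tangent_space A p. \<forall>v\<in>tangent_space A p. \<alpha> p (u + v) = \<alpha> p u + \<alpha> p v) \<and>
     (\<forall>p r. \<forall>u\<in>tangent_space A p. \<alpha> p (r *\<^sub>R u) = r * \<alpha> p u) \<and>
     (\<forall>X\<in>vector_fields A. form_on_fields \<alpha> X \<in> smooth_functions A)"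

definition riemannian_metric ::
    "('a, 'e::euclidean_space) atlas \<Rightarrow> ('a \<Rightarrow> 'a tvec \<Rightarrow> 'a tvec \<Rightarrow> real) \<Rightarrow> bool" where
  "riemannian_metric A g \<longleftrightarrow>
     (\<forall>p. \<forall>u\<in>tangent_space A p. \<forall>v\<in>tangent_space A p. \<forall>w\<in>tangent_space A p.
        g p (u + v) w = g p u w + g p v w) \<and>
     (\<forall>p r. \<forall>u\<in>tangent_space A p. \<forall>w\<in>tangent_space A p. g p (r *\<^sub>R u) w = r * g p u w) \<and>
     (\<forall>p. \<forall>u\<in>tangent_space A p. \<forall>v\<in>tangent_space A p. g p u v = g p v u) \<and>
     (\<forall>p. \<forall>u\<in>tangent_space A p. u \<noteq> 0 \<longrightarrow> g p u u > 0) \<and>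
     (\<forall>X\<in>vector_fields A. \<forall>Y\<in>vector_fields A. bilin_on_fields g X Y \<in> smooth_functions A)"

definition ext_deriv ::
    "('a, 'e::euclidean_space) atlas \<Rightarrow> ('a \<Rightarrow> 'a tvec \<Rightarrow> real) \<Rightarrow> 'a vfield \<Rightarrow> 'a vfield \<Rightarrow> 'a \<Rightarrow> real"
  where
  "ext_deriv A \<alpha> X Y = (\<lambda>p. dir_deriv X (form_on_fields \<alpha> Y) p
     - dir_deriv Y (form_on_fields \<alpha> X) p - \<alpha> p (lie_bracket A X Y p))"

section \<open>Connections and curvature\<close>

text \<open>Only the values of a connection on smooth vector fields are relevant.\<close>

definition affine_connection ::
    "('a, 'e::euclidean_space) atlas \<Rightarrow> ('a vfield \<Rightarrow> 'a vfield \<Rightarrow> 'a vfield) \<Rightarrow> bool" where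
  "affine_connection A D \<longleftrightarrow>
     (\<forall>X\<in>vector_fields A. \<forall>Y\<in>vector_fields A. D X Y \<in> vector_fields A) \<and>
     (\<forall>X\<in>vector_fields A. \<forall>Y\<in>vector_fields A. \<forall>Z\<in>vector_fields A.
        D (X + Y) Z = D X Z + D Y Z \<and> D X (Y + Z) = D X Y + D X Z) \<and>
     (\<forall>f\<in>smooth_functions A. \<forall>X\<in>vector_fields A. \<forall>Y\<in>vector_fields A.
        D (f \<cdot>\<^sub>v X) Y = f \<cdot>\<^sub>v D X Y \<and>
        D X (f \<cdot>\<^sub>v Y) = dir_deriv X f \<cdot>\<^sub>v Y + f \<cdot>\<^sub>v D X Y)"

definition levi_civita_connection ::
    "('a, 'e::euclidean_space) atlas \<Rightarrow> ('a \<Rightarrow> 'a tvec \<Rightarrow> 'a tvec \<Rightarrow> real) \<Rightarrow>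
     ('a vfield \<Rightarrow> 'a vfield \<Rightarrow> 'a vfield) \<Rightarrow> bool" where
  "levi_civita_connection A g D \<longleftrightarrow>
     affine_connection A D \<and>
     (\<forall>X\<in>vector_fields A. \<forall>Y\<in>vector_fields A. D X Y - D Y X = lie_bracket A X Y) \<and>
     (\<forall>X\<in>vector_fields A. \<forall>Y\<in>vector_fields A. \<forall>Z\<in>vector_fields A.
        dir_deriv X (bilin_on_fields g Y Z) =
          (\<lambda>p. bilin_on_fields g (D X Y) Z p + bilin_on_fields g Y (D X Z) p))"

definition curvature ::
    "('a, 'e::euclidean_space) atlas \<Rightarrow> ('a vfield \<Rightarrow> 'a vfield \<Rightarrow> 'a vfield) \<Rightarrow>
     'a vfield \<Rightarrow> 'a vfield \<Rightarrow> 'a vfield \<Rightarrow> 'a vfield" where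
  "curvature A D X Y Z = D X (D Y Z) - D Y (D X Z) - D (lie_bracket A X Y) Z"

definition sections ::
    "('a, 'e::euclidean_space) atlas \<Rightarrow> ('a \<Rightarrow> 'a tvec set) \<Rightarrow> 'a vfield set" where
  "sections A B = {X \<in> vector_fields A. \<forall>p. X p \<in> B p}"

text \<open>
  \<open>E\<close> restricts to a local orthonormal frame of the subbundle \<open>B\<close> around \<open>p\<close>, with index range
  \<open>{..<m}\<close>. Connections act here on globally defined fields, so the members of the frame are
  global sections that are orthonormal near \<open>p\<close>; every local frame around \<open>p\<close> agrees near \<open>p\<close>
  with one of this kind.
\<close>

definition local_orthonormal_frame ::
    "('a::topological_space, 'e::euclidean_space) atlas \<Rightarrow> ('a \<Rightarrow> 'a tvec \<Rightarrow> 'a tvec \<Rightarrow> real) \<Rightarrow>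
     ('a \<Rightarrow> 'a tvec set) \<Rightarrow> nat \<Rightarrow> 'a \<Rightarrow> (nat \<Rightarrow> 'a vfield) \<Rightarrow> bool" where
  "local_orthonormal_frame A g B m p E \<longleftrightarrow>
     (\<forall>a<m. E a \<in> sections A B) \<and>
     (\<exists>W. open W \<and> p \<in> W \<and> (\<forall>q\<in>W.
        (\<forall>a<m. \<forall>b<m. g q (E a q) (E b q) = (if a = b then 1 else 0)) \<and>
        span ((\<lambda>a. E a q) ` {..<m}) = B q))"

text \<open>\<open>m\<close> is the rank of \<open>B\<close>; the value does not depend on the choice of the frame.\<close>

definition ricci ::
    "('a::topological_space, 'e::euclidean_space) atlas \<Rightarrow> ('a \<Rightarrow> 'a tvec \<Rightarrow> 'a tvec \<Rightarrow> real) \<Rightarrow>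
     ('a \<Rightarrow> 'a tvec set) \<Rightarrow> nat \<Rightarrow> ('a vfield \<Rightarrow> 'a vfield \<Rightarrow> 'a vfield) \<Rightarrow>
     'a vfield \<Rightarrow> 'a vfield \<Rightarrow> 'a \<Rightarrow> real" where
  "ricci A g B m D X Y p =
     (let E = (SOME E. local_orthonormal_frame A g B m p E)
      in \<Sum>a<m. bilin_on_fields g (curvature A D X (E a) (E a)) Y p)"

section \<open>S-manifolds\<close>

definition metric_f_manifold ::
    "('a::{t2_space, second_countable_topology}, 'e::euclidean_space) atlas \<Rightarrow> nat \<Rightarrow> nat \<Rightarrow>
     ('a \<Rightarrow> 'a tvec \<Rightarrow> 'a tvec) \<Rightarrow> (nat \<Rightarrow> 'a vfield) \<Rightarrow> (nat \<Rightarrow> 'a \<Rightarrow> 'a tvec \<Rightarrow> real) \<Rightarrow>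
     ('a \<Rightarrow> 'a tvec \<Rightarrow> 'a tvec \<Rightarrow> real) \<Rightarrow> bool" where
  "metric_f_manifold A n s \<phi> \<xi> \<eta> g \<longleftrightarrow>
     connected_smooth_manifold A \<and>
     DIM('e) = 2 * n + s \<and>
     endomorphism_field A \<phi> \<and>
     (\<forall>i<s. \<xi> i \<in> vector_fields A) \<and>
     (\<forall>i<s. one_form A (\<eta> i)) \<and>
     riemannian_metric A g \<and>
     (\<forall>p. dim (\<phi> p ` tangent_space A p) = 2 * n) \<and>
     (\<forall>p. {u \<in> tangent_space A p. \<phi> p u = 0} = span ((\<lambda>i. \<xi> i p) ` {..<s})) \<and>
     (\<forall>p. \<forall>i<s. \<forall>j<s. \<eta> i p (\<xi> j p) = (if i = j then 1 else 0)) \<and>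
     (\<forall>p. \<forall>i<s. \<forall>u\<in>tangent_space A p. \<eta> i p (\<phi> p u) = 0) \<and>
     (\<forall>p. \<forall>u\<in>tangent_space A p. \<phi> p (\<phi> p u) = - u + (\<Sum>i<s. \<eta> i p u *\<^sub>R \<xi> i p)) \<and>
     (\<forall>p. \<forall>u\<in>tangent_space A p. \<forall>v\<in>tangent_space A p.
        g p (\<phi> p u) (\<phi> p v) = g p u v - (\<Sum>i<s. \<eta> i p u * \<eta> i p v))"

definition fundamental_form ::
    "('a \<Rightarrow> 'a tvec \<Rightarrow> 'a tvec) \<Rightarrow> ('a \<Rightarrow> 'a tvec \<Rightarrow> 'a tvec \<Rightarrow> real) \<Rightarrow>
     'a \<Rightarrow> 'a tvec \<Rightarrow> 'a tvec \<Rightarrow> real" where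
  "fundamental_form \<phi> g p u v = g p u (\<phi> p v)"

definition nijenhuis ::
    "('a, 'e::euclidean_space) atlas \<Rightarrow> ('a \<Rightarrow> 'a tvec \<Rightarrow> 'a tvec) \<Rightarrow>
     'a vfield \<Rightarrow> 'a vfield \<Rightarrow> 'a vfield" where
  "nijenhuis A \<phi> X Y =
     lie_bracket A (on_fields \<phi> X) (on_fields \<phi> Y)
     + on_fields \<phi> (on_fields \<phi> (lie_bracket A X Y))
     - on_fields \<phi> (lie_bracket A X (on_fields \<phi> Y))
     - on_fields \<phi> (lie_bracket A (on_fields \<phi> X) Y)"

definition normality_tensor ::
    "('a, 'e::euclidean_space) atlas \<Rightarrow> nat \<Rightarrow> ('a \<Rightarrow> 'a tvec \<Rightarrow> 'a tvec) \<Rightarrow> (nat \<Rightarrow> 'a vfield) \<Rightarrow>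
     (nat \<Rightarrow> 'a \<Rightarrow> 'a tvec \<Rightarrow> real) \<Rightarrow> 'a vfield \<Rightarrow> 'a vfield \<Rightarrow> 'a vfield" where
  "normality_tensor A s \<phi> \<xi> \<eta> X Y =
     nijenhuis A \<phi> X Y + (\<Sum>i<s. ext_deriv A (\<eta> i) X Y \<cdot>\<^sub>v \<xi> i)"

definition S_manifold ::
    "('a::{t2_space, second_countable_topology}, 'e::euclidean_space) atlas \<Rightarrow> nat \<Rightarrow> nat \<Rightarrow>
     ('a \<Rightarrow> 'a tvec \<Rightarrow> 'a tvec) \<Rightarrow> (nat \<Rightarrow> 'a vfield) \<Rightarrow> (nat \<Rightarrow> 'a \<Rightarrow> 'a tvec \<Rightarrow> real) \<Rightarrow>
     ('a \<Rightarrow> 'a tvec \<Rightarrow> 'a tvec \<Rightarrow> real) \<Rightarrow> bool" where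
  "S_manifold A n s \<phi> \<xi> \<eta> g \<longleftrightarrow>
     metric_f_manifold A n s \<phi> \<xi> \<eta> g \<and>
     s \<ge> 1 \<and>
     (\<forall>j<s. \<forall>X\<in>vector_fields A. \<forall>Y\<in>vector_fields A. \<forall>p.
        2 * bilin_on_fields (fundamental_form \<phi> g) X Y p = ext_deriv A (\<eta> j) X Y p) \<and>
     (\<forall>X\<in>vector_fields A. \<forall>Y\<in>vector_fields A. normality_tensor A s \<phi> \<xi> \<eta> X Y = 0)"

section \<open>The characteristic connection\<close>

definition char_torsion ::
    "nat \<Rightarrow> ('a \<Rightarrow> 'a tvec \<Rightarrow> 'a tvec) \<Rightarrow> (nat \<Rightarrow> 'a vfield) \<Rightarrow> (nat \<Rightarrow> 'a \<Rightarrow> 'a tvec \<Rightarrow> real) \<Rightarrow>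
     ('a \<Rightarrow> 'a tvec \<Rightarrow> 'a tvec \<Rightarrow> real) \<Rightarrow> 'a vfield \<Rightarrow> 'a vfield \<Rightarrow> 'a vfield" where
  "char_torsion s \<phi> \<xi> \<eta> g X Y =
     2 *\<^sub>R (\<Sum>i<s. bilin_on_fields (fundamental_form \<phi> g) X Y \<cdot>\<^sub>v \<xi> i
                 - form_on_fields (\<eta> i) X \<cdot>\<^sub>v on_fields \<phi> Y
                 + form_on_fields (\<eta> i) Y \<cdot>\<^sub>v on_fields \<phi> X)"

lemma subspace_tangent_space: "subspace (tangent_space A p)"
  unfolding subspace_def tangent_space_def
  by (auto simp: scaleR_fun_def algebra_simps)

text \<open>
  The torsion lowered by \<open>g\<close> is the 3-form \<open>\<Sum>i. \<eta> i \<and> d(\<eta> i)\<close>, which confirms the sign and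
  normalisation conventions of \<open>char_torsion\<close>.
\<close>

lemma char_torsion_eq_wedge:
  assumes S: "S_manifold A n s \<phi> \<xi> \<eta> g"
    and XYZ: "X \<in> vector_fields A" "Y \<in> vector_fields A" "Z \<in> vector_fields A"
  shows "bilin_on_fields g (char_torsion s \<phi> \<xi> \<eta> g X Y) Z p =
    (\<Sum>i<s. form_on_fields (\<eta> i) X p * ext_deriv A (\<eta> i) Y Z p
          + form_on_fields (\<eta> i) Y p * ext_deriv A (\<eta> i) Z X p
          + form_on_fields (\<eta> i) Z p * ext_deriv A (\<eta> i) X Y p)"
proof -
  let ?T = "tangent_space A p"
  note M = S[unfolded S_manifold_def metric_f_manifold_def]
  have rm: "riemannian_metric A g" and en: "endomorphism_field A \<phi>" using M by auto
  have sub: "subspace ?T" by (rule subspace_tangent_space)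
  have T: "X p \<in> ?T" "Y p \<in> ?T" "Z p \<in> ?T" using XYZ by (auto simp: vector_fields_def)
  have \<xi>T: "\<xi> i p \<in> ?T" if "i < s" for i using M that by (auto simp: vector_fields_def)
  have \<phi>T: "\<phi> p u \<in> ?T" if "u \<in> ?T" for u using en that by (auto simp: endomorphism_field_def)
  have gadd: "g p (u + v) w = g p u w + g p v w" if "u \<in> ?T" "v \<in> ?T" "w \<in> ?T" for u v w
    using rm that by (auto simp: riemannian_metric_def)
  have gsc: "g p (r *\<^sub>R u) w = r * g p u w" if "u \<in> ?T" "w \<in> ?T" for r u w
    using rm that by (auto simp: riemannian_metric_def)
  have gsym: "g p u v = g p v u" if "u \<in> ?T" "v \<in> ?T" for u v
    using rm that by (auto simp: riemannian_metric_def)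
  have gneg: "g p (- u) w = - g p u w" if "u \<in> ?T" "w \<in> ?T" for u w
    using gsc[OF that, of "-1"] by simp
  have g0: "g p 0 w = 0" if "w \<in> ?T" for w
    by (metis gsc subspace_0[OF sub] that scaleR_zero_left mult_zero_left)
  have gsum: "g p (\<Sum>i\<in>I. f i) w = (\<Sum>i\<in>I. g p (f i) w)"
    if "finite I" "\<And>i. i \<in> I \<Longrightarrow> f i \<in> ?T" "w \<in> ?T" for I :: "nat set" and f w
    using that
  proof (induction I rule: finite_induct)
    case empty
    then show ?case by (simp only: sum.empty g0)
  next
    case (insert x F)
    have F: "sum f F \<in> ?T" using insert.prems by (intro subspace_sum[OF sub]) auto
    have "g p (f x + sum f F) w = g p (f x) w + (\<Sum>i\<in>F. g p (f i) w)"
      using insert.IH insert.prems gadd[OF _ F, of "f x" w] by simp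
    then show ?case by (simp only: sum.insert[OF insert.hyps])
  qed
  have compat: "g p (\<phi> p u) (\<phi> p v) = g p u v - (\<Sum>i<s. \<eta> i p u * \<eta> i p v)"
    if "u \<in> ?T" "v \<in> ?T" for u v using M that by blast
  have phi2: "\<phi> p (\<phi> p u) = - u + (\<Sum>i<s. \<eta> i p u *\<^sub>R \<xi> i p)" if "u \<in> ?T" for u
    using M that by blast
  have \<eta>\<phi>: "\<eta> i p (\<phi> p u) = 0" if "u \<in> ?T" "i < s" for u i using M that by blast
  have \<eta>\<xi>: "\<eta> i p (\<xi> j p) = (if i = j then 1 else 0)" if "i < s" "j < s" for i j
    using M that by blast
  have \<phi>\<xi>: "\<phi> p (\<xi> i p) = 0" if "i < s" for i
  proof -
    have "\<xi> i p \<in> span ((\<lambda>i. \<xi> i p) ` {..<s})" using that by (intro span_base) auto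
    moreover have "{u \<in> ?T. \<phi> p u = 0} = span ((\<lambda>i. \<xi> i p) ` {..<s})" using M by blast
    ultimately show ?thesis by blast
  qed
  have g\<xi>: "g p (\<xi> i p) u = \<eta> i p u" if "i < s" "u \<in> ?T" for i u
  proof -
    have "0 = g p (\<xi> i p) u - (\<Sum>j<s. \<eta> j p (\<xi> i p) * \<eta> j p u)"
      using compat[OF \<xi>T[OF that(1)] that(2)] by (simp add: \<phi>\<xi>[OF that(1)] g0 \<phi>T that(2))
    also have "(\<Sum>j<s. \<eta> j p (\<xi> i p) * \<eta> j p u) = (\<Sum>j<s. if j = i then \<eta> j p u else 0)"
      using that by (intro sum.cong) (auto simp: \<eta>\<xi>)
    also have "\<dots> = \<eta> i p u" using that by simp
    finally show ?thesis by simp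
  qed
  have skew: "g p u (\<phi> p v) = - g p v (\<phi> p u)" if u: "u \<in> ?T" and v: "v \<in> ?T" for u v
  proof -
    have V: "(\<Sum>i<s. \<eta> i p v *\<^sub>R \<xi> i p) \<in> ?T"
      using \<xi>T by (intro subspace_sum[OF sub] subspace_scale[OF sub]) auto
    have "g p u (\<phi> p v) = g p (\<phi> p u) (\<phi> p (\<phi> p v))"
      using compat[OF u \<phi>T[OF v]] by (simp add: \<eta>\<phi> v)
    also have "\<dots> = g p (- v + (\<Sum>i<s. \<eta> i p v *\<^sub>R \<xi> i p)) (\<phi> p u)"
      unfolding phi2[OF v, symmetric] by (rule gsym[OF \<phi>T[OF u] \<phi>T[OF \<phi>T[OF v]]])
    also have "\<dots> = - g p v (\<phi> p u) + g p (\<Sum>i<s. \<eta> i p v *\<^sub>R \<xi> i p) (\<phi> p u)"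
      unfolding gadd[OF subspace_neg[OF sub v] V \<phi>T[OF u]] gneg[OF v \<phi>T[OF u]] by (rule refl)
    also have "g p (\<Sum>i<s. \<eta> i p v *\<^sub>R \<xi> i p) (\<phi> p u) = (\<Sum>i<s. \<eta> i p v * g p (\<xi> i p) (\<phi> p u))"
      using u \<xi>T by (subst gsum) (auto simp: gsc \<phi>T subspace_scale[OF sub])
    also have "\<dots> = 0" using u by (auto simp: g\<xi> \<phi>T \<eta>\<phi> intro!: sum.neutral)
    finally show ?thesis by simp
  qed
  define t where "t i = g p (X p) (\<phi> p (Y p)) *\<^sub>R \<xi> i p - \<eta> i p (X p) *\<^sub>R \<phi> p (Y p)
    + \<eta> i p (Y p) *\<^sub>R \<phi> p (X p)" for i
  have tT: "t i \<in> ?T" if "i < s" for i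
    unfolding t_def using that T \<xi>T \<phi>T
    by (intro subspace_add[OF sub] subspace_diff[OF sub] subspace_scale[OF sub]) auto
  have sum_app: "(\<Sum>i\<in>I. h i) p = (\<Sum>i\<in>I. h i p)" for I :: "nat set" and h :: "nat \<Rightarrow> 'a vfield"
    by (induction I rule: infinite_finite_induct) auto
  have "char_torsion s \<phi> \<xi> \<eta> g X Y p = 2 *\<^sub>R (\<Sum>i<s. t i)"
    unfolding char_torsion_def scaleR_fun_def[of 2 "_ :: 'a vfield"] sum_app
    by (simp add: t_def fscale_def on_fields_def form_on_fields_def bilin_on_fields_def
        fundamental_form_def)
  moreover have "(\<Sum>i<s. t i) \<in> ?T" using tT by (intro subspace_sum[OF sub]) auto
  moreover have "g p (\<Sum>i<s. t i) (Z p) = (\<Sum>i<s. g p (t i) (Z p))"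
    using tT by (intro gsum T) auto
  ultimately have "bilin_on_fields g (char_torsion s \<phi> \<xi> \<eta> g X Y) Z p =
      2 * (\<Sum>i<s. g p (t i) (Z p))"
    by (simp only: bilin_on_fields_def gsc[OF _ T(3)])
  also have "\<dots> = (\<Sum>i<s. 2 * g p (t i) (Z p))" by (simp add: sum_distrib_left)
  also have "\<dots> = (\<Sum>i<s. form_on_fields (\<eta> i) X p * ext_deriv A (\<eta> i) Y Z p
          + form_on_fields (\<eta> i) Y p * ext_deriv A (\<eta> i) Z X p
          + form_on_fields (\<eta> i) Z p * ext_deriv A (\<eta> i) X Y p)"
  proof (rule sum.cong[OF refl])
    fix i assume "i \<in> {..<s}"
    then have i: "i < s" by simp
    have d: "ext_deriv A (\<eta> i) U V p = 2 * g p (U p) (\<phi> p (V p))"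
      if "U \<in> vector_fields A" "V \<in> vector_fields A" for U V
      using M i that by (simp add: bilin_on_fields_def fundamental_form_def)
    have "g p (t i) (Z p) = g p (X p) (\<phi> p (Y p)) * \<eta> i p (Z p)
        - \<eta> i p (X p) * g p (Z p) (\<phi> p (Y p)) + \<eta> i p (Y p) * g p (Z p) (\<phi> p (X p))"
    proof -
      let ?a = "g p (X p) (\<phi> p (Y p)) *\<^sub>R \<xi> i p" and ?b = "(- \<eta> i p (X p)) *\<^sub>R \<phi> p (Y p)"
        and ?c = "\<eta> i p (Y p) *\<^sub>R \<phi> p (X p)"
      have abc: "?a \<in> ?T" "?b \<in> ?T" "?c \<in> ?T"
        using T \<xi>T[OF i] \<phi>T by (intro subspace_scale[OF sub]; blast)+
      have "t i = ?a + ?b + ?c"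
        unfolding t_def scaleR_minus_left diff_conv_add_uminus by (rule refl)
      then have "g p (t i) (Z p) = g p ?a (Z p) + g p ?b (Z p) + g p ?c (Z p)"
        by (simp only: gadd[OF subspace_add[OF sub abc(1,2)] abc(3) T(3)]
            gadd[OF abc(1,2) T(3)])
      moreover have "g p ?a (Z p) = g p (X p) (\<phi> p (Y p)) * \<eta> i p (Z p)"
        by (simp only: gsc[OF \<xi>T[OF i] T(3)] g\<xi>[OF i T(3)])
      moreover have "g p ?b (Z p) = - \<eta> i p (X p) * g p (Z p) (\<phi> p (Y p))"
        by (simp only: gsc[OF \<phi>T[OF T(2)] T(3)] gsym[OF \<phi>T[OF T(2)] T(3)])
      moreover have "g p ?c (Z p) = \<eta> i p (Y p) * g p (Z p) (\<phi> p (X p))"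
        by (simp only: gsc[OF \<phi>T[OF T(1)] T(3)] gsym[OF \<phi>T[OF T(1)] T(3)])
      ultimately show ?thesis by simp
    qed
    then show "2 * g p (t i) (Z p) = form_on_fields (\<eta> i) X p * ext_deriv A (\<eta> i) Y Z p
          + form_on_fields (\<eta> i) Y p * ext_deriv A (\<eta> i) Z X p
          + form_on_fields (\<eta> i) Z p * ext_deriv A (\<eta> i) X Y p"
      using skew[OF T(3) T(2)] by (simp add: d XYZ form_on_fields_def algebra_simps)
  qed
  finally show ?thesis .
qed

definition char_connection ::
    "nat \<Rightarrow> ('a \<Rightarrow> 'a tvec \<Rightarrow> 'a tvec) \<Rightarrow> (nat \<Rightarrow> 'a vfield) \<Rightarrow> (nat \<Rightarrow> 'a \<Rightarrow> 'a tvec \<Rightarrow> real) \<Rightarrow>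
     ('a \<Rightarrow> 'a tvec \<Rightarrow> 'a tvec \<Rightarrow> real) \<Rightarrow> ('a vfield \<Rightarrow> 'a vfield \<Rightarrow> 'a vfield) \<Rightarrow>
     'a vfield \<Rightarrow> 'a vfield \<Rightarrow> 'a vfield" where
  "char_connection s \<phi> \<xi> \<eta> g nabla_g X Y =
     nabla_g X Y + (1 / 2) *\<^sub>R char_torsion s \<phi> \<xi> \<eta> g X Y"

definition ricci_flat ::
    "('a::topological_space, 'e::euclidean_space) atlas \<Rightarrow> ('a \<Rightarrow> 'a tvec \<Rightarrow> 'a tvec \<Rightarrow> real) \<Rightarrow>
     ('a vfield \<Rightarrow> 'a vfield \<Rightarrow> 'a vfield) \<Rightarrow> bool" where
  "ricci_flat A g D \<longleftrightarrow>
     (\<forall>U\<in>vector_fields A. \<forall>V\<in>vector_fields A. \<forall>p.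
        ricci A g (tangent_space A) DIM('e) D U V p = 0)"

section \<open>Transverse geometry\<close>

definition horizontal ::
    "('a, 'e::euclidean_space) atlas \<Rightarrow> ('a \<Rightarrow> 'a tvec \<Rightarrow> 'a tvec) \<Rightarrow> 'a \<Rightarrow> 'a tvec set" where
  "horizontal A \<phi> p = \<phi> p ` tangent_space A p"

definition vertical ::
    "('a, 'e::euclidean_space) atlas \<Rightarrow> ('a \<Rightarrow> 'a tvec \<Rightarrow> 'a tvec) \<Rightarrow> 'a \<Rightarrow> 'a tvec set" where
  "vertical A \<phi> p = {u \<in> tangent_space A p. \<phi> p u = 0}"

definition hor_part ::
    "('a, 'e::euclidean_space) atlas \<Rightarrow> ('a \<Rightarrow> 'a tvec \<Rightarrow> 'a tvec) \<Rightarrow> 'a vfield \<Rightarrow> 'a vfield" where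
  "hor_part A \<phi> X = (\<lambda>p. THE w. w \<in> horizontal A \<phi> p \<and> X p - w \<in> vertical A \<phi> p)"

definition ver_part ::
    "('a, 'e::euclidean_space) atlas \<Rightarrow> ('a \<Rightarrow> 'a tvec \<Rightarrow> 'a tvec) \<Rightarrow> 'a vfield \<Rightarrow> 'a vfield" where
  "ver_part A \<phi> X = X - hor_part A \<phi> X"

text \<open>
  The two defining cases, for horizontal and for vertical \<open>X\<close>, are extended additively to
  arbitrary \<open>X\<close>.
\<close>

definition transverse_connection ::
    "('a, 'e::euclidean_space) atlas \<Rightarrow> ('a \<Rightarrow> 'a tvec \<Rightarrow> 'a tvec) \<Rightarrow>
     ('a vfield \<Rightarrow> 'a vfield \<Rightarrow> 'a vfield) \<Rightarrow> 'a vfield \<Rightarrow> 'a vfield \<Rightarrow> 'a vfield" where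
  "transverse_connection A \<phi> nabla_g X Y =
     hor_part A \<phi> (nabla_g (hor_part A \<phi> X) Y) + hor_part A \<phi> (lie_bracket A (ver_part A \<phi> X) Y)"

definition transverse_ricci ::
    "('a::topological_space, 'e::euclidean_space) atlas \<Rightarrow> nat \<Rightarrow> ('a \<Rightarrow> 'a tvec \<Rightarrow> 'a tvec) \<Rightarrow>
     ('a \<Rightarrow> 'a tvec \<Rightarrow> 'a tvec \<Rightarrow> real) \<Rightarrow> ('a vfield \<Rightarrow> 'a vfield \<Rightarrow> 'a vfield) \<Rightarrow>
     'a vfield \<Rightarrow> 'a vfield \<Rightarrow> 'a \<Rightarrow> real" where
  "transverse_ricci A n \<phi> g nabla_g =
     ricci A g (horizontal A \<phi>) (2 * n) (transverse_connection A \<phi> nabla_g)"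

text \<open>
  The transverse structure of an S-manifold is automatically Kaehler, so only the Einstein
  condition appears.
\<close>

definition transverse_kaehler_einstein ::
    "('a::topological_space, 'e::euclidean_space) atlas \<Rightarrow> nat \<Rightarrow> ('a \<Rightarrow> 'a tvec \<Rightarrow> 'a tvec) \<Rightarrow>
     ('a \<Rightarrow> 'a tvec \<Rightarrow> 'a tvec \<Rightarrow> real) \<Rightarrow> ('a vfield \<Rightarrow> 'a vfield \<Rightarrow> 'a vfield) \<Rightarrow> real \<Rightarrow> bool" where
  "transverse_kaehler_einstein A n \<phi> g nabla_g lam \<longleftrightarrow>
     (\<forall>X\<in>sections A (horizontal A \<phi>). \<forall>Y\<in>sections A (horizontal A \<phi>). \<forall>p.
        transverse_ricci A n \<phi> g nabla_g X Y p = lam * bilin_on_fields g X Y p)"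

end

theory Submission
  imports Defs
begin

text \<open>
  Write \<open>\<nabla>\<close> for the characteristic and \<open>\<nabla>\<^sup>T\<close> for the transverse connection, \<open>R\<close> and \<open>R\<^sup>T\<close> for their
  curvatures. On horizontal fields \<open>Y\<close> one has \<open>\<nabla>\<^sup>T\<^sub>U Y = \<nabla>\<^sub>U Y + 2 (\<Sum>i. \<eta>\<^sub>i U) \<phi> Y\<close>, and since
  \<open>\<eta>\<^sub>i [X, Z] = - 2 F(X, Z)\<close> for horizontal \<open>X\<close>, \<open>Z\<close>, this gives
  \<open>R\<^sup>T(X, Z) W = R(X, Z) W + 4 s F(X, Z) \<phi> W\<close>. Tracing over a horizontal orthonormal frame, which
  suffices because \<open>\<nabla>\<xi>\<^sub>i = 0\<close>, yields \<open>Ric\<^sup>T = Ric + 4 s g\<close> on horizontal fields.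

  It remains to see that \<open>Ric\<close> vanishes as soon as one argument is a \<open>\<xi>\<^sub>i\<close>. In the second slot
  this follows from \<open>\<nabla>\<xi>\<^sub>i = 0\<close>. For the first slot, \<open>\<nabla>\<^sub>\<xi> = L\<^sub>\<xi> - 2 \<phi>\<close>, and the Lie derivative
  \<open>L\<^sub>\<xi> \<nabla>\<close> vanishes because it is symmetric and skew in overlapping pairs of slots. So on
  horizontal fields and up to vertical terms \<open>R(\<xi>, Z) W = 2 (\<nabla>\<^sub>Z \<phi>) W\<close>, whose trace is zero
  because \<open>dF = 0\<close>, as for almost Kaehler manifolds.

  Ricci tensors are traces over an arbitrarily chosen frame, so one also needs that local
  orthonormal frames exist, which rests on bump functions, on Hadamard's lemma (finite dimension
  of the spaces of derivations) and on the Gram-Schmidt process.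
\<close>

section \<open>Functions of class C^k on open sets\<close>

text \<open>Connections act on global fields only and \<open>ricci\<close> takes its frame by
  choice, so nothing is pointwise from the start. Linearity over the smooth functions replaces
  localization: a bump function turns a frame near p into a global expansion, and linearity then
  forces dependence on the values at p alone. The analytic half of the development serves this
  purpose. The 2 in the comparison of the two connections comes from the Reeb directions: there the
  transverse connection is the Lie derivative, while the torsion T(\<xi>, Y) = - 2 \<phi> Y shifts
  the characteristic one by - 2 \<phi>. Each of the s Reeb fields contributes one such term. The
  curvature of a connection with torsion has no pair symmetry a priori, so Ric(U, \<xi>) = 0 does
  not by itself give Ric(\<xi>, V) = 0. Hence the separate argument for the first slot.\<close>

lemma Ck_on_imp_continuous_on: "Ck_on k S f \<Longrightarrow> continuous_on S f"
  by (cases k) (auto intro: differentiable_imp_continuous_on)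

lemma Ck_on_SucD: "Ck_on (Suc k) S f \<Longrightarrow> Ck_on k S f"
proof (induction k arbitrary: f)
  case 0
  then show ?case by (simp add: differentiable_imp_continuous_on)
next
  case (Suc k)
  show ?case
    unfolding Ck_on.simps(2)[of k]
  proof (intro conjI allI)
    show "f differentiable_on S" using Suc.prems by simp
    fix v
    have "Ck_on (Suc k) S (\<lambda>x. frechet_derivative f (at x) v)"
      using Suc.prems unfolding Ck_on.simps(2)[of "Suc k"] by blast
    then show "Ck_on k S (\<lambda>x. frechet_derivative f (at x) v)" by (rule Suc.IH)
  qed
qed

lemma Ck_on_cong:
  assumes "open S" "\<And>x. x \<in> S \<Longrightarrow> f x = g x" "Ck_on k S f"
  shows "Ck_on k S g"
  using assms(2,3)
proof (induction k arbitrary: f g)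
  case 0
  then show ?case using continuous_on_cong[of S S f g] by simp
next
  case (Suc k)
  have df: "f differentiable_on S" using Suc.prems by simp
  have 1: "frechet_derivative f (at x) = frechet_derivative g (at x)" if "x \<in> S" for x
    using df assms(1) Suc.prems(1) that
    by (intro frechet_derivative_transform_within_open[of f x S])
       (auto simp: differentiable_on_eq_differentiable_at)
  have "Ck_on k S (\<lambda>x. frechet_derivative g (at x) v)" for v
    by (rule Suc.IH[of "\<lambda>x. frechet_derivative f (at x) v"]) (use Suc.prems(2) in \<open>simp_all add: 1\<close>)
  moreover have "g differentiable_on S"
    unfolding differentiable_on_def
  proof
    fix x assume x: "x \<in> S"
    then have "f differentiable at x within S" using df by (simp add: differentiable_on_def)
    then show "g differentiable at x within S"
      by (rule differentiable_transform_within[OF _ zero_less_one x]) (rule Suc.prems(1))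
  qed
  ultimately show ?case by simp
qed

lemma Ck_on_has_derivative:
  assumes "open S" "Ck_on (Suc k) S f" "x \<in> S"
  shows "(f has_derivative frechet_derivative f (at x)) (at x)"
  using assms by (simp add: differentiable_on_eq_differentiable_at frechet_derivative_works[symmetric])

text \<open>Frees the induction step from \<open>frechet_derivative\<close>: any explicit family of
  derivatives may be used, which is how the Leibniz rule, the chain rule and differentiation under
  the integral enter below.\<close>

lemma Ck_on_SucI:
  assumes S: "open S" and d: "\<And>x. x \<in> S \<Longrightarrow> (f has_derivative f' x) (at x)"
    and "\<And>v. Ck_on k S (\<lambda>x. f' x v)"
  shows "Ck_on (Suc k) S f"
proof -
  have eq: "f' x = frechet_derivative f (at x)" if "x \<in> S" for x
    using d[OF that] by (rule frechet_derivative_at)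
  have "f differentiable_on S"
    unfolding differentiable_on_eq_differentiable_at[OF S] using d differentiable_def by blast
  moreover have "Ck_on k S (\<lambda>x. frechet_derivative f (at x) v)" for v
    by (rule Ck_on_cong[OF S _ assms(3)[of v]]) (simp add: eq)
  ultimately show ?thesis by simp
qed

lemma Ck_on_subset:
  assumes "Ck_on k S f" "T \<subseteq> S"
  shows "Ck_on k T f"
  using assms
  by (induction k arbitrary: f) (auto intro: continuous_on_subset differentiable_on_subset)

lemma Ck_on_local:
  assumes "open S" "\<And>x. x \<in> S \<Longrightarrow> \<exists>U. open U \<and> x \<in> U \<and> Ck_on k U f"
  shows "Ck_on k S f"
  using assms(2)
proof (induction k arbitrary: f)
  case 0
  then have "\<forall>x\<in>S. isCont f x" using continuous_on_interior[of _ f] interior_open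
    by (metis Ck_on.simps(1))
  then show ?case using continuous_at_imp_continuous_on by auto
next
  case (Suc k)
  have "f differentiable_on S"
    unfolding differentiable_on_eq_differentiable_at[OF assms(1)]
    using Suc.prems differentiable_on_eq_differentiable_at[of _ f] by fastforce
  moreover have "Ck_on k S (\<lambda>x. frechet_derivative f (at x) v)" for v
    by (rule Suc.IH) (use Suc.prems in fastforce)
  ultimately show ?case by simp
qed

lemma Ck_on_const [simp]: "Ck_on k S (\<lambda>x. c)"
  by (induction k arbitrary: c) auto

lemma Ck_on_add:
  assumes "open S" "Ck_on k S f" "Ck_on k S g"
  shows "Ck_on k S (\<lambda>x. f x + g x)"
  using assms(2,3)
proof (induction k arbitrary: f g)
  case 0
  then show ?case by (simp add: continuous_on_add)
next
  case (Suc k)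
  show ?case
    by (rule Ck_on_SucI[OF assms(1) has_derivative_add[OF Ck_on_has_derivative Ck_on_has_derivative]])
       (use Suc assms(1) in auto)
qed

lemma Ck_on_linear:
  assumes "open S" "bounded_linear L" "Ck_on k S f"
  shows "Ck_on k S (\<lambda>x. L (f x))"
  using assms(3)
proof (induction k arbitrary: f)
  case 0
  then show ?case using bounded_linear.continuous_on[OF assms(2)] by simp
next
  case (Suc k)
  show ?case
    by (rule Ck_on_SucI[OF assms(1) bounded_linear.has_derivative[OF assms(2) Ck_on_has_derivative]])
       (use Suc assms(1) in auto)
qed

lemma Ck_on_scaleR:
  fixes a :: "'e::euclidean_space \<Rightarrow> real"
  assumes "open S" "Ck_on k S a" "Ck_on k S f"
  shows "Ck_on k S (\<lambda>x. a x *\<^sub>R f x)"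
  using assms(2,3)
proof (induction k arbitrary: a f)
  case 0
  then show ?case by (simp add: continuous_on_scaleR)
next
  case (Suc k)
  show ?case
  proof (rule Ck_on_SucI[OF assms(1) has_derivative_scaleR])
    fix x assume "x \<in> S"
    then show "(a has_derivative frechet_derivative a (at x)) (at x)"
      and "(f has_derivative frechet_derivative f (at x)) (at x)"
      using Suc.prems assms(1) Ck_on_has_derivative by blast+
  next
    fix v
    show "Ck_on k S (\<lambda>x. a x *\<^sub>R frechet_derivative f (at x) v + frechet_derivative a (at x) v *\<^sub>R f x)"
      using Suc.prems Ck_on_SucD[OF Suc.prems(1)] Ck_on_SucD[OF Suc.prems(2)]
      by (intro Ck_on_add assms(1) Suc.IH) auto
  qed
qed

lemma Ck_on_sum:
  assumes "open S" "\<And>i. i \<in> I \<Longrightarrow> Ck_on k S (f i)"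
  shows "Ck_on k S (\<lambda>x. \<Sum>i\<in>I. f i x)"
  using assms(2) by (induction I rule: infinite_finite_induct) (auto intro: Ck_on_add assms(1))

lemma Ck_on_id: 
  assumes "open S" shows "Ck_on k S (\<lambda>x. x)"
  by (cases k) (auto intro: Ck_on_SucI[OF assms has_derivative_ident])

text \<open>\<open>Ck_on\<close> controls derivatives in fixed directions, whereas the chain rule
  differentiates f in the moving direction given by the derivative of h. Expanding that direction in
  the basis leaves products of functions of class C^k.\<close>

lemma Ck_on_compose:
  fixes f :: "'b::euclidean_space \<Rightarrow> 'c::real_normed_vector" and h :: "'e::euclidean_space \<Rightarrow> 'b"
  assumes S: "open S" and T: "open T" and "Ck_on k T f" "Ck_on k S h" and hT: "h ` S \<subseteq> T"
  shows "Ck_on k S (\<lambda>x. f (h x))"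
  using assms(3,4)
proof (induction k arbitrary: f)
  case 0
  then show ?case using continuous_on_compose2[of T f S h] hT by simp
next
  case (Suc k)
  let ?D = "\<lambda>x v. \<Sum>i\<in>Basis. (frechet_derivative h (at x) v \<bullet> i) *\<^sub>R frechet_derivative f (at (h x)) i"
  show ?case
  proof (rule Ck_on_SucI[OF S, where f' = ?D])
    fix x assume x: "x \<in> S"
    have df: "(f has_derivative frechet_derivative f (at (h x))) (at (h x))"
      using Ck_on_has_derivative[OF T Suc.prems(1)] x hT by blast
    have dh: "(h has_derivative frechet_derivative h (at x)) (at x)"
      using Ck_on_has_derivative[OF S Suc.prems(2) x] .
    have lin: "linear (frechet_derivative f (at (h x)))" using df has_derivative_linear by blast
    have "frechet_derivative f (at (h x)) (frechet_derivative h (at x) v) = ?D x v" for v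
      by (subst euclidean_representation[symmetric, of "frechet_derivative h (at x) v"])
         (simp only: linear_sum[OF lin] linear_cmul[OF lin])
    then show "((\<lambda>x. f (h x)) has_derivative ?D x) (at x)"
      using has_derivative_compose[OF dh df] by simp
  next
    fix v
    have h: "Ck_on k S h" using Suc.prems(2) by (rule Ck_on_SucD)
    show "Ck_on k S (\<lambda>x. ?D x v)"
    proof (intro Ck_on_sum Ck_on_scaleR S)
      fix i :: 'b
      show "Ck_on k S (\<lambda>x. frechet_derivative h (at x) v \<bullet> i)"
        using Suc.prems(2) by (intro Ck_on_linear[OF S bounded_linear_inner_left]) simp
      show "Ck_on k S (\<lambda>x. frechet_derivative f (at (h x)) i)"
        by (rule Suc.IH) (use Suc.prems(1) h in auto)
    qed
  qed
qed

section \<open>Closure properties of smooth maps between Euclidean spaces\<close>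

lemma smooth_on_imp_continuous_on: "smooth_on S f \<Longrightarrow> continuous_on S f"
  by (metis Ck_on.simps(1) smooth_on_def)

lemma smooth_on_has_derivative:
  "open S \<Longrightarrow> smooth_on S f \<Longrightarrow> x \<in> S \<Longrightarrow> (f has_derivative frechet_derivative f (at x)) (at x)"
  by (metis Ck_on_has_derivative smooth_on_def)

lemma smooth_on_frechet_derivative:
  assumes "smooth_on S f"
  shows "smooth_on S (\<lambda>x. frechet_derivative f (at x) v)"
  unfolding smooth_on_def
proof
  fix k
  have "Ck_on (Suc k) S f" using assms unfolding smooth_on_def by blast
  then show "Ck_on k S (\<lambda>x. frechet_derivative f (at x) v)" by simp
qed

lemma smooth_on_cong: "open S \<Longrightarrow> (\<And>x. x \<in> S \<Longrightarrow> f x = g x) \<Longrightarrow> smooth_on S f \<Longrightarrow> smooth_on S g"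
  using Ck_on_cong[of S f g] by (simp add: smooth_on_def)

lemma smooth_on_subset: "smooth_on S f \<Longrightarrow> T \<subseteq> S \<Longrightarrow> smooth_on T f"
  using Ck_on_subset[of _ S f T] by (simp add: smooth_on_def)

lemma smooth_on_local:
  assumes "open S" "\<And>x. x \<in> S \<Longrightarrow> \<exists>U. open U \<and> x \<in> U \<and> smooth_on U f"
  shows "smooth_on S f"
  unfolding smooth_on_def
proof
  fix k show "Ck_on k S f"
    using assms by (intro Ck_on_local) (auto simp: smooth_on_def)
qed

lemma smooth_on_const: "smooth_on S (\<lambda>x. c)"
  by (simp add: smooth_on_def)

lemma smooth_on_id: "open S \<Longrightarrow> smooth_on S (\<lambda>x. x)"
  by (simp add: smooth_on_def Ck_on_id)

lemma smooth_on_add: "open S \<Longrightarrow> smooth_on S f \<Longrightarrow> smooth_on S g \<Longrightarrow> smooth_on S (\<lambda>x. f x + g x)"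
  by (simp add: smooth_on_def Ck_on_add)

lemma smooth_on_linear: "open S \<Longrightarrow> bounded_linear L \<Longrightarrow> smooth_on S f \<Longrightarrow> smooth_on S (\<lambda>x. L (f x))"
  by (simp add: smooth_on_def Ck_on_linear)

lemma smooth_on_mult:
  fixes f g :: "'e::euclidean_space \<Rightarrow> real"
  shows "open S \<Longrightarrow> smooth_on S f \<Longrightarrow> smooth_on S g \<Longrightarrow> smooth_on S (\<lambda>x. f x * g x)"
  using Ck_on_scaleR[of S _ f g] by (simp add: smooth_on_def)

lemma smooth_on_sum:
  "open S \<Longrightarrow> (\<And>i. i \<in> I \<Longrightarrow> smooth_on S (f i)) \<Longrightarrow> smooth_on S (\<lambda>x. \<Sum>i\<in>I. f i x)"
  by (simp add: smooth_on_def Ck_on_sum)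

lemma smooth_on_compose:
  fixes f :: "'b::euclidean_space \<Rightarrow> 'c::real_normed_vector" and h :: "'e::euclidean_space \<Rightarrow> 'b"
  assumes "open S" "open T" "smooth_on T f" "smooth_on S h" "h ` S \<subseteq> T"
  shows "smooth_on S (\<lambda>x. f (h x))"
  using assms Ck_on_compose[of S T _ f h] by (simp add: smooth_on_def)

subsection \<open>Cutoff functions\<close>

text \<open>The family is closed under differentiation, \<open>h k' = h (k + 2) - k * h (k + 1)\<close>.\<close>

definition flat_exp :: "nat \<Rightarrow> real \<Rightarrow> real" where
  "flat_exp k x = (if x > 0 then inverse x ^ k * exp (- inverse x) else 0)"

text \<open>Away from 0 the formula is computed on a half-line. At 0 both one-sided difference
  quotients tend to 0; on the right the substitution y = 1/x turns the quotient into y^(k+1) / exp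
  y.\<close>

lemma flat_exp_has_derivative:
  "(flat_exp k has_real_derivative flat_exp (k + 2) x - real k * flat_exp (k + 1) x) (at x)"
proof (cases x "0::real" rule: linorder_cases)
  case greater
  define i where "i = inverse x"
  have i: "((\<lambda>x. inverse x) has_real_derivative - i\<^sup>2) (at x)"
    using DERIV_inverse[of x] greater by (simp add: i_def power2_eq_square numeral_2_eq_2)
  have "((\<lambda>x. inverse x ^ k * exp (- inverse x)) has_real_derivative
      real k * i ^ (k - 1) * - i\<^sup>2 * exp (- i) + i ^ k * (exp (- i) * i\<^sup>2)) (at x)"
    by (rule derivative_eq_intros refl i)+ (simp add: i_def)
  also have "real k * i ^ (k - 1) * - i\<^sup>2 * exp (- i) + i ^ k * (exp (- i) * i\<^sup>2) =
      flat_exp (k + 2) x - real k * flat_exp (k + 1) x"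
    using greater
    by (cases k) (simp_all add: flat_exp_def i_def[symmetric] power2_eq_square algebra_simps)
  finally have "((\<lambda>x. inverse x ^ k * exp (- inverse x)) has_real_derivative
      flat_exp (k + 2) x - real k * flat_exp (k + 1) x) (at x)" .
  then show ?thesis
    by (rule has_field_derivative_transform_within_open[where S = "{0<..}"])
       (use greater in \<open>auto simp: flat_exp_def\<close>)
next
  case less
  have "((\<lambda>x. 0) has_real_derivative flat_exp (k + 2) x - real k * flat_exp (k + 1) x) (at x)"
    using less by (simp add: flat_exp_def)
  then show ?thesis
    by (rule has_field_derivative_transform_within_open[where S = "{..<0}"])
       (use less in \<open>auto simp: flat_exp_def\<close>)
next
  case equal
  have "((\<lambda>y::real. y ^ Suc k / exp y) \<longlongrightarrow> 0) at_top"
    by (rule tendsto_power_div_exp_0)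
  then have "((\<lambda>x. inverse x ^ Suc k / exp (inverse x)) \<longlongrightarrow> (0::real)) (at_right 0)"
    by (rule filterlim_compose[OF _ filterlim_inverse_at_top_right])
  then have "((\<lambda>y. flat_exp k y / y) \<longlongrightarrow> 0) (at_right 0)"
    by (rule Lim_transform_eventually)
       (auto simp: eventually_at_right_field flat_exp_def exp_minus field_simps intro: exI[of _ 1])
  moreover have "((\<lambda>y. flat_exp k y / y) \<longlongrightarrow> 0) (at_left 0)"
    by (rule Lim_transform_eventually[OF tendsto_const])
       (auto simp: eventually_at_left_field flat_exp_def intro: exI[of _ "-1"])
  ultimately have "((\<lambda>y. flat_exp k y / y) \<longlongrightarrow> 0) (at 0)"
    using filterlim_split_at by blast
  then show ?thesis
    by (simp add: has_field_derivative_iff equal flat_exp_def[of _ 0])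
qed

text \<open>Induction on the order with the index i free: each derivative is again a combination of
  members of the family. Shared by the flat exponentials and, with b = 0, by the powers of a
  positive variable.\<close>

lemma smooth_on_realI:
  fixes f :: "nat \<Rightarrow> real \<Rightarrow> real"
  assumes "open S" and d: "\<And>i x. x \<in> S \<Longrightarrow> (f i has_real_derivative a i * f (i + 1) x + b i * f (i + 2) x) (at x)"
  shows "smooth_on S (f i)"
proof -
  have "Ck_on k S (f i)" for k
  proof (induction k arbitrary: i)
    case 0
    have "continuous_on S (f i)"
      by (rule continuous_at_imp_continuous_on) (use DERIV_isCont[OF d] in blast)
    then show ?case by simp
  next
    case (Suc k)
    show ?case
    proof (rule Ck_on_SucI[OF assms(1)])
      show "x \<in> S \<Longrightarrow> (f i has_derivative (\<lambda>v. (a i * f (i + 1) x + b i * f (i + 2) x) *\<^sub>R v)) (at x)" for x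
        using d[of x i] by (simp add: has_field_derivative_def)
      show "Ck_on k S (\<lambda>x. (a i * f (i + 1) x + b i * f (i + 2) x) *\<^sub>R v)" for v
        unfolding real_scaleR_def[symmetric]
        by (rule Ck_on_scaleR[OF assms(1) Ck_on_add[OF assms(1)
          Ck_on_scaleR[OF assms(1) Ck_on_const Suc] Ck_on_scaleR[OF assms(1) Ck_on_const Suc]] Ck_on_const])
    qed
  qed
  then show ?thesis by (simp add: smooth_on_def)
qed

lemma smooth_on_flat_exp: "smooth_on UNIV (flat_exp k)"
  by (rule smooth_on_realI[where a = "\<lambda>k. - real k" and b = "\<lambda>k. 1"])
     (use flat_exp_has_derivative in \<open>simp_all add: algebra_simps\<close>)

lemma smooth_on_powr: "smooth_on {0<..} (\<lambda>x::real. x powr r)"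
proof -
  have "smooth_on {0<..} ((\<lambda>i x. x powr (r - real i)) 0)"
    by (rule smooth_on_realI[where a = "\<lambda>i. r - real i" and b = "\<lambda>i. 0"])
       (auto intro!: derivative_eq_intros simp: algebra_simps)
  then show ?thesis by simp
qed

lemma flat_exp_pos: "x > 0 \<Longrightarrow> flat_exp k x > 0"
  by (simp add: flat_exp_def)

lemma flat_exp_nonneg: "flat_exp k x \<ge> 0"
  by (simp add: flat_exp_def)

text \<open>The usual quotient of flat functions, with the reciprocal written as
  \<open>powr (- 1)\<close> so that smoothness reduces to a composition with
  \<open>smooth_on_powr\<close>. For a < b the two summands of the denominator are never both
  zero.\<close>

definition cutoff :: "real \<Rightarrow> real \<Rightarrow> real \<Rightarrow> real" where
  "cutoff a b t = flat_exp 0 (t - a) * (flat_exp 0 (t - a) + flat_exp 0 (b - t)) powr (- 1)"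

lemma cutoff_eq_0: "t \<le> a \<Longrightarrow> cutoff a b t = 0"
  by (simp add: cutoff_def flat_exp_def)

lemma cutoff_eq_1: "a < b \<Longrightarrow> b \<le> t \<Longrightarrow> cutoff a b t = 1"
  by (simp add: cutoff_def flat_exp_def powr_minus)

lemma smooth_on_cutoff:
  assumes "a < b" shows "smooth_on UNIV (cutoff a b)"
proof -
  have l: "smooth_on UNIV (\<lambda>t::real. t + - a)" and r: "smooth_on UNIV (\<lambda>t::real. b + - 1 * t)"
    by (intro smooth_on_add smooth_on_mult smooth_on_id smooth_on_const open_UNIV)+
  have l: "smooth_on UNIV (\<lambda>t. flat_exp 0 (t - a))"
    using smooth_on_compose[OF _ _ smooth_on_flat_exp l] by simp
  have r: "smooth_on UNIV (\<lambda>t. flat_exp 0 (b - t))"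
    using smooth_on_compose[OF _ _ smooth_on_flat_exp r] by simp
  have pos: "flat_exp 0 (t - a) + flat_exp 0 (b - t) > 0" for t
    using assms flat_exp_pos[of "t - a" 0] flat_exp_pos[of "b - t" 0]
      flat_exp_nonneg[of 0 "t - a"] flat_exp_nonneg[of 0 "b - t"] by (cases "t > a") auto
  show ?thesis
    unfolding cutoff_def
    by (intro smooth_on_mult l smooth_on_compose[OF _ _ smooth_on_powr] smooth_on_add r)
       (use pos in auto)
qed

text \<open>Normalizing a field needs the inverse root of a smooth function that may vanish far
  away, while \<open>CF_compose\<close> asks for a factor smooth on the whole line. So the power is
  switched off below c/4 and is exact above c/2.\<close>

lemma exists_smooth_inverse_sqrt:
  assumes "c > 0"
  obtains \<theta> :: "real \<Rightarrow> real" where "smooth_on UNIV \<theta>" "\<And>t. t > c / 2 \<Longrightarrow> \<theta> t = t powr (- (1 / 2))"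
proof
  define \<theta> where "\<theta> t = cutoff (c / 4) (c / 2) t * t powr (- (1 / 2))" for t
  show "smooth_on UNIV \<theta>"
  proof (rule smooth_on_local)
    fix x :: real
    show "\<exists>U. open U \<and> x \<in> U \<and> smooth_on U \<theta>"
    proof (cases "x > 0")
      case True
      have "smooth_on {0<..} \<theta>"
        unfolding \<theta>_def using assms
        by (intro smooth_on_mult smooth_on_powr smooth_on_subset[OF smooth_on_cutoff]) auto
      then show ?thesis using True by (intro exI[of _ "{0<..}"]) auto
    next
      case False
      have "smooth_on {..<c / 4} \<theta>"
        by (rule smooth_on_cong[OF _ _ smooth_on_const[of _ 0]]) (auto simp: \<theta>_def cutoff_eq_0)
      then show ?thesis using False assms by (intro exI[of _ "{..<c/4}"]) auto
    qed
  qed simp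
  show "\<theta> t = t powr (- (1 / 2))" if "t > c / 2" for t
    using that assms by (simp add: \<theta>_def cutoff_eq_1)
qed

lemma exists_smooth_bump:
  fixes x0 :: "'e::euclidean_space"
  assumes "r > 0"
  obtains \<beta> :: "'e \<Rightarrow> real" where "smooth_on UNIV \<beta>" "\<beta> x0 = 1" "\<And>x. x \<notin> ball x0 r \<Longrightarrow> \<beta> x = 0"
proof
  \<comment> \<open>The squared distance is polynomial, hence smooth at \<open>x0\<close> as
    well.\<close>
  define \<beta> where "\<beta> x = cutoff 0 (r\<^sup>2) (r\<^sup>2 - (x - x0) \<bullet> (x - x0))" for x
  have "smooth_on UNIV (\<lambda>x. r\<^sup>2 + - 1 * (\<Sum>i\<in>Basis. ((x \<bullet> i) + - (x0 \<bullet> i)) * ((x \<bullet> i) + - (x0 \<bullet> i))))"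
    by (intro smooth_on_add smooth_on_mult smooth_on_sum smooth_on_const open_UNIV
        smooth_on_linear[OF open_UNIV bounded_linear_inner_left smooth_on_id])
  moreover have "(\<Sum>i\<in>Basis. ((x \<bullet> i) + - (x0 \<bullet> i)) * ((x \<bullet> i) + - (x0 \<bullet> i))) = (x - x0) \<bullet> (x - x0)" for x
    by (subst euclidean_inner) (simp add: inner_diff_left)
  ultimately have q: "smooth_on UNIV (\<lambda>x. r\<^sup>2 - (x - x0) \<bullet> (x - x0))" by simp
  show "smooth_on UNIV \<beta>"
    unfolding \<beta>_def
    by (rule smooth_on_compose[OF _ _ smooth_on_cutoff q]) (use assms in auto)
  show "\<beta> x0 = 1" using assms by (simp add: \<beta>_def cutoff_eq_1)
  show "\<beta> x = 0" if "x \<notin> ball x0 r" for x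
  proof -
    have "r \<le> norm (x - x0)" using that by (simp add: dist_norm norm_minus_commute)
    then have "r\<^sup>2 \<le> (x - x0) \<bullet> (x - x0)"
      using assms by (metis less_eq_real_def power2_norm_eq_inner power_mono)
    then show ?thesis by (simp add: \<beta>_def cutoff_eq_0)
  qed
qed

subsection \<open>Hadamard's lemma\<close>

text \<open>Differentiation under the integral sign preserves the shape of the integrand, except
  that the chain rule along the ray contributes one more factor t; this is why the exponent j varies
  in the induction.\<close>

lemma Ck_on_integral_radial:
  fixes h :: "'e::euclidean_space \<Rightarrow> real"
  assumes "Ck_on k (ball x0 r) h"
  shows "Ck_on k (ball x0 r) (\<lambda>x. integral {0..1} (\<lambda>t. t ^ j * h (x0 + t *\<^sub>R (x - x0))))"
  using assms
proof (induction k arbitrary: h j)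
  have in_ball: "x0 + t *\<^sub>R (x - x0) \<in> ball x0 r" if "x \<in> ball x0 r" "t \<in> {0..1}" for x t
    using that mult_left_le_one_le[of "norm (x - x0)" t]
    by (auto simp: dist_norm norm_minus_commute intro: order_le_less_trans)
  have cont: "continuous_on (ball x0 r \<times> cbox 0 1) (\<lambda>(x, t). t ^ j * h (x0 + t *\<^sub>R (x - x0)))"
    if "continuous_on (ball x0 r) h" for h :: "'e \<Rightarrow> real" and j :: nat
    unfolding split_beta using in_ball
    by (intro continuous_intros continuous_on_compose2[OF that]) auto
  {
    case 0
    then show ?case
      using integral_continuous_on_param[OF cont[of h j]] by simp
  next
    case (Suc k)
    let ?D = "\<lambda>x v. integral {0..1} (\<lambda>t. t ^ (j + 1) * frechet_derivative h (at (x0 + t *\<^sub>R (x - x0))) v)"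
    have dh: "(h has_derivative frechet_derivative h (at x)) (at x)" if "x \<in> ball x0 r" for x
      using Ck_on_has_derivative[OF open_ball Suc.prems that] .
    have Dc: "continuous_on (ball x0 r) (\<lambda>x. frechet_derivative h (at x) v)" for v
    proof -
      have "Ck_on k (ball x0 r) (\<lambda>x. frechet_derivative h (at x) v)" using Suc.prems by simp
      then show ?thesis by (rule Ck_on_imp_continuous_on)
    qed
    show ?case
    proof (rule Ck_on_SucI[OF open_ball, where f' = ?D])
      fix x assume x: "x \<in> ball x0 r"
      \<comment> \<open>The Leibniz rule for integrals takes the derivative in x as a continuous
        family of bounded linear maps, so the pointwise derivatives are packaged as such; continuity
        is then checked on basis vectors.\<close>
      define B where "B x t = Blinfun (\<lambda>v. t ^ (j + 1) * frechet_derivative h (at (x0 + t *\<^sub>R (x - x0))) v)" for x t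
      have B: "blinfun_apply (B x t) v = t ^ (j + 1) * frechet_derivative h (at (x0 + t *\<^sub>R (x - x0))) v"
        if "x \<in> ball x0 r" "t \<in> {0..1}" for x t v
        unfolding B_def
        by (subst bounded_linear_Blinfun_apply)
           (use dh[OF in_ball[OF that]] has_derivative_bounded_linear bounded_linear_const_mult in blast)+
      have Bc: "continuous_on (ball x0 r \<times> cbox 0 1) (\<lambda>(x, t). B x t)"
        unfolding split_beta
      proof (rule continuous_on_blinfun_componentwise)
        fix i :: 'e
        have "continuous_on (ball x0 r \<times> cbox 0 1)
            (\<lambda>(x, t). t ^ (j + 1) * frechet_derivative h (at (x0 + t *\<^sub>R (x - x0))) i)"
          by (rule cont[OF Dc])
        then show "continuous_on (ball x0 r \<times> cbox 0 1) (\<lambda>p. blinfun_apply (B (fst p) (snd p)) i)"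
          by (rule continuous_on_eq) (auto simp: B)
      qed
      have int: "(\<lambda>t. t ^ j * h (x0 + t *\<^sub>R (x - x0))) integrable_on cbox 0 1" if "x \<in> ball x0 r" for x
      proof (rule integrable_continuous)
        have "continuous_on (cbox 0 1) (\<lambda>t. (\<lambda>(x, t). t ^ j * h (x0 + t *\<^sub>R (x - x0))) (x, t))"
          by (rule continuous_on_compose2[OF cont[OF Ck_on_imp_continuous_on[OF Suc.prems]]])
             (use that in \<open>auto intro!: continuous_intros\<close>)
        then show "continuous_on (cbox 0 1) (\<lambda>t. t ^ j * h (x0 + t *\<^sub>R (x - x0)))" by simp
      qed
      have "((\<lambda>x. integral (cbox 0 1) (\<lambda>t. t ^ j * h (x0 + t *\<^sub>R (x - x0)))) has_derivative
          blinfun_apply (integral (cbox 0 1) (B x))) (at x within ball x0 r)"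
      proof (rule leibniz_rule[OF _ int Bc x convex_ball])
        fix x t assume xt: "x \<in> ball x0 r" "t \<in> cbox 0 (1::real)"
        have "((\<lambda>x. x0 + t *\<^sub>R (x - x0)) has_derivative (\<lambda>v. t *\<^sub>R v)) (at x)"
          by (auto intro!: derivative_eq_intros)
        from has_derivative_compose[OF this dh] 
        have "((\<lambda>x. h (x0 + t *\<^sub>R (x - x0))) has_derivative
            (\<lambda>v. frechet_derivative h (at (x0 + t *\<^sub>R (x - x0))) (t *\<^sub>R v))) (at x)"
          using in_ball xt by auto
        then have "((\<lambda>x. t ^ j * h (x0 + t *\<^sub>R (x - x0))) has_derivative
            (\<lambda>v. t ^ j * frechet_derivative h (at (x0 + t *\<^sub>R (x - x0))) (t *\<^sub>R v))) (at x)"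
          by (rule has_derivative_mult_right)
        moreover have "t ^ j * frechet_derivative h (at (x0 + t *\<^sub>R (x - x0))) (t *\<^sub>R v) = blinfun_apply (B x t) v" for v
          using linear_cmul[OF has_derivative_linear[OF dh[OF in_ball]]] xt by (simp add: B)
        ultimately show "((\<lambda>x. t ^ j * h (x0 + t *\<^sub>R (x - x0))) has_derivative blinfun_apply (B x t)) (at x within ball x0 r)"
          using has_derivative_at_withinI by fastforce
      qed auto
      moreover have "blinfun_apply (integral (cbox 0 1) (B x)) = ?D x"
      proof
        fix v
        have "B x integrable_on cbox 0 1"
        proof (rule integrable_continuous)
          have "continuous_on (cbox 0 1) (\<lambda>t. (\<lambda>(x, t). B x t) (x, t))"
            by (rule continuous_on_compose2[OF Bc]) (use x in \<open>auto intro!: continuous_intros\<close>)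
          then show "continuous_on (cbox 0 1) (B x)" by simp
        qed
        then have "blinfun_apply (integral (cbox 0 1) (B x)) v = integral (cbox 0 1) (\<lambda>t. blinfun_apply (B x t) v)"
          using blinfun_apply_integral by blast
        also have "\<dots> = ?D x v" using x by (auto simp: B intro!: Henstock_Kurzweil_Integration.integral_cong)
        finally show "blinfun_apply (integral (cbox 0 1) (B x)) v = ?D x v" .
      qed
      ultimately show "((\<lambda>x. integral {0..1} (\<lambda>t. t ^ j * h (x0 + t *\<^sub>R (x - x0)))) has_derivative ?D x) (at x)"
        using x by (simp only: at_within_open[OF x open_ball] cbox_interval)
    next
      fix v
      show "Ck_on k (ball x0 r) (\<lambda>x. ?D x v)" by (rule Suc.IH) (use Suc.prems in simp)
    qed
  }
qed

text \<open>Integrate the derivative of f along the segment from \<open>x0\<close> to x: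
  \<open>h i\<close> is the mean of the i-th partial derivative over that segment, which at
  \<open>x0\<close> is the partial derivative itself. On a ball the segments stay inside the
  domain.\<close>

lemma Hadamard:
  fixes f :: "'e::euclidean_space \<Rightarrow> real"
  assumes f: "smooth_on (ball x0 r) f" and r: "r > 0"
  obtains h :: "'e \<Rightarrow> 'e \<Rightarrow> real" where
    "\<And>i. smooth_on (ball x0 r) (h i)"
    "\<And>x. x \<in> ball x0 r \<Longrightarrow> f x = f x0 + (\<Sum>i\<in>Basis. ((x - x0) \<bullet> i) * h i x)"
    "\<And>i. h i x0 = frechet_derivative f (at x0) i"
proof
  define h where "h i x = integral {0..1} (\<lambda>t. t ^ 0 * frechet_derivative f (at (x0 + t *\<^sub>R (x - x0))) i)" for i x
  show "smooth_on (ball x0 r) (h i)" for i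
    unfolding smooth_on_def h_def
    using smooth_on_frechet_derivative[OF f] by (auto simp only: smooth_on_def intro: Ck_on_integral_radial)
  show "h i x0 = frechet_derivative f (at x0) i" for i by (simp add: h_def)
  have df: "(f has_derivative frechet_derivative f (at x)) (at x)" if "x \<in> ball x0 r" for x
    using smooth_on_has_derivative[OF open_ball f that] .
  fix x assume x: "x \<in> ball x0 r"
  have in_ball: "x0 + t *\<^sub>R (x - x0) \<in> ball x0 r" if "t \<in> {0..1}" for t
    using x that mult_left_le_one_le[of "norm (x - x0)" t]
    by (auto simp: dist_norm norm_minus_commute intro: order_le_less_trans)
  let ?d = "\<lambda>t. frechet_derivative f (at (x0 + t *\<^sub>R (x - x0)))"
  have "((\<lambda>t. ?d t (x - x0)) has_integral f (x0 + 1 *\<^sub>R (x - x0)) - f (x0 + 0 *\<^sub>R (x - x0))) {0..1}"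
  proof (rule fundamental_theorem_of_calculus)
    fix t :: real assume t: "t \<in> {0..1}"
    have "((\<lambda>t. x0 + t *\<^sub>R (x - x0)) has_derivative (\<lambda>s. s *\<^sub>R (x - x0))) (at t)"
      by (auto intro!: derivative_eq_intros)
    from has_derivative_compose[OF this df[OF in_ball[OF t]]]
    show "((\<lambda>t. f (x0 + t *\<^sub>R (x - x0))) has_vector_derivative ?d t (x - x0)) (at t within {0..1})"
      using linear_cmul[OF has_derivative_linear[OF df[OF in_ball[OF t]]]]
      by (auto simp: has_vector_derivative_def intro: has_derivative_at_withinI)
  qed simp
  then have "f x - f x0 = integral {0..1} (\<lambda>t. ?d t (x - x0))" by (simp add: integral_unique)
  also have "\<dots> = integral {0..1} (\<lambda>t. \<Sum>i\<in>Basis. ((x - x0) \<bullet> i) * ?d t i)"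
  proof (rule Henstock_Kurzweil_Integration.integral_cong)
    fix t :: real assume t: "t \<in> {0..1}"
    note lin = has_derivative_linear[OF df[OF in_ball[OF t]]]
    have "?d t (x - x0) = ?d t (\<Sum>i\<in>Basis. ((x - x0) \<bullet> i) *\<^sub>R i)" by (simp only: euclidean_representation)
    also have "\<dots> = (\<Sum>i\<in>Basis. ((x - x0) \<bullet> i) * ?d t i)"
      by (simp only: linear_sum[OF lin] linear_cmul[OF lin] real_scaleR_def)
    finally show "?d t (x - x0) = (\<Sum>i\<in>Basis. ((x - x0) \<bullet> i) * ?d t i)" .
  qed
  also have "\<dots> = (\<Sum>i\<in>Basis. integral {0..1} (\<lambda>t. ((x - x0) \<bullet> i) * ?d t i))"
  proof (rule integral_sum)
    fix i :: 'e
    have "continuous_on {0..1} (\<lambda>t. ?d t i)"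
      by (rule continuous_on_compose2[OF smooth_on_imp_continuous_on[OF smooth_on_frechet_derivative[OF f]]])
         (use in_ball in \<open>auto intro!: continuous_intros\<close>)
    then show "(\<lambda>t. ((x - x0) \<bullet> i) * ?d t i) integrable_on {0..1}"
      by (intro integrable_continuous_real continuous_intros)
  qed simp
  finally show "f x = f x0 + (\<Sum>i\<in>Basis. ((x - x0) \<bullet> i) * h i x)" by (simp add: h_def)
qed

section \<open>Smooth functions and vector fields on a manifold\<close>

lemma tangent_spaceD:
  assumes "v \<in> tangent_space A p"
  shows "f \<notin> smooth_functions A \<Longrightarrow> v f = 0"
    and "f \<in> smooth_functions A \<Longrightarrow> h \<in> smooth_functions A \<Longrightarrow> v (\<lambda>x. f x + h x) = v f + v h"
    and "f \<in> smooth_functions A \<Longrightarrow> v (\<lambda>x. r * f x) = r * v f"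
    and "f \<in> smooth_functions A \<Longrightarrow> h \<in> smooth_functions A \<Longrightarrow>
      v (\<lambda>x. f x * h x) = f p * v h + h p * v f"
  using assms unfolding tangent_space_def by auto

lemma vector_fieldsD:
  assumes "X \<in> vector_fields A"
  shows "X p \<in> tangent_space A p" "f \<in> smooth_functions A \<Longrightarrow> dir_deriv X f \<in> smooth_functions A"
  using assms unfolding vector_fields_def by auto

locale smooth_manifold =
  fixes A :: "('a::{t2_space, second_countable_topology}, 'e::euclidean_space) atlas"
  assumes connected_smooth_manifold: "connected_smooth_manifold A"
begin

abbreviation "CF \<equiv> smooth_functions A"
abbreviation "VF \<equiv> vector_fields A"

lemma chart:
  assumes "(U, c) \<in> A"
  shows "open U" "open (c ` U)" "continuous_on U c" "continuous_on (c ` U) (inv_into U c)"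
    and "\<And>q. q \<in> U \<Longrightarrow> inv_into U c (c q) = q"
proof -
  have "open U \<and> open (c ` U) \<and> homeomorphism U (c ` U) c (inv_into U c)"
    using connected_smooth_manifold assms unfolding connected_smooth_manifold_def by fast
  then show "open U" "open (c ` U)" "continuous_on U c" "continuous_on (c ` U) (inv_into U c)"
    "\<And>q. q \<in> U \<Longrightarrow> inv_into U c (c q) = q"
    by (auto simp: homeomorphism_def)
qed

lemma open_chart_image:
  assumes c: "(U, c) \<in> A" and W: "open W"
  shows "open (c ` (U \<inter> W))"
proof -
  have "c ` (U \<inter> W) = c ` U \<inter> inv_into U c -` W"
    using chart(5)[OF c] by force
  then show ?thesis
    using continuous_open_preimage[OF chart(4)[OF c] chart(2)[OF c] W] by simp
qed

lemma transition_smooth: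
  assumes "(U, c) \<in> A" "(V, d) \<in> A"
  shows "smooth_on (c ` (U \<inter> V)) (d \<circ> inv_into U c)"
  using connected_smooth_manifold assms unfolding connected_smooth_manifold_def by fast

lemma CF_D: "f \<in> CF \<Longrightarrow> (U, c) \<in> A \<Longrightarrow> smooth_on (c ` U) (\<lambda>x. f (inv_into U c x))"
  by (auto simp: smooth_functions_def o_def)

lemma CF_I:
  "(\<And>U c. (U, c) \<in> A \<Longrightarrow> smooth_on (c ` U) (\<lambda>x. f (inv_into U c x))) \<Longrightarrow> f \<in> CF"
  by (auto simp: smooth_functions_def o_def)

lemma chart_ball:
  assumes "open W" "p \<in> W"
  obtains U c R where "(U, c) \<in> A" "p \<in> U" "R > 0" "ball (c p) R \<subseteq> c ` (U \<inter> W)"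
proof -
  have "p \<in> (\<Union>(U, c)\<in>A. U)"
    using connected_smooth_manifold unfolding connected_smooth_manifold_def by auto
  then obtain U c where c: "(U, c) \<in> A" "p \<in> U" by auto
  obtain R where "R > 0" "ball (c p) R \<subseteq> c ` (U \<inter> W)"
    using open_chart_image[OF c(1) assms(1)] c(2) assms(2) open_contains_ball by blast
  then show thesis using that c by blast
qed

lemma CF_continuous:
  assumes "f \<in> CF"
  shows "continuous_on UNIV f"
proof -
  have "isCont f p" for p
  proof -
    obtain U c and R :: real where c: "(U, c) \<in> A" "p \<in> U" by (rule chart_ball[of UNIV p]) simp_all
    have "continuous_on U (\<lambda>q. f (inv_into U c (c q)))"
      using continuous_on_compose2[OF smooth_on_imp_continuous_on[OF CF_D[OF assms c(1)]] chart(3)[OF c(1)]]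
      by auto
    then have "continuous_on U f"
      by (rule continuous_on_eq) (simp add: chart(5)[OF c(1)])
    then show ?thesis using chart(1)[OF c(1)] c(2) continuous_on_eq_continuous_at by blast
  qed
  then show ?thesis by (simp add: continuous_at_imp_continuous_on)
qed

lemma CF_const: "(\<lambda>q. r) \<in> CF"
  by (rule CF_I) (rule smooth_on_const)

lemma CF_add: "f \<in> CF \<Longrightarrow> h \<in> CF \<Longrightarrow> (\<lambda>q. f q + h q) \<in> CF"
  by (rule CF_I) (rule smooth_on_add[OF chart(2) CF_D CF_D])

lemma CF_mult: "f \<in> CF \<Longrightarrow> h \<in> CF \<Longrightarrow> (\<lambda>q. f q * h q) \<in> CF"
  by (rule CF_I) (rule smooth_on_mult[OF chart(2) CF_D CF_D])

lemma CF_uminus: "f \<in> CF \<Longrightarrow> (\<lambda>q. - f q) \<in> CF"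
  using CF_mult[OF CF_const[of "-1"], of f] by simp

lemma CF_diff: "f \<in> CF \<Longrightarrow> h \<in> CF \<Longrightarrow> (\<lambda>q. f q - h q) \<in> CF"
  using CF_add[OF _ CF_uminus, of f h] by simp

lemma CF_sum: "(\<And>i. i \<in> I \<Longrightarrow> f i \<in> CF) \<Longrightarrow> (\<lambda>q. \<Sum>i\<in>I. f i q) \<in> CF"
  by (induction I rule: infinite_finite_induct) (auto intro: CF_add CF_const)

lemma CF_compose:
  fixes \<theta> :: "real \<Rightarrow> real"
  assumes "smooth_on UNIV \<theta>" "f \<in> CF"
  shows "(\<lambda>q. \<theta> (f q)) \<in> CF"
  by (rule CF_I, rule smooth_on_compose[OF _ open_UNIV assms(1) CF_D[OF assms(2)]])
     (auto intro: chart(2))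

text \<open>Near a point of the chart ball the function is F after a transition map. Every other
  point lies off the compact image of \<open>cball x0 r\<close>, which is closed by the Hausdorff
  property, and off that image the function is 0.\<close>

lemma CF_extend:
  assumes c: "(U, c) \<in> A" and ball: "ball x0 R \<subseteq> c ` U" and r: "r < R"
    and F: "smooth_on (ball x0 R) F" and F0: "\<And>x. x \<notin> cball x0 r \<Longrightarrow> F x = 0"
  shows "(\<lambda>q. if q \<in> U \<and> c q \<in> ball x0 R then F (c q) else 0) \<in> CF"
    (is "?f \<in> CF")
proof (rule CF_I)
  fix V d assume d: "(V, d) \<in> A"
  let ?U = "U \<inter> c -` ball x0 R" and ?K = "inv_into U c ` cball x0 r"
  have oU: "open ?U"
    using continuous_open_preimage[OF chart(3)[OF c] chart(1)[OF c]] by simp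
  have "cball x0 r \<subseteq> c ` U" using ball r by fastforce
  then have "compact ?K"
    by (intro compact_continuous_image continuous_on_subset[OF chart(4)[OF c]]) auto
  then have oK: "open (- ?K)" using compact_imp_closed by auto
  have KU: "?K \<subseteq> ?U"
  proof
    fix q assume "q \<in> ?K"
    then obtain x where x: "x \<in> cball x0 r" "q = inv_into U c x" by auto
    then have "x \<in> ball x0 R" using r by auto
    then show "q \<in> ?U"
      using ball x(2) by (auto simp: f_inv_into_f inv_into_into subset_iff)
  qed
  have f0: "?f q = 0" if "q \<notin> ?K" for q
  proof (cases "q \<in> ?U")
    case True
    then have "c q \<notin> cball x0 r" using that chart(5)[OF c, of q] by (metis IntD1 image_eqI)
    then show ?thesis using F0 by simp
  qed auto
  show "smooth_on (d ` V) (\<lambda>x. ?f (inv_into V d x))"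
  proof (rule smooth_on_local)
    show "open (d ` V)" by (rule chart(2)[OF d])
    fix x assume "x \<in> d ` V"
    then obtain q where q: "q \<in> V" "x = d q" by auto
    show "\<exists>W. open W \<and> x \<in> W \<and> smooth_on W (\<lambda>x. ?f (inv_into V d x))"
    proof (cases "q \<in> ?U")
      case True
      let ?W = "d ` (V \<inter> ?U)"
      have o: "open ?W" by (rule open_chart_image[OF d oU])
      have t: "smooth_on ?W (\<lambda>x. c (inv_into V d x))"
        using smooth_on_subset[OF transition_smooth[OF d c], of ?W] by (auto simp: o_def)
      have "smooth_on ?W (\<lambda>x. F (c (inv_into V d x)))"
        by (rule smooth_on_compose[OF o open_ball F t]) (auto simp: chart(5)[OF d])
      then have "smooth_on ?W (\<lambda>x. ?f (inv_into V d x))"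
        by (rule smooth_on_cong[OF o, rotated]) (auto simp: chart(5)[OF d])
      then show ?thesis using o True q by blast
    next
      case False
      let ?W = "d ` (V \<inter> - ?K)"
      have o: "open ?W" by (rule open_chart_image[OF d oK])
      have "smooth_on ?W (\<lambda>x. ?f (inv_into V d x))"
      proof (rule smooth_on_cong[OF o _ smooth_on_const[of _ 0]])
        fix x assume "x \<in> ?W"
        then have "inv_into V d x \<notin> ?K" by (auto simp: chart(5)[OF d])
        then show "0 = ?f (inv_into V d x)" by (rule f0[symmetric])
      qed
      moreover have "x \<in> ?W" using False KU q by blast
      ultimately show ?thesis using o by blast
    qed
  qed
qed

lemma bump_function:
  assumes "open W" "p \<in> W"
  obtains b where "b \<in> CF" "b p = 1" "\<And>q. q \<notin> W \<Longrightarrow> b q = 0"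
proof -
  obtain U c and R :: real where c: "(U, c) \<in> A" "p \<in> U" "R > 0" "ball (c p) R \<subseteq> c ` (U \<inter> W)"
    using chart_ball[OF assms] .
  obtain \<beta> :: "'e \<Rightarrow> real" where \<beta>: "smooth_on UNIV \<beta>" "\<beta> (c p) = 1" "\<And>x. x \<notin> ball (c p) (R / 2) \<Longrightarrow> \<beta> x = 0"
    by (rule exists_smooth_bump[OF half_gt_zero[OF c(3)], of "c p"]) blast
  let ?b = "\<lambda>q. if q \<in> U \<and> c q \<in> ball (c p) R then \<beta> (c q) else 0"
  have "?b \<in> CF"
  proof (rule CF_extend[OF c(1)])
    show "\<beta> x = 0" if "x \<notin> cball (c p) (R / 2)" for x using that \<beta>(3)[of x] by auto
  qed (use c \<beta>(1) in \<open>auto intro: smooth_on_subset\<close>)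
  moreover have "?b p = 1" using c \<beta> by simp
  moreover have "?b q = 0" if "q \<notin> W" for q
  proof -
    have "\<not> (q \<in> U \<and> c q \<in> ball (c p) R)"
      using that c(4) chart(5)[OF c(1)] by (metis IntE imageE subsetD)
    then show ?thesis by auto
  qed
  ultimately show thesis using that by blast
qed

section \<open>Derivations at a point and finite generation of the tangent spaces\<close>

lemma tangent_const:
  assumes "v \<in> tangent_space A p"
  shows "v (\<lambda>q. r) = 0"
proof -
  have "v (\<lambda>q. 1 * 1) = 0"
    using tangent_spaceD(4)[OF assms CF_const[of 1] CF_const[of 1]] by simp
  then show ?thesis using tangent_spaceD(3)[OF assms CF_const[of 1], of r] by simp
qed

lemma tangent_sum:
  assumes "v \<in> tangent_space A p" "\<And>i. i \<in> I \<Longrightarrow> f i \<in> CF"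
  shows "v (\<lambda>q. \<Sum>i\<in>I. f i q) = (\<Sum>i\<in>I. v (f i))"
  using assms(2)
proof (induction I rule: infinite_finite_induct)
  case (insert i I)
  then show ?case
    using tangent_spaceD(2)[OF assms(1), of "f i" "\<lambda>q. \<Sum>i\<in>I. f i q"] CF_sum[of I f] by auto
qed (simp_all add: tangent_const[OF assms(1)])

text \<open>Coordinate fields damped by a bump function are global derivations. They span at p
  because Hadamard's lemma writes f - f(p) as a sum of products whose first factors, the centred
  coordinates, vanish at p; a derivation at p then only sees the partial derivatives of f.\<close>

lemma exists_spanning_fields:
  obtains X :: "'e \<Rightarrow> 'a vfield"
  where "\<And>i. X i \<in> VF" "span ((\<lambda>i. X i p) ` Basis) = tangent_space A p"
proof -
  obtain U c and R :: real where c: "(U, c) \<in> A" "p \<in> U" "R > 0" "ball (c p) R \<subseteq> c ` (U \<inter> UNIV)"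
    by (rule chart_ball[of UNIV p]) simp_all
  let ?B = "ball (c p) R"
  have ball: "?B \<subseteq> c ` U" using c(4) by simp
  obtain \<beta> :: "'e \<Rightarrow> real" where \<beta>: "smooth_on UNIV \<beta>" "\<beta> (c p) = 1" "\<And>x. x \<notin> ball (c p) (R / 2) \<Longrightarrow> \<beta> x = 0"
    by (rule exists_smooth_bump[OF half_gt_zero[OF c(3)], of "c p"]) blast
  have \<beta>0: "\<beta> x = 0" if "x \<notin> cball (c p) (R / 2)" for x using that \<beta>(3)[of x] by auto
  define ext where "ext F q = (if q \<in> U \<and> c q \<in> ?B then \<beta> (c q) * F (c q) else 0)" for F :: "'e \<Rightarrow> real" and q
  have ext: "ext F \<in> CF" if "smooth_on ?B F" for F
    unfolding ext_def
  proof (rule CF_extend[OF c(1) ball])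
    show "R / 2 < R" using c(3) by simp
    show "smooth_on ?B (\<lambda>x. \<beta> x * F x)"
      by (intro smooth_on_mult that smooth_on_subset[OF \<beta>(1)]) auto
    show "\<beta> x * F x = 0" if "x \<notin> cball (c p) (R / 2)" for x using \<beta>0[OF that] by simp
  qed
  define loc where "loc f x = f (inv_into U c x)" for f :: "'a \<Rightarrow> real" and x
  have loc: "smooth_on ?B (loc f)" if "f \<in> CF" for f
    unfolding loc_def using smooth_on_subset[OF CF_D[OF that c(1)] ball] .
  have dloc: "(loc f has_derivative frechet_derivative (loc f) (at x)) (at x)" if "f \<in> CF" "x \<in> ?B" for f x
    using smooth_on_has_derivative[OF open_ball loc[OF that(1)] that(2)] .
  define X where "X i q f = (if f \<in> CF then ext (\<lambda>x. frechet_derivative (loc f) (at x) i) q else 0)"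
    for i :: 'e and q f
  have XVF: "X i \<in> VF" for i
    unfolding vector_fields_def
  proof (intro CollectI conjI allI ballI)
    fix f assume f: "f \<in> CF"
    show "dir_deriv (X i) f \<in> CF"
      using ext[OF smooth_on_frechet_derivative[OF loc[OF f], of i]] f
      by (simp add: dir_deriv_def X_def)
  next
    fix q
    show "X i q \<in> tangent_space A q"
    proof (cases "q \<in> U \<and> c q \<in> ?B")
      case False
      then show ?thesis by (auto simp: tangent_space_def X_def ext_def)
    next
      case True
      note d = dloc[OF _ True[THEN conjunct2]]
      have X: "X i q f = \<beta> (c q) * frechet_derivative (loc f) (at (c q)) i" if "f \<in> CF" for f
        using True that by (simp add: X_def ext_def)
      have fd: "frechet_derivative (loc f) (at (c q)) = D" if "(loc f has_derivative D) (at (c q))" for f D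
        using frechet_derivative_at[OF that] by simp
      have locq: "loc f (c q) = f q" for f using True chart(5)[OF c(1)] by (simp add: loc_def)
      show ?thesis
        unfolding tangent_space_def
      proof (intro CollectI conjI allI ballI impI)
        show "f \<notin> CF \<Longrightarrow> X i q f = 0" for f by (simp add: X_def)
      next
        fix f h assume fh: "f \<in> CF" "h \<in> CF"
        have "(loc (\<lambda>x. f x + h x) has_derivative
            (\<lambda>v. frechet_derivative (loc f) (at (c q)) v + frechet_derivative (loc h) (at (c q)) v)) (at (c q))"
          using has_derivative_add[OF d[OF fh(1)] d[OF fh(2)]] by (simp add: loc_def[abs_def])
        from fd[OF this] show "X i q (\<lambda>x. f x + h x) = X i q f + X i q h"
          using fh by (simp add: X CF_add algebra_simps)
        have "(loc (\<lambda>x. f x * h x) has_derivative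
            (\<lambda>v. f q * frechet_derivative (loc h) (at (c q)) v + frechet_derivative (loc f) (at (c q)) v * h q)) (at (c q))"
          using has_derivative_mult[OF d[OF fh(1)] d[OF fh(2)]] unfolding locq by (simp add: loc_def[abs_def])
        from fd[OF this] show "X i q (\<lambda>x. f x * h x) = f q * X i q h + h q * X i q f"
          using fh by (simp add: X CF_mult algebra_simps)
      next
        fix r f assume f: "f \<in> CF"
        have "(loc (\<lambda>x. r * f x) has_derivative (\<lambda>v. r * frechet_derivative (loc f) (at (c q)) v)) (at (c q))"
          using has_derivative_mult_right[OF d[OF f], of r] by (simp add: loc_def[abs_def])
        from fd[OF this] show "X i q (\<lambda>x. r * f x) = r * X i q f"
          using f CF_mult[OF CF_const f, of r] by (simp add: X)
      qed
    qed
  qed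
  have "span ((\<lambda>i. X i p) ` Basis) \<subseteq> tangent_space A p"
    by (rule span_minimal) (use vector_fieldsD(1)[OF XVF] subspace_tangent_space in auto)
  moreover have "tangent_space A p \<subseteq> span ((\<lambda>i. X i p) ` Basis)"
  proof
    fix v assume v: "v \<in> tangent_space A p"
    define x where "x i = ext (\<lambda>y. (y - c p) \<bullet> i)" for i
    have x: "x i \<in> CF" for i
    proof -
      have "smooth_on ?B (\<lambda>y. (y + - c p) \<bullet> i)"
        by (intro smooth_on_linear[OF open_ball bounded_linear_inner_left] smooth_on_add
            smooth_on_id smooth_on_const open_ball)
      then show ?thesis unfolding x_def by (intro ext) simp
    qed
    define b where "b = ext (\<lambda>y. 1)"
    have b: "b \<in> CF" unfolding b_def by (rule ext[OF smooth_on_const])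
    have bp: "b p = 1" using c \<beta> by (simp add: b_def ext_def)
    have "v f = (\<Sum>i\<in>Basis. v (x i) * X i p f)" if f: "f \<in> CF" for f
    proof -
      obtain h where h: "\<And>i. smooth_on ?B (h i)"
        "\<And>y. y \<in> ?B \<Longrightarrow> loc f y = loc f (c p) + (\<Sum>i\<in>Basis. ((y - c p) \<bullet> i) * h i y)"
        "\<And>i. h i (c p) = frechet_derivative (loc f) (at (c p)) i"
        using Hadamard[OF loc[OF f] c(3)] by metis
      have locp: "loc f (c p) = f p" using c(2) chart(5)[OF c(1)] by (simp add: loc_def)
      have H: "ext (h i) \<in> CF" for i by (rule ext[OF h(1)])
      \<comment> \<open>Since \<beta> is only known to be 1 at the centre, a global identity is
        needed. On the right \<open>x i\<close> and \<open>ext (h i)\<close> carry one \<beta> each,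
        so f is multiplied by \<open>b\<close> twice on the left. The terms in \<open>v b\<close>
        cancel at the end.\<close>
      have eq: "(\<lambda>q. b q * (b q * f q)) = (\<lambda>q. f p * (b q * b q) + (\<Sum>i\<in>Basis. x i q * ext (h i) q))"
      proof
        fix q
        show "b q * (b q * f q) = f p * (b q * b q) + (\<Sum>i\<in>Basis. x i q * ext (h i) q)"
        proof (cases "q \<in> U \<and> c q \<in> ?B")
          case True
          then have "f q = f p + (\<Sum>i\<in>Basis. ((c q - c p) \<bullet> i) * h i (c q))"
            using h(2)[of "c q"] chart(5)[OF c(1), of q] locp by (simp add: loc_def)
          then show ?thesis
            using True by (simp add: b_def x_def ext_def algebra_simps sum_distrib_left)
        qed (auto simp: b_def x_def ext_def)
      qed
      have xp: "x i p = 0" for i using c by (simp add: x_def ext_def)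
      have Hp: "ext (h i) p = X i p f" for i
        using c f \<beta>(2) by (simp add: ext_def X_def h(3))
      have "v (\<lambda>q. b q * (b q * f q)) = f p * v b + (f p * v b + v f)"
        using tangent_spaceD(4)[OF v b CF_mult[OF b f]] tangent_spaceD(4)[OF v b f] bp by simp
      moreover have "v (\<lambda>q. f p * (b q * b q)) = f p * (v b + v b)"
        using tangent_spaceD(3)[OF v CF_mult[OF b b], of "f p"] tangent_spaceD(4)[OF v b b] bp by simp
      moreover have "v (\<lambda>q. \<Sum>i\<in>Basis. x i q * ext (h i) q) = (\<Sum>i\<in>Basis. v (x i) * X i p f)"
        using tangent_spaceD(4)[OF v x H] tangent_sum[OF v, of Basis "\<lambda>i q. x i q * ext (h i) q"] CF_mult[OF x H]
        by (simp add: xp Hp mult.commute)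
      moreover have "v (\<lambda>q. f p * (b q * b q) + (\<Sum>i\<in>Basis. x i q * ext (h i) q)) =
          v (\<lambda>q. f p * (b q * b q)) + v (\<lambda>q. \<Sum>i\<in>Basis. x i q * ext (h i) q)"
        by (intro tangent_spaceD(2)[OF v] CF_mult CF_const CF_sum b x H)
      ultimately show ?thesis unfolding eq by (simp add: algebra_simps)
    qed
    moreover have "v f = 0" if "f \<notin> CF" for f using tangent_spaceD(1)[OF v that] .
    moreover have "(\<Sum>i\<in>I. v (x i) *\<^sub>R X i p) f = (\<Sum>i\<in>I. v (x i) * X i p f)" for f and I :: "'e set"
      by (induction I rule: infinite_finite_induct) (auto simp: scaleR_fun_def)
    moreover have "X i p f = 0" if "f \<notin> CF" for i f using that by (simp add: X_def)
    ultimately have "v f = (\<Sum>i\<in>Basis. v (x i) *\<^sub>R X i p) f" for f by (cases "f \<in> CF") simp_all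
    then have "v = (\<Sum>i\<in>Basis. v (x i) *\<^sub>R X i p)" by blast
    also have "\<dots> \<in> span ((\<lambda>i. X i p) ` Basis)"
      by (intro span_sum span_scale span_base imageI)
    finally show "v \<in> span ((\<lambda>i. X i p) ` Basis)" .
  qed
  ultimately show thesis using that XVF by blast
qed

section \<open>Vector fields as a module over the smooth functions, and the Lie bracket\<close>

lemma dir_deriv_add:
  "X \<in> VF \<Longrightarrow> f \<in> CF \<Longrightarrow> h \<in> CF \<Longrightarrow> dir_deriv X (\<lambda>q. f q + h q) p = dir_deriv X f p + dir_deriv X h p"
  unfolding dir_deriv_def by (rule tangent_spaceD(2)[OF vector_fieldsD(1)])

lemma dir_deriv_mult:
  "X \<in> VF \<Longrightarrow> f \<in> CF \<Longrightarrow> h \<in> CF \<Longrightarrow>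
    dir_deriv X (\<lambda>q. f q * h q) p = f p * dir_deriv X h p + h p * dir_deriv X f p"
  unfolding dir_deriv_def by (rule tangent_spaceD(4)[OF vector_fieldsD(1)])

lemma dir_deriv_cmult:
  "X \<in> VF \<Longrightarrow> f \<in> CF \<Longrightarrow> dir_deriv X (\<lambda>q. r * f q) p = r * dir_deriv X f p"
  unfolding dir_deriv_def by (rule tangent_spaceD(3)[OF vector_fieldsD(1)])

lemma dir_deriv_const: "X \<in> VF \<Longrightarrow> dir_deriv X (\<lambda>q. r) p = 0"
  unfolding dir_deriv_def by (rule tangent_const[OF vector_fieldsD(1)])

lemma dir_deriv_uminus:
  "X \<in> VF \<Longrightarrow> f \<in> CF \<Longrightarrow> dir_deriv X (\<lambda>q. - f q) p = - dir_deriv X f p"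
  using dir_deriv_cmult[of X f "-1" p] by simp

lemma dir_deriv_diff:
  "X \<in> VF \<Longrightarrow> f \<in> CF \<Longrightarrow> h \<in> CF \<Longrightarrow> dir_deriv X (\<lambda>q. f q - h q) p = dir_deriv X f p - dir_deriv X h p"
  using dir_deriv_add[OF _ _ CF_uminus, of X f h p] dir_deriv_uminus[of X h p] by simp

lemma VF_add:
  assumes "X \<in> VF" "Y \<in> VF" shows "X + Y \<in> VF"
proof -
  have "dir_deriv (X + Y) f = (\<lambda>q. dir_deriv X f q + dir_deriv Y f q)" for f
    by (auto simp: dir_deriv_def)
  then show ?thesis
    using assms by (auto simp: vector_fields_def intro: CF_add subspace_add[OF subspace_tangent_space])
qed

lemma VF_fscale:
  assumes "f \<in> CF" "X \<in> VF" shows "f \<cdot>\<^sub>v X \<in> VF"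
proof -
  have "dir_deriv (f \<cdot>\<^sub>v X) h = (\<lambda>q. f q * dir_deriv X h q)" for h
    by (auto simp: dir_deriv_def fscale_def scaleR_fun_def)
  moreover have "(f \<cdot>\<^sub>v X) p \<in> tangent_space A p" for p
    unfolding fscale_def
    by (rule subspace_scale[OF subspace_tangent_space vector_fieldsD(1)[OF assms(2)]])
  ultimately show ?thesis
    using assms by (auto simp: vector_fields_def intro: CF_mult)
qed

lemma VF_zero: "0 \<in> VF"
  using subspace_0[OF subspace_tangent_space[of A]] CF_const[of 0]
  by (auto simp: vector_fields_def dir_deriv_def zero_fun_def)

lemma VF_uminus: assumes "X \<in> VF" shows "- X \<in> VF"
proof -
  have "- X = (\<lambda>q. - 1) \<cdot>\<^sub>v X" by (auto simp: fscale_def fun_eq_iff)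
  then show ?thesis using VF_fscale[OF CF_const assms] by simp
qed

lemma VF_diff: "X \<in> VF \<Longrightarrow> Y \<in> VF \<Longrightarrow> X - Y \<in> VF"
  using VF_add[OF _ VF_uminus, of X Y] by simp

lemma VF_sum: "(\<And>i. i \<in> I \<Longrightarrow> X i \<in> VF) \<Longrightarrow> (\<Sum>i\<in>I. X i) \<in> VF"
  by (induction I rule: infinite_finite_induct) (auto intro: VF_add VF_zero)

lemma VF_bracket:
  assumes X: "X \<in> VF" and Y: "Y \<in> VF" shows "lie_bracket A X Y \<in> VF"
proof -
  note v = vector_fieldsD[OF X] vector_fieldsD[OF Y]
  have LB: "lie_bracket A X Y p f = dir_deriv X (dir_deriv Y f) p - dir_deriv Y (dir_deriv X f) p"
    if "f \<in> CF" for p f using that by (simp add: lie_bracket_def dir_deriv_def)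
  have "dir_deriv (lie_bracket A X Y) f = (\<lambda>q. dir_deriv X (dir_deriv Y f) q - dir_deriv Y (dir_deriv X f) q)"
    if "f \<in> CF" for f using that by (auto simp: dir_deriv_def lie_bracket_def)
  moreover have "lie_bracket A X Y p \<in> tangent_space A p" for p
    unfolding tangent_space_def
  proof (intro CollectI conjI allI ballI impI)
    show "f \<notin> CF \<Longrightarrow> lie_bracket A X Y p f = 0" for f by (simp add: lie_bracket_def)
  next
    fix f h assume fh: "f \<in> CF" "h \<in> CF"
    have "dir_deriv Z (\<lambda>x. f x + h x) = (\<lambda>q. dir_deriv Z f q + dir_deriv Z h q)" if "Z \<in> VF" for Z
      using dir_deriv_add[OF that fh] by auto
    then show "lie_bracket A X Y p (\<lambda>x. f x + h x) = lie_bracket A X Y p f + lie_bracket A X Y p h"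
      using fh X Y by (simp add: LB CF_add dir_deriv_add v)
    have "dir_deriv Z (\<lambda>x. f x * h x) = (\<lambda>q. f q * dir_deriv Z h q + h q * dir_deriv Z f q)" if "Z \<in> VF" for Z
      using dir_deriv_mult[OF that fh] by auto
    then show "lie_bracket A X Y p (\<lambda>x. f x * h x) = f p * lie_bracket A X Y p h + h p * lie_bracket A X Y p f"
      using fh X Y
      by (simp add: LB CF_mult dir_deriv_add dir_deriv_mult v algebra_simps)
  next
    fix r f assume f: "f \<in> CF"
    have "dir_deriv Z (\<lambda>x. r * f x) = (\<lambda>q. r * dir_deriv Z f q)" if "Z \<in> VF" for Z
      using dir_deriv_cmult[OF that f] by auto
    then show "lie_bracket A X Y p (\<lambda>x. r * f x) = r * lie_bracket A X Y p f"
      using f X Y CF_mult[OF CF_const f, of r]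
      by (simp add: LB dir_deriv_cmult v algebra_simps)
  qed
  ultimately show ?thesis
    using v by (auto simp: vector_fields_def intro: CF_diff)
qed

lemma dir_deriv_bracket:
  "f \<in> CF \<Longrightarrow> dir_deriv (lie_bracket A X Y) f p =
    dir_deriv X (dir_deriv Y f) p - dir_deriv Y (dir_deriv X f) p"
  by (simp add: dir_deriv_def lie_bracket_def)

lemma VF_eqI:
  assumes "X \<in> VF" "Y \<in> VF" "\<And>f p. f \<in> CF \<Longrightarrow> dir_deriv X f p = dir_deriv Y f p"
  shows "X = Y"
proof (intro ext)
  fix p f
  show "X p f = Y p f"
    using assms(3)[of f p] tangent_spaceD(1)[OF vector_fieldsD(1)[OF assms(1)], of f p]
      tangent_spaceD(1)[OF vector_fieldsD(1)[OF assms(2)], of f p]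
    by (cases "f \<in> CF") (auto simp: dir_deriv_def)
qed

end

section \<open>Orthonormal frames and traces\<close>

locale riemannian_manifold = smooth_manifold A
  for A :: "('a::{t2_space, second_countable_topology}, 'e::euclidean_space) atlas" +
  fixes g :: "'a \<Rightarrow> 'a tvec \<Rightarrow> 'a tvec \<Rightarrow> real"
  assumes riemannian_metric: "riemannian_metric A g"
begin

abbreviation "T \<equiv> tangent_space A"
abbreviation "G \<equiv> bilin_on_fields g"

lemma VF_T: "X \<in> VF \<Longrightarrow> X p \<in> T p"
  by (rule vector_fieldsD(1))

lemma g_add: "u \<in> T p \<Longrightarrow> v \<in> T p \<Longrightarrow> w \<in> T p \<Longrightarrow> g p (u + v) w = g p u w + g p v w"
  and g_scale: "u \<in> T p \<Longrightarrow> w \<in> T p \<Longrightarrow> g p (r *\<^sub>R u) w = r * g p u w"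
  and g_sym: "u \<in> T p \<Longrightarrow> v \<in> T p \<Longrightarrow> g p u v = g p v u"
  and g_pos: "u \<in> T p \<Longrightarrow> u \<noteq> 0 \<Longrightarrow> g p u u > 0"
  using riemannian_metric unfolding riemannian_metric_def by auto

lemma g_CF: "X \<in> VF \<Longrightarrow> Y \<in> VF \<Longrightarrow> G X Y \<in> CF"
  using riemannian_metric unfolding riemannian_metric_def by auto

lemmas T_intros = subspace_add[OF subspace_tangent_space] subspace_diff[OF subspace_tangent_space]
  subspace_scale[OF subspace_tangent_space] subspace_neg[OF subspace_tangent_space]
  subspace_sum[OF subspace_tangent_space] subspace_0[OF subspace_tangent_space]

lemma g_zero: "w \<in> T p \<Longrightarrow> g p 0 w = 0"
  using g_scale[of 0 p w 0] T_intros(6) by (metis mult_zero_left scale_zero_left)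

lemma g_minus: "u \<in> T p \<Longrightarrow> w \<in> T p \<Longrightarrow> g p (- u) w = - g p u w"
  using g_scale[of u p w "-1"] by simp

lemma g_diff: "u \<in> T p \<Longrightarrow> v \<in> T p \<Longrightarrow> w \<in> T p \<Longrightarrow> g p (u - v) w = g p u w - g p v w"
  using g_add[of u p "- v" w] g_minus[of v p w] T_intros(4)[of v A p] by simp

lemma g_sum:
  assumes "\<And>i. i \<in> I \<Longrightarrow> u i \<in> T p" "w \<in> T p"
  shows "g p (\<Sum>i\<in>I. u i) w = (\<Sum>i\<in>I. g p (u i) w)"
  using assms(1)
proof (induction I rule: infinite_finite_induct)
  case (insert i I)
  have "g p (u i + sum u I) w = g p (u i) w + (\<Sum>i\<in>I. g p (u i) w)"
    using insert g_add[of "u i" p "sum u I" w] T_intros(5)[of I u A p] assms(2) by simp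
  then show ?case by (simp only: sum.insert[OF insert.hyps])
qed (simp_all add: g_zero[OF assms(2)])

subsection \<open>Pointwise orthonormal families\<close>

text \<open>The members are global fields although only their values at p are orthonormal: tensorial
  expressions take fields, linear algebra takes values.\<close>

definition orthonormal_at :: "'a \<Rightarrow> nat \<Rightarrow> (nat \<Rightarrow> 'a vfield) \<Rightarrow> bool" where
  "orthonormal_at p m E \<longleftrightarrow> (\<forall>a<m. E a \<in> VF) \<and>
    (\<forall>a<m. \<forall>b<m. g p (E a p) (E b p) = (if a = b then 1 else 0))"

lemma orthonormal_atD:
  assumes "orthonormal_at p m E" "a < m"
  shows "E a \<in> VF" "E a p \<in> T p" "b < m \<Longrightarrow> g p (E a p) (E b p) = (if a = b then 1 else 0)"
  using assms VF_T by (auto simp: orthonormal_at_def)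

lemma g_orthonormal_sum:
  assumes E: "orthonormal_at p m E" and b: "b < m"
  shows "g p (\<Sum>a<m. c a *\<^sub>R E a p) (E b p) = c b"
proof -
  have "g p (\<Sum>a<m. c a *\<^sub>R E a p) (E b p) = (\<Sum>a<m. c a * g p (E a p) (E b p))"
    using orthonormal_atD(2)[OF E] b by (subst g_sum) (auto intro: T_intros simp: g_scale)
  also have "\<dots> = (\<Sum>a<m. if a = b then c a else 0)"
    using orthonormal_atD(3)[OF E] b by (intro sum.cong) auto
  finally show ?thesis using b by simp
qed

lemma orthonormal_inj_on:
  assumes E: "orthonormal_at p m E"
  shows "inj_on (\<lambda>a. E a p) {..<m}"
proof (rule inj_onI)
  fix a b assume "a \<in> {..<m}" "b \<in> {..<m}" "E a p = E b p"
  then show "a = b" using orthonormal_atD(3)[OF E, of a b] orthonormal_atD(3)[OF E, of b b]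
    by (auto split: if_splits)
qed

lemma orthonormal_independent:
  assumes E: "orthonormal_at p m E"
  shows "independent ((\<lambda>a. E a p) ` {..<m})"
proof
  let ?S = "(\<lambda>a. E a p) ` {..<m}"
  assume "dependent ?S"
  then obtain u v where u: "v \<in> ?S" "u v \<noteq> 0" "(\<Sum>w\<in>?S. u w *\<^sub>R w) = 0"
    using dependent_finite[of ?S] by auto
  then obtain b where b: "b < m" "v = E b p" by auto
  have "(\<Sum>a<m. u (E a p) *\<^sub>R E a p) = 0"
    using u(3) by (simp add: sum.reindex[OF orthonormal_inj_on[OF E]])
  then have "u (E b p) = 0"
    using g_orthonormal_sum[OF E b(1), of "\<lambda>a. u (E a p)"] g_zero[OF orthonormal_atD(2)[OF E b(1)]] by simp
  then show False using u b by simp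
qed

lemma orthonormal_expansion:
  assumes E: "orthonormal_at p m E" and u: "u \<in> span ((\<lambda>a. E a p) ` {..<m})"
  shows "u = (\<Sum>a<m. g p u (E a p) *\<^sub>R E a p)"
proof -
  have "u \<in> range (\<lambda>c. \<Sum>w\<in>(\<lambda>a. E a p) ` {..<m}. c w *\<^sub>R w)"
    using u by (subst (asm) span_finite) auto
  then obtain c where c: "u = (\<Sum>a<m. c (E a p) *\<^sub>R E a p)"
    by (auto simp: sum.reindex[OF orthonormal_inj_on[OF E]])
  have "g p u (E b p) = c (E b p)" if "b < m" for b
    using g_orthonormal_sum[OF E that, of "\<lambda>a. c (E a p)"] c by simp
  then have "(\<Sum>a<m. g p u (E a p) *\<^sub>R E a p) = (\<Sum>a<m. c (E a p) *\<^sub>R E a p)" by simp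
  then show ?thesis using c by simp
qed

subsection \<open>Existence of local orthonormal frames\<close>

lemma sections_add:
  assumes "\<And>q. subspace (B q)" "X \<in> sections A B" "Y \<in> sections A B"
  shows "X + Y \<in> sections A B"
  using assms by (auto simp: sections_def VF_add subspace_add)

lemma sections_fscale:
  assumes "\<And>q. subspace (B q)" "f \<in> CF" "X \<in> sections A B"
  shows "f \<cdot>\<^sub>v X \<in> sections A B"
  using assms VF_fscale by (auto simp: sections_def fscale_def subspace_scale)

lemma sections_sum:
  assumes "\<And>q. subspace (B q)" "\<And>i. i \<in> I \<Longrightarrow> X i \<in> sections A B"
  shows "(\<Sum>i\<in>I. X i) \<in> sections A B"
  using assms(2)
proof (induction I rule: infinite_finite_induct)
  have "0 \<in> sections A B" using assms(1) VF_zero by (auto simp: sections_def subspace_0)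
  then show "(\<Sum>i\<in>{}. X i) \<in> sections A B" and "infinite I \<Longrightarrow> (\<Sum>i\<in>I. X i) \<in> sections A B" for I
    by simp_all
qed (auto intro: sections_add assms(1))

lemma sum_fun_apply: "(\<Sum>i\<in>I. h i) p = (\<Sum>i\<in>I. h i p)"
  for h :: "'i \<Rightarrow> 'b \<Rightarrow> 'c::comm_monoid_add"
  by (induction I rule: infinite_finite_induct) auto

text \<open>As long as k < m, the k vectors found so far cannot span m independent ones, so some
  \<open>V i p\<close> lies outside their span and its orthogonal part is nonzero at p. All
  coefficients are global smooth functions, so the sections remain global; orthonormality holds near
  p.\<close>

lemma gram_schmidt:
  assumes B: "\<And>q. subspace (B q)"
    and V: "\<And>i. i \<in> I \<Longrightarrow> V i \<in> sections A B"
    and S: "independent S" "card S = m" "finite S" "S \<subseteq> span ((\<lambda>i. V i p) ` I)"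
  shows "k \<le> m \<Longrightarrow> \<exists>E W. (\<forall>a<k. E a \<in> sections A B) \<and> open W \<and> p \<in> W \<and> (\<forall>q\<in>W. orthonormal_at q k E)"
proof (induction k)
  case 0
  show ?case by (rule exI, rule exI[of _ UNIV]) (simp add: orthonormal_at_def)
next
  case (Suc k)
  then obtain E W where EB: "\<And>a. a < k \<Longrightarrow> E a \<in> sections A B" and W: "open W" "p \<in> W"
    and E: "\<And>q. q \<in> W \<Longrightarrow> orthonormal_at q k E" by auto
  have EV: "E a \<in> VF" if "a < k" for a using EB[OF that] by (simp add: sections_def)
  let ?E = "(\<lambda>a. E a p) ` {..<k}"
  have "\<not> S \<subseteq> span ?E"
  proof
    assume "S \<subseteq> span ?E"
    then have "card S \<le> card ?E" using independent_span_bound[OF _ S(1)] by simp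
    also have "\<dots> \<le> k" using card_image_le[of "{..<k}"] by fastforce
    finally show False using S(2) Suc.prems by simp
  qed
  then obtain i where i: "i \<in> I" "V i p \<notin> span ?E"
    using S(4) span_mono[of "(\<lambda>i. V i p) ` I" "span ?E"] by (auto simp: span_span)
  have VV: "V i \<in> VF" using V[OF i(1)] by (simp add: sections_def)
  define w where "w = V i + (\<Sum>a<k. (\<lambda>q. - G (V i) (E a) q) \<cdot>\<^sub>v E a)"
  have wB: "w \<in> sections A B"
    unfolding w_def
    by (intro sections_add[OF B] sections_sum[OF B] sections_fscale[OF B] CF_uminus g_CF V i(1) VV EB EV) auto
  then have wV: "w \<in> VF" by (simp add: sections_def)
  have w: "w q = V i q - (\<Sum>a<k. g q (V i q) (E a q) *\<^sub>R E a q)" for q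
    by (simp add: w_def fscale_def bilin_on_fields_def sum_fun_apply sum_negf)
  have "w p \<noteq> 0"
  proof
    assume "w p = 0"
    then have "V i p = (\<Sum>a<k. g p (V i p) (E a p) *\<^sub>R E a p)" by (simp add: w)
    also have "\<dots> \<in> span ?E" by (intro span_sum span_scale span_base) auto
    finally show False using i by simp
  qed
  then have Np: "G w w p > 0" using g_pos[OF VF_T[OF wV]] by (simp add: bilin_on_fields_def)
  \<comment> \<open>\<open>G w w\<close> may vanish far from p. Scaling by \<open>\<theta>\<close>
    normalizes w exactly where \<open>G w w\<close> exceeds half its value at p, and the
    neighbourhood is cut down to that region.\<close>
  obtain \<theta> where \<theta>: "smooth_on UNIV \<theta>" "\<And>t. t > G w w p / 2 \<Longrightarrow> \<theta> t = t powr (- (1 / 2))"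
    using exists_smooth_inverse_sqrt[OF Np] by blast
  define E' where "E' a = (if a = k then (\<lambda>q. \<theta> (G w w q)) \<cdot>\<^sub>v w else E a)" for a
  define W' where "W' = W \<inter> {q. G w w q > G w w p / 2}"
  have "open {q. G w w q > G w w p / 2}"
    by (intro open_Collect_less continuous_on_const CF_continuous g_CF wV)
  then have W': "open W'" "p \<in> W'" using W Np by (auto simp: W'_def)
  have E'k: "E' k \<in> sections A B"
    unfolding E'_def using sections_fscale[OF B CF_compose[OF \<theta>(1) g_CF[OF wV wV]] wB] by simp
  have E'B: "E' a \<in> sections A B" if "a < Suc k" for a
    using that EB E'k by (cases "a = k") (auto simp: E'_def)
  have "orthonormal_at q (Suc k) E'" if q: "q \<in> W'" for q
  proof -
    have Eq: "orthonormal_at q k E" using E q by (simp add: W'_def)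
    let ?t = "G w w q"
    have t: "?t > G w w p / 2" using q by (simp add: W'_def)
    then have tpos: "?t > 0" using Np by simp
    have th: "\<theta> ?t * \<theta> ?t * ?t = 1"
    proof -
      have "\<theta> ?t * \<theta> ?t = ?t powr (- 1)"
        unfolding \<theta>(2)[OF t] powr_add[symmetric] by simp
      then show ?thesis using tpos by (simp add: powr_neg_one)
    qed
    have E'q: "E' k q = \<theta> ?t *\<^sub>R w q" by (simp add: E'_def fscale_def)
    have wT: "w q \<in> T q" by (rule VF_T[OF wV])
    have kk: "g q (E' k q) (E' k q) = 1"
      unfolding E'q using wT th
      by (simp add: g_scale g_sym[of "w q" q "\<theta> _ *\<^sub>R w q"] T_intros bilin_on_fields_def algebra_simps)
    have kb: "g q (E' k q) (E b q) = 0" if b: "b < k" for b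
    proof -
      have "g q (w q) (E b q) = g q (V i q) (E b q) - g q (\<Sum>a<k. g q (V i q) (E a q) *\<^sub>R E a q) (E b q)"
        unfolding w using b EV VV by (intro g_diff VF_T T_intros) auto
      also have "\<dots> = 0" using g_orthonormal_sum[OF Eq b, of "\<lambda>a. g q (V i q) (E a q)"] by simp
      finally show ?thesis unfolding E'q using g_scale[OF wT VF_T[OF EV[OF b]]] by simp
    qed
    have bk: "g q (E b q) (E' k q) = 0" if "b < k" for b
      using kb[OF that] g_sym[OF VF_T[OF EV[OF that]], of "E' k q"] E'k VF_T by (auto simp: sections_def)
    have "E' a q = E a q" if "a < k" for a using that by (simp add: E'_def)
    then show ?thesis
      using E'B orthonormal_atD(3)[OF Eq] kk kb bk
      by (auto simp: orthonormal_at_def sections_def less_Suc_eq)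
  qed
  then show ?case using E'B W' by blast
qed

lemma orthonormal_spans:
  assumes E: "orthonormal_at q m E" "\<And>a. a < m \<Longrightarrow> E a q \<in> span S" and S: "finite S" "card S = m"
  shows "span ((\<lambda>a. E a q) ` {..<m}) = span S"
proof -
  let ?E = "(\<lambda>a. E a q) ` {..<m}"
  have i: "independent ?E" by (rule orthonormal_independent[OF E(1)])
  have c: "card ?E = m" using card_image[OF orthonormal_inj_on[OF E(1)]] by simp
  have "S \<subseteq> span ?E"
  proof
    fix x assume x: "x \<in> S"
    show "x \<in> span ?E"
    proof (rule ccontr)
      assume n: "x \<notin> span ?E"
      have "x \<notin> ?E" using n span_base[of x ?E] by blast
      moreover have "independent (insert x ?E)" by (rule independent_insertI[OF n i])
      moreover have "insert x ?E \<subseteq> span S" using E(2) x span_superset[of S] by auto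
      ultimately have "card (insert x ?E) \<le> card S" "card (insert x ?E) = Suc m"
        using independent_span_bound[OF S(1), of "insert x ?E"] c by simp_all
      then show False using S by simp
    qed
  qed
  moreover have "?E \<subseteq> span S" using E(2) by auto
  ultimately show ?thesis by (meson span_minimal subspace_span subset_antisym)
qed

text \<open>Generation by sections is asked at p only. At nearby points the constant rank does the
  rest: m orthonormal vectors in a fibre of dimension m span it.\<close>

lemma exists_local_orthonormal_frame:
  assumes B: "\<And>q. \<exists>S. finite S \<and> independent S \<and> card S = m \<and> span S = B q"
    and V: "\<And>i. i \<in> I \<Longrightarrow> V i \<in> sections A B" "B p = span ((\<lambda>i. V i p) ` I)"
  shows "\<exists>E. local_orthonormal_frame A g B m p E"
proof -
  have sB: "subspace (B q)" for q using B[of q] subspace_span by metis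
  obtain S where "finite S" "independent S" "card S = m" "span S = B p" using B by blast
  moreover from this have "S \<subseteq> span ((\<lambda>i. V i p) ` I)" using V(2) span_superset[of S] by simp
  ultimately have "\<exists>E W. (\<forall>a<m. E a \<in> sections A B) \<and> open W \<and> p \<in> W \<and> (\<forall>q\<in>W. orthonormal_at q m E)"
    by (intro gram_schmidt[OF sB V(1)]) auto
  then obtain E W where EW: "\<forall>a<m. E a \<in> sections A B" "open W" "p \<in> W" "\<forall>q\<in>W. orthonormal_at q m E"
    by blast
  have "span ((\<lambda>a. E a q) ` {..<m}) = B q" if "q \<in> W" for q
  proof -
    obtain S where "finite S" "independent S" "card S = m" "span S = B q" using B by blast
    then show ?thesis
      using orthonormal_spans[of q m E S] EW that by (auto simp: sections_def)
  qed
  then show ?thesis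
    unfolding local_orthonormal_frame_def using EW by (auto simp: orthonormal_at_def intro!: exI[of _ E] exI[of _ W])
qed

lemma local_orthonormal_frameD:
  assumes "local_orthonormal_frame A g B m p E"
  shows "orthonormal_at p m E" "a < m \<Longrightarrow> E a \<in> sections A B" "span ((\<lambda>a. E a p) ` {..<m}) = B p"
  using assms unfolding local_orthonormal_frame_def orthonormal_at_def by (auto simp: sections_def)

subsection \<open>Tensors\<close>

text \<open>The usual criterion for tensors in evaluated form: linearity over the smooth functions
  on global fields, with values at p. \<open>tensorial_cong\<close> turns it into dependence on X p
  alone.\<close>

definition tensorial :: "'a \<Rightarrow> ('a vfield \<Rightarrow> real) \<Rightarrow> bool" where
  "tensorial p Q \<longleftrightarrow> (\<forall>X\<in>VF. \<forall>Y\<in>VF. Q (X + Y) = Q X + Q Y) \<and>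
    (\<forall>f\<in>CF. \<forall>X\<in>VF. Q (f \<cdot>\<^sub>v X) = f p * Q X)"

lemma tensorial_add: "tensorial p Q \<Longrightarrow> X \<in> VF \<Longrightarrow> Y \<in> VF \<Longrightarrow> Q (X + Y) = Q X + Q Y"
  and tensorial_fscale: "tensorial p Q \<Longrightarrow> f \<in> CF \<Longrightarrow> X \<in> VF \<Longrightarrow> Q (f \<cdot>\<^sub>v X) = f p * Q X"
  by (auto simp: tensorial_def)

lemma tensorial_zero: "tensorial p Q \<Longrightarrow> Q 0 = 0"
  using tensorial_add[of p Q 0 0] VF_zero by simp

lemma tensorial_sum:
  assumes "tensorial p Q" "\<And>i. i \<in> I \<Longrightarrow> f i \<in> CF" "\<And>i. i \<in> I \<Longrightarrow> X i \<in> VF"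
  shows "Q (\<Sum>i\<in>I. f i \<cdot>\<^sub>v X i) = (\<Sum>i\<in>I. f i p * Q (X i))"
  using assms(2,3)
proof (induction I rule: infinite_finite_induct)
  case (insert i I)
  have "Q (f i \<cdot>\<^sub>v X i + (\<Sum>i\<in>I. f i \<cdot>\<^sub>v X i)) = f i p * Q (X i) + (\<Sum>i\<in>I. f i p * Q (X i))"
    using insert tensorial_add[OF assms(1) VF_fscale, of "f i" "X i" "\<Sum>i\<in>I. f i \<cdot>\<^sub>v X i"]
      tensorial_fscale[OF assms(1), of "f i" "X i"] VF_sum[of I "\<lambda>i. f i \<cdot>\<^sub>v X i"] VF_fscale
    by simp
  then show ?case by (simp only: sum.insert[OF insert.hyps])
qed (simp_all add: tensorial_zero[OF assms(1)])

end

text \<open>The rank condition is automatic, but is cheaper to verify from the f-structure.\<close>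

locale framed_manifold = riemannian_manifold A g
  for A :: "('a::{t2_space, second_countable_topology}, 'e::euclidean_space) atlas" and g +
  assumes tangent_rank: "\<And>q. \<exists>S. finite S \<and> independent S \<and> card S = DIM('e) \<and> span S = tangent_space A q"
begin

lemma exists_tangent_frame: "\<exists>E. local_orthonormal_frame A g T DIM('e) p E"
proof -
  obtain X :: "'e \<Rightarrow> 'a vfield" where X: "\<And>i. X i \<in> VF" "span ((\<lambda>i. X i p) ` Basis) = T p"
    using exists_spanning_fields[of p] by blast
  show ?thesis
    by (rule exists_local_orthonormal_frame[OF tangent_rank, of Basis X])
       (use X VF_T in \<open>auto simp: sections_def\<close>)
qed

text \<open>Take a bump function b with b p = 1 that is 0 outside the domain of a frame. Then b Z
  expands globally in the frame members, and all coefficients vanish at p.\<close>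

lemma tensorial_vanish:
  assumes Q: "tensorial p Q" and Z: "Z \<in> VF" "Z p = 0"
  shows "Q Z = 0"
proof -
  obtain E W where E0: "\<forall>a<DIM('e). E a \<in> sections A T" and W: "open W" "p \<in> W"
    and EW0: "\<forall>q\<in>W. (\<forall>a<DIM('e). \<forall>b<DIM('e). g q (E a q) (E b q) = (if a = b then 1 else 0)) \<and>
      span ((\<lambda>a. E a q) ` {..<DIM('e)}) = T q"
    using exists_tangent_frame[of p] unfolding local_orthonormal_frame_def by blast
  have E: "E a \<in> VF" if "a < DIM('e)" for a using E0 that by (simp add: sections_def)
  have EW: "orthonormal_at q DIM('e) E" "span ((\<lambda>a. E a q) ` {..<DIM('e)}) = T q" if "q \<in> W" for q
    using EW0 that E by (auto simp: orthonormal_at_def)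
  obtain b where b: "b \<in> CF" "b p = 1" "\<And>q. q \<notin> W \<Longrightarrow> b q = 0" using bump_function[OF W] by blast
  have "b \<cdot>\<^sub>v Z = (\<Sum>a<DIM('e). (\<lambda>q. b q * G Z (E a) q) \<cdot>\<^sub>v E a)"
  proof
    fix q
    show "(b \<cdot>\<^sub>v Z) q = (\<Sum>a<DIM('e). (\<lambda>q. b q * G Z (E a) q) \<cdot>\<^sub>v E a) q"
    proof (cases "q \<in> W")
      case True
      have "Z q = (\<Sum>a<DIM('e). g q (Z q) (E a q) *\<^sub>R E a q)"
        using orthonormal_expansion[OF EW(1)[OF True]] EW(2)[OF True] VF_T[OF Z(1)] by blast
      then have "b q *\<^sub>R Z q = b q *\<^sub>R (\<Sum>a<DIM('e). g q (Z q) (E a q) *\<^sub>R E a q)" by simp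
      then show ?thesis
        by (simp add: fscale_def sum_fun_apply bilin_on_fields_def scaleR_sum_right)
    qed (simp add: fscale_def sum_fun_apply b(3))
  qed
  then have "Q (b \<cdot>\<^sub>v Z) = (\<Sum>a<DIM('e). b p * G Z (E a) p * Q (E a))"
    using tensorial_sum[OF Q, of "{..<DIM('e)}" "\<lambda>a q. b q * G Z (E a) q" E] CF_mult[OF b(1) g_CF[OF Z(1)]] E
    by simp
  also have "\<dots> = 0"
    by (rule sum.neutral) (use g_zero[OF VF_T[OF E]] Z(2) in \<open>auto simp: bilin_on_fields_def\<close>)
  finally show ?thesis using tensorial_fscale[OF Q b(1) Z(1)] b(2) by simp
qed

lemma tensorial_cong:
  assumes Q: "tensorial p Q" and XY: "X \<in> VF" "Y \<in> VF" "X p = Y p"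
  shows "Q X = Q Y"
proof -
  have "Q (X - Y) = 0" by (rule tensorial_vanish[OF Q VF_diff[OF XY(1,2)]]) (use XY in simp)
  then show ?thesis using tensorial_add[OF Q VF_diff[OF XY(1,2)] XY(2)] by simp
qed

lemma tensorial_expansion:
  assumes Q: "tensorial p Q" and E: "orthonormal_at p m E" and Z: "Z \<in> VF"
    "Z p \<in> span ((\<lambda>a. E a p) ` {..<m})"
  shows "Q Z = (\<Sum>a<m. g p (Z p) (E a p) * Q (E a))"
proof -
  have "Q Z = Q (\<Sum>a<m. (\<lambda>q. g p (Z p) (E a p)) \<cdot>\<^sub>v E a)"
  proof (rule tensorial_cong[OF Q Z(1)])
    show "(\<Sum>a<m. (\<lambda>q. g p (Z p) (E a p)) \<cdot>\<^sub>v E a) \<in> VF"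
      using orthonormal_atD(1)[OF E] by (intro VF_sum VF_fscale CF_const) auto
    show "Z p = (\<Sum>a<m. (\<lambda>q. g p (Z p) (E a p)) \<cdot>\<^sub>v E a) p"
      using orthonormal_expansion[OF E Z(2)] by (simp add: sum_fun_apply fscale_def)
  qed
  also have "\<dots> = (\<Sum>a<m. g p (Z p) (E a p) * Q (E a))"
    using orthonormal_atD(1)[OF E] by (intro tensorial_sum[OF Q] CF_const) auto
  finally show ?thesis .
qed

section \<open>Traces do not depend on the orthonormal basis\<close>

lemma parseval:
  assumes E: "orthonormal_at p m E" and u: "u \<in> span ((\<lambda>a. E a p) ` {..<m})" and v: "v \<in> T p"
  shows "(\<Sum>a<m. g p u (E a p) * g p (E a p) v) = g p u v"
proof -
  have "g p u v = g p (\<Sum>a<m. g p u (E a p) *\<^sub>R E a p) v"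
    using orthonormal_expansion[OF E u] by simp
  also have "\<dots> = (\<Sum>a<m. g p u (E a p) * g p (E a p) v)"
    using orthonormal_atD(2)[OF E] v by (subst g_sum) (auto intro: T_intros simp: g_scale)
  finally show ?thesis by simp
qed

text \<open>Expanding one basis in the other introduces an orthogonal matrix, whose orthogonality is
  \<open>parseval\<close>. This makes the choice in \<open>ricci\<close> harmless and later allows
  passing from a frame to its image under \<phi>.\<close>

lemma trace_independent:
  assumes Q1: "\<And>X. X \<in> VF \<Longrightarrow> tensorial p (\<lambda>Y. Q X Y)" and Q2: "\<And>Y. Y \<in> VF \<Longrightarrow> tensorial p (\<lambda>X. Q X Y)"
    and E: "orthonormal_at p m E" and F: "orthonormal_at p m F"
    and EF: "span ((\<lambda>a. E a p) ` {..<m}) = span ((\<lambda>a. F a p) ` {..<m})"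
  shows "(\<Sum>a<m. Q (E a) (E a)) = (\<Sum>a<m. Q (F a) (F a))"
proof -
  note VE = orthonormal_atD(1)[OF E] and VF = orthonormal_atD(1)[OF F]
  note TE = orthonormal_atD(2)[OF E] and TF = orthonormal_atD(2)[OF F]
  have EspF: "E a p \<in> span ((\<lambda>a. F a p) ` {..<m})" if "a < m" for a
    unfolding EF[symmetric] using that by (intro span_base) auto
  have FspE: "F a p \<in> span ((\<lambda>a. E a p) ` {..<m})" if "a < m" for a
    unfolding EF using that by (intro span_base) auto
  have "Q (E a) (E a) = (\<Sum>b<m. \<Sum>c<m. g p (E a p) (F b p) * (g p (E a p) (F c p) * Q (F b) (F c)))"
    if a: "a < m" for a
  proof -
    have "Q (E a) (E a) = (\<Sum>b<m. g p (E a p) (F b p) * Q (F b) (E a))"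
      by (rule tensorial_expansion[OF Q2 F]) (use a VE EspF in auto)
    also have "\<dots> = (\<Sum>b<m. g p (E a p) (F b p) * (\<Sum>c<m. g p (E a p) (F c p) * Q (F b) (F c)))"
      by (intro sum.cong refl arg_cong2[where f = "(*)"] tensorial_expansion[OF Q1 F])
         (use a VE VF EspF in auto)
    finally show ?thesis by (simp add: sum_distrib_left)
  qed
  then have "(\<Sum>a<m. Q (E a) (E a)) =
      (\<Sum>a<m. \<Sum>b<m. \<Sum>c<m. g p (E a p) (F b p) * (g p (E a p) (F c p) * Q (F b) (F c)))"
    by simp
  also have "\<dots> = (\<Sum>b<m. \<Sum>a<m. \<Sum>c<m. g p (E a p) (F b p) * (g p (E a p) (F c p) * Q (F b) (F c)))"
    by (rule sum.swap)
  also have "\<dots> = (\<Sum>b<m. \<Sum>c<m. \<Sum>a<m. g p (E a p) (F b p) * (g p (E a p) (F c p) * Q (F b) (F c)))"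
    by (rule sum.cong[OF refl]) (rule sum.swap)
  also have "\<dots> = (\<Sum>b<m. \<Sum>c<m. (\<Sum>a<m. g p (F b p) (E a p) * g p (E a p) (F c p)) * Q (F b) (F c))"
  proof (intro sum.cong refl)
    fix b c assume b: "b \<in> {..<m}"
    have eq: "g p (E a p) (F b p) * (g p (E a p) (F c p) * Q (F b) (F c)) =
        g p (F b p) (E a p) * g p (E a p) (F c p) * Q (F b) (F c)" if "a < m" for a
      using g_sym[OF TE[OF that] TF[of b]] b by simp
    then show "(\<Sum>a<m. g p (E a p) (F b p) * (g p (E a p) (F c p) * Q (F b) (F c))) =
        (\<Sum>a<m. g p (F b p) (E a p) * g p (E a p) (F c p)) * Q (F b) (F c)"
      unfolding sum_distrib_right by (rule sum.cong[OF refl]) (simp only: lessThan_iff eq)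
  qed
  also have "\<dots> = (\<Sum>b<m. \<Sum>c<m. g p (F b p) (F c p) * Q (F b) (F c))"
    by (intro sum.cong refl arg_cong2[where f = "(*)"] parseval[OF E]) (use FspE TF in auto)
  also have "\<dots> = (\<Sum>b<m. \<Sum>c<m. if b = c then Q (F b) (F c) else 0)"
    by (intro sum.cong refl) (simp add: orthonormal_atD(3)[OF F])
  finally show ?thesis by simp
qed

end

section \<open>Brackets and curvature\<close>

context smooth_manifold
begin

lemma dir_deriv_field_simps:
  "dir_deriv (X + Y) f p = dir_deriv X f p + dir_deriv Y f p"
  "dir_deriv (X - Y) f p = dir_deriv X f p - dir_deriv Y f p"
  "dir_deriv (- X) f p = - dir_deriv X f p"
  "dir_deriv (h \<cdot>\<^sub>v X) f p = h p * dir_deriv X f p"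
  by (simp_all add: dir_deriv_def fscale_def scaleR_fun_def)

lemma dir_deriv_CF: "X \<in> VF \<Longrightarrow> f \<in> CF \<Longrightarrow> dir_deriv X f \<in> CF"
  by (rule vector_fieldsD(2))

lemma dir_deriv_fun_simps:
  "dir_deriv (X + Y) f = (\<lambda>p. dir_deriv X f p + dir_deriv Y f p)"
  "dir_deriv (h \<cdot>\<^sub>v X) f = (\<lambda>p. h p * dir_deriv X f p)"
  "f \<in> CF \<Longrightarrow> dir_deriv (lie_bracket A X Y) f =
    (\<lambda>p. dir_deriv X (dir_deriv Y f) p - dir_deriv Y (dir_deriv X f) p)"
  by (auto simp: dir_deriv_field_simps dir_deriv_bracket)

lemma bracket_swap: "lie_bracket A X Y = - lie_bracket A Y X"
  by (auto simp: lie_bracket_def fun_eq_iff)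

lemma bracket_add:
  assumes "X \<in> VF" "Y \<in> VF" "Z \<in> VF"
  shows "lie_bracket A (X + Y) Z = lie_bracket A X Z + lie_bracket A Y Z"
    and "lie_bracket A Z (X + Y) = lie_bracket A Z X + lie_bracket A Z Y"
proof -
  show *: "lie_bracket A (X + Y) Z = lie_bracket A X Z + lie_bracket A Y Z"
    by (rule VF_eqI)
       (use assms in \<open>simp_all add: VF_bracket VF_add dir_deriv_bracket dir_deriv_field_simps
          dir_deriv_fun_simps dir_deriv_add dir_deriv_CF\<close>)
  show "lie_bracket A Z (X + Y) = lie_bracket A Z X + lie_bracket A Z Y"
    unfolding bracket_swap[of Z] * by simp
qed

lemma bracket_fscale:
  assumes "X \<in> VF" "Y \<in> VF" "h \<in> CF"
  shows "lie_bracket A (h \<cdot>\<^sub>v X) Y = h \<cdot>\<^sub>v lie_bracket A X Y - dir_deriv Y h \<cdot>\<^sub>v X"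
    and "lie_bracket A Y (h \<cdot>\<^sub>v X) = h \<cdot>\<^sub>v lie_bracket A Y X + dir_deriv Y h \<cdot>\<^sub>v X"
proof -
  show *: "lie_bracket A (h \<cdot>\<^sub>v X) Y = h \<cdot>\<^sub>v lie_bracket A X Y - dir_deriv Y h \<cdot>\<^sub>v X"
    by (rule VF_eqI)
       (use assms in \<open>simp_all add: VF_bracket VF_fscale VF_diff dir_deriv_bracket dir_deriv_field_simps
          dir_deriv_fun_simps dir_deriv_mult dir_deriv_CF algebra_simps\<close>)
  show "lie_bracket A Y (h \<cdot>\<^sub>v X) = h \<cdot>\<^sub>v lie_bracket A Y X + dir_deriv Y h \<cdot>\<^sub>v X"
    unfolding bracket_swap[of Y] * by (simp add: fscale_def fun_eq_iff)
qed

lemma bracket_zero: "X \<in> VF \<Longrightarrow> lie_bracket A X 0 = 0"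
  using bracket_add(2)[OF VF_zero VF_zero, of X] by simp

lemma Jacobi:
  assumes "X \<in> VF" "Y \<in> VF" "Z \<in> VF"
  shows "lie_bracket A X (lie_bracket A Y Z) =
    lie_bracket A (lie_bracket A X Y) Z + lie_bracket A Y (lie_bracket A X Z)"
  by (rule VF_eqI)
     (use assms in \<open>simp_all add: VF_bracket VF_add dir_deriv_bracket dir_deriv_field_simps
        dir_deriv_fun_simps dir_deriv_diff dir_deriv_CF\<close>)

lemma fscale_add: "f \<cdot>\<^sub>v (X + Y) = f \<cdot>\<^sub>v X + f \<cdot>\<^sub>v Y"
  by (auto simp: fscale_def scaleR_add_right)

end

section \<open>Affine connections and the tensoriality of curvature\<close>

locale affine_manifold = smooth_manifold A
  for A :: "('a::{t2_space, second_countable_topology}, 'e::euclidean_space) atlas" +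
  fixes D :: "'a vfield \<Rightarrow> 'a vfield \<Rightarrow> 'a vfield"
  assumes affine_connection: "affine_connection A D"
begin

lemma D_VF: "X \<in> VF \<Longrightarrow> Y \<in> VF \<Longrightarrow> D X Y \<in> VF"
  and D_add1: "X \<in> VF \<Longrightarrow> Y \<in> VF \<Longrightarrow> Z \<in> VF \<Longrightarrow> D (X + Y) Z = D X Z + D Y Z"
  and D_add2: "X \<in> VF \<Longrightarrow> Y \<in> VF \<Longrightarrow> Z \<in> VF \<Longrightarrow> D X (Y + Z) = D X Y + D X Z"
  and D_fscale1: "f \<in> CF \<Longrightarrow> X \<in> VF \<Longrightarrow> Y \<in> VF \<Longrightarrow> D (f \<cdot>\<^sub>v X) Y = f \<cdot>\<^sub>v D X Y"
  and D_fscale2: "f \<in> CF \<Longrightarrow> X \<in> VF \<Longrightarrow> Y \<in> VF \<Longrightarrow> D X (f \<cdot>\<^sub>v Y) = dir_deriv X f \<cdot>\<^sub>v Y + f \<cdot>\<^sub>v D X Y"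
  using affine_connection unfolding affine_connection_def by auto

lemma D_uminus1: "X \<in> VF \<Longrightarrow> Y \<in> VF \<Longrightarrow> D (- X) Y = - D X Y"
proof -
  assume "X \<in> VF" "Y \<in> VF"
  moreover have "(\<lambda>p. - 1) \<cdot>\<^sub>v Z = - Z" for Z :: "'a vfield" by (auto simp: fscale_def)
  ultimately show ?thesis using D_fscale1[OF CF_const, of X Y "-1"] by simp
qed

lemma D_diff1: "X \<in> VF \<Longrightarrow> Y \<in> VF \<Longrightarrow> Z \<in> VF \<Longrightarrow> D (X - Y) Z = D X Z - D Y Z"
  using D_add1[OF _ VF_uminus, of X Y Z] D_uminus1[of Y Z] by simp

lemma D_zero2: "X \<in> VF \<Longrightarrow> D X 0 = 0"
  using D_add2[OF _ VF_zero VF_zero, of X] by simp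

lemma D_uminus2: "X \<in> VF \<Longrightarrow> Y \<in> VF \<Longrightarrow> D X (- Y) = - D X Y"
proof -
  assume XY: "X \<in> VF" "Y \<in> VF"
  then have "D X Y + D X (- Y) = 0" using D_add2[OF XY VF_uminus[OF XY(2)]] D_zero2 by simp
  then show ?thesis by (rule minus_unique[symmetric])
qed

abbreviation "R \<equiv> curvature A D"

lemma R_VF: "X \<in> VF \<Longrightarrow> Y \<in> VF \<Longrightarrow> Z \<in> VF \<Longrightarrow> R X Y Z \<in> VF"
  unfolding curvature_def by (intro VF_diff D_VF VF_bracket)

lemma R_swap: "X \<in> VF \<Longrightarrow> Y \<in> VF \<Longrightarrow> Z \<in> VF \<Longrightarrow> R X Y Z = - R Y X Z"
  unfolding curvature_def bracket_swap[of X Y] by (simp add: D_uminus1 VF_bracket)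

lemma R_add1:
  assumes "X \<in> VF" "Y \<in> VF" "Z \<in> VF" "W \<in> VF"
  shows "R (X + Y) Z W = R X Z W + R Y Z W"
  unfolding curvature_def
  using assms by (simp add: D_add1 D_add2 D_VF bracket_add VF_bracket algebra_simps)

lemma R_add2:
  assumes "X \<in> VF" "Y \<in> VF" "Z \<in> VF" "W \<in> VF"
  shows "R Z (X + Y) W = R Z X W + R Z Y W"
  using R_add1[OF assms] assms R_swap[of Z _ W] by (simp add: VF_add)

lemma R_add3:
  assumes "X \<in> VF" "Y \<in> VF" "Z \<in> VF" "W \<in> VF"
  shows "R X Y (Z + W) = R X Y Z + R X Y W"
  unfolding curvature_def
  using assms by (simp add: D_add2 D_VF VF_bracket algebra_simps)

text \<open>The Leibniz term Y(f) D_X Z is cancelled by the one that the bracket of f X and Y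
  produces.\<close>

lemma R_fscale1:
  assumes "f \<in> CF" "X \<in> VF" "Y \<in> VF" "Z \<in> VF"
  shows "R (f \<cdot>\<^sub>v X) Y Z = f \<cdot>\<^sub>v R X Y Z"
proof -
  have "R (f \<cdot>\<^sub>v X) Y Z = f \<cdot>\<^sub>v D X (D Y Z) - (dir_deriv Y f \<cdot>\<^sub>v D X Z + f \<cdot>\<^sub>v D Y (D X Z))
      - (f \<cdot>\<^sub>v D (lie_bracket A X Y) Z - dir_deriv Y f \<cdot>\<^sub>v D X Z)"
    using assms
    by (simp add: curvature_def D_fscale1 D_fscale2 D_VF bracket_fscale D_diff1 VF_fscale VF_bracket dir_deriv_CF)
  also have "\<dots> = f \<cdot>\<^sub>v R X Y Z"
    by (rule ext) (simp add: curvature_def fscale_def scaleR_diff_right)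
  finally show ?thesis .
qed

lemma R_fscale2:
  assumes "f \<in> CF" "X \<in> VF" "Y \<in> VF" "Z \<in> VF"
  shows "R X (f \<cdot>\<^sub>v Y) Z = f \<cdot>\<^sub>v R X Y Z"
proof -
  have "R X (f \<cdot>\<^sub>v Y) Z = - (f \<cdot>\<^sub>v R Y X Z)"
    using R_swap[of X "f \<cdot>\<^sub>v Y" Z] R_fscale1[of f Y X Z] assms by (simp add: VF_fscale)
  also have "\<dots> = f \<cdot>\<^sub>v R X Y Z"
    unfolding R_swap[OF assms(2-4)] by (rule ext) (simp add: fscale_def)
  finally show ?thesis .
qed

text \<open>The first-order Leibniz terms cancel in pairs, the second-order ones against the
  derivative of f along the bracket.\<close>

lemma R_fscale3:
  assumes "f \<in> CF" "X \<in> VF" "Y \<in> VF" "Z \<in> VF"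
  shows "R X Y (f \<cdot>\<^sub>v Z) = f \<cdot>\<^sub>v R X Y Z"
proof -
  have DD: "D U (D V (f \<cdot>\<^sub>v Z)) = (dir_deriv U (dir_deriv V f) \<cdot>\<^sub>v Z + dir_deriv V f \<cdot>\<^sub>v D U Z)
      + (dir_deriv U f \<cdot>\<^sub>v D V Z + f \<cdot>\<^sub>v D U (D V Z))" if "U \<in> VF" "V \<in> VF" for U V
    using assms that by (simp add: D_fscale2 D_add2 D_VF VF_fscale dir_deriv_CF)
  have "R X Y (f \<cdot>\<^sub>v Z) = D X (D Y (f \<cdot>\<^sub>v Z)) - D Y (D X (f \<cdot>\<^sub>v Z))
      - (dir_deriv (lie_bracket A X Y) f \<cdot>\<^sub>v Z + f \<cdot>\<^sub>v D (lie_bracket A X Y) Z)"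
    using assms by (simp add: curvature_def D_fscale2 VF_bracket)
  also have "\<dots> = f \<cdot>\<^sub>v R X Y Z"
    unfolding DD[OF assms(2,3)] DD[OF assms(3,2)]
    by (rule ext)
       (simp add: curvature_def fscale_def scaleR_diff_right scaleR_diff_left dir_deriv_bracket[OF assms(1)])
  finally show ?thesis .
qed

end

section \<open>S-manifolds and their characteristic connection\<close>

locale S_manifold_connection = riemannian_manifold A g
  for A :: "('a::{t2_space, second_countable_topology}, 'e::euclidean_space) atlas" and g +
  fixes n s :: nat
    and \<phi> :: "'a \<Rightarrow> 'a tvec \<Rightarrow> 'a tvec"
    and \<xi> :: "nat \<Rightarrow> 'a vfield"
    and \<eta> :: "nat \<Rightarrow> 'a \<Rightarrow> 'a tvec \<Rightarrow> real"
    and nabla_g :: "'a vfield \<Rightarrow> 'a vfield \<Rightarrow> 'a vfield"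
  assumes S: "S_manifold A n s \<phi> \<xi> \<eta> g"
    and LC: "levi_civita_connection A g nabla_g"
begin

lemmas S_unfolded = S[unfolded S_manifold_def metric_f_manifold_def]

lemma DIM_eq: "DIM('e) = 2 * n + s" and s_ge_1: "1 \<le> s"
  and dim_horizontal: "dim (\<phi> p ` T p) = 2 * n"
  using S_unfolded by auto

lemma phi_T: "u \<in> T p \<Longrightarrow> \<phi> p u \<in> T p"
  and phi_add: "u \<in> T p \<Longrightarrow> v \<in> T p \<Longrightarrow> \<phi> p (u + v) = \<phi> p u + \<phi> p v"
  and phi_scale: "u \<in> T p \<Longrightarrow> \<phi> p (r *\<^sub>R u) = r *\<^sub>R \<phi> p u"
  using S_unfolded unfolding endomorphism_field_def by auto

lemma xi_VF: "i < s \<Longrightarrow> \<xi> i \<in> VF"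
  using S_unfolded by auto

lemma xi_T: "i < s \<Longrightarrow> \<xi> i p \<in> T p"
  using xi_VF VF_T by blast

lemma eta_add: "i < s \<Longrightarrow> u \<in> T p \<Longrightarrow> v \<in> T p \<Longrightarrow> \<eta> i p (u + v) = \<eta> i p u + \<eta> i p v"
  and eta_scale: "i < s \<Longrightarrow> u \<in> T p \<Longrightarrow> \<eta> i p (r *\<^sub>R u) = r * \<eta> i p u"
  using S_unfolded unfolding one_form_def by auto

lemma eta_phi: "u \<in> T p \<Longrightarrow> i < s \<Longrightarrow> \<eta> i p (\<phi> p u) = 0"
  and eta_xi: "i < s \<Longrightarrow> j < s \<Longrightarrow> \<eta> i p (\<xi> j p) = (if i = j then 1 else 0)"
  and phi_phi: "u \<in> T p \<Longrightarrow> \<phi> p (\<phi> p u) = - u + (\<Sum>i<s. \<eta> i p u *\<^sub>R \<xi> i p)"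
  and g_phi_phi: "u \<in> T p \<Longrightarrow> v \<in> T p \<Longrightarrow>
    g p (\<phi> p u) (\<phi> p v) = g p u v - (\<Sum>i<s. \<eta> i p u * \<eta> i p v)"
  and ker_phi: "{u \<in> T p. \<phi> p u = 0} = span ((\<lambda>i. \<xi> i p) ` {..<s})"
  using S_unfolded by blast+

lemma phi_xi: "i < s \<Longrightarrow> \<phi> p (\<xi> i p) = 0"
  using ker_phi[of p] span_base[of "\<xi> i p" "(\<lambda>i. \<xi> i p) ` {..<s}"] by blast

lemma phi_zero: "\<phi> p 0 = 0"
  using phi_scale[OF T_intros(6), of p 0] by simp

lemma phi_minus: "u \<in> T p \<Longrightarrow> \<phi> p (- u) = - \<phi> p u"
  using phi_scale[of u p "-1"] by simp

lemma eta_zero: "i < s \<Longrightarrow> \<eta> i p 0 = 0"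
  using eta_scale[OF _ T_intros(6), of i p 0] by simp

lemma eta_minus: "i < s \<Longrightarrow> u \<in> T p \<Longrightarrow> \<eta> i p (- u) = - \<eta> i p u"
  using eta_scale[of i u p "-1"] by simp

text \<open>With a Reeb field as first argument the left side of the compatibility identity is
  0.\<close>

lemma g_xi: 
  assumes "i < s" "u \<in> T p" shows "g p (\<xi> i p) u = \<eta> i p u"
proof -
  have "(\<Sum>j<s. \<eta> j p (\<xi> i p) * \<eta> j p u) = (\<Sum>j<s. if j = i then \<eta> j p u else 0)"
    using assms by (intro sum.cong) (auto simp: eta_xi)
  then show ?thesis
    using g_phi_phi[OF xi_T[OF assms(1)] assms(2)] assms by (simp add: phi_xi g_zero phi_T)
qed

text \<open>Compatibility for u and \<phi> v, followed by the formula for \<phi>^2, whose Reeb terms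
  are orthogonal to the image of \<phi>.\<close>

lemma phi_skew:
  assumes u: "u \<in> T p" and v: "v \<in> T p"
  shows "g p (\<phi> p u) v = - g p u (\<phi> p v)"
proof -
  have V: "(\<Sum>i<s. \<eta> i p u *\<^sub>R \<xi> i p) \<in> T p" using xi_T by (intro T_intros) auto
  have "g p u (\<phi> p v) = g p (\<phi> p (\<phi> p v)) (\<phi> p u)"
    using g_phi_phi[OF u phi_T[OF v]] by (simp add: eta_phi v g_sym[OF phi_T[OF u] phi_T[OF phi_T[OF v]]])
  also have "\<dots> = g p (- v) (\<phi> p u) + g p (\<Sum>i<s. \<eta> i p v *\<^sub>R \<xi> i p) (\<phi> p u)"
    unfolding phi_phi[OF v] using v u xi_T by (intro g_add phi_T T_intros) auto
  also have "g p (\<Sum>i<s. \<eta> i p v *\<^sub>R \<xi> i p) (\<phi> p u) = (\<Sum>i<s. \<eta> i p v * g p (\<xi> i p) (\<phi> p u))"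
    using xi_T by (subst g_sum) (auto intro: T_intros phi_T u simp: g_scale xi_T phi_T u)
  also have "\<dots> = 0" using u by (simp add: g_xi phi_T eta_phi)
  also have "g p (- v) (\<phi> p u) = - g p (\<phi> p u) v"
    unfolding g_minus[OF v phi_T[OF u]] g_sym[OF v phi_T[OF u]] ..
  finally show ?thesis by simp
qed

section \<open>The horizontal bundle and frames adapted to the splitting\<close>

abbreviation "H \<equiv> horizontal A \<phi>"

lemma horizontal_iff: "u \<in> H p \<longleftrightarrow> u \<in> T p \<and> (\<forall>i<s. \<eta> i p u = 0)"
proof
  assume "u \<in> T p \<and> (\<forall>i<s. \<eta> i p u = 0)"
  then have u: "u \<in> T p" and "\<phi> p (\<phi> p u) = - u" by (simp_all add: phi_phi)
  then have "u = \<phi> p (- \<phi> p u)" by (simp add: phi_minus phi_T)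
  then show "u \<in> H p" unfolding horizontal_def using T_intros(4)[OF phi_T[OF u]] by blast
qed (auto simp: horizontal_def phi_T eta_phi)

lemma subspace_H: "subspace (H p)"
  unfolding subspace_def
  by (auto simp: horizontal_iff T_intros eta_add eta_scale eta_zero)

definition adapted_frame :: "(nat \<Rightarrow> 'a vfield) \<Rightarrow> nat \<Rightarrow> 'a vfield" where
  "adapted_frame E a = (if a < 2 * n then E a else \<xi> (a - 2 * n))"

lemma adapted_frame_orthonormal:
  assumes E: "orthonormal_at p (2 * n) E" and EH: "\<And>a. a < 2 * n \<Longrightarrow> E a p \<in> H p"
  shows "orthonormal_at p DIM('e) (adapted_frame E)"
proof -
  have 1: "g p (\<xi> i p) (E a p) = 0" "g p (E a p) (\<xi> i p) = 0" if "i < s" "a < 2 * n" for i a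
    using g_xi[OF that(1)] EH[OF that(2)] that g_sym[of "E a p" p "\<xi> i p"] xi_T
    by (auto simp: horizontal_iff)
  have 2: "g p (\<xi> i p) (\<xi> j p) = (if i = j then 1 else 0)" if "i < s" "j < s" for i j
    using g_xi[OF that(1) xi_T[OF that(2)]] eta_xi that by simp
  have 3: "a - 2 * n < s" if "\<not> a < 2 * n" "a < 2 * n + s" for a using that by simp
  show ?thesis
    unfolding orthonormal_at_def DIM_eq adapted_frame_def
    using orthonormal_atD[OF E] 3 by (auto simp: 1 2 xi_VF)
qed

lemma adapted_frame_span:
  assumes EH: "span ((\<lambda>a. E a p) ` {..<2 * n}) = H p"
  shows "span ((\<lambda>a. adapted_frame E a p) ` {..<DIM('e)}) = T p"
proof -
  let ?S = "span ((\<lambda>a. adapted_frame E a p) ` {..<DIM('e)})"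
  have E: "E a p \<in> ?S" if "a < 2 * n" for a
    using that by (intro span_base) (auto simp: adapted_frame_def DIM_eq intro!: rev_image_eqI[of a])
  have X: "\<xi> i p \<in> ?S" if "i < s" for i
    using that by (intro span_base) (auto simp: adapted_frame_def DIM_eq intro!: rev_image_eqI[of "2 * n + i"])
  have "H p \<subseteq> ?S"
    unfolding EH[symmetric] by (rule span_minimal) (use E in auto)
  moreover have "u \<in> ?S" if "u \<in> T p" "H p \<subseteq> ?S" for u
  proof -
    have "- \<phi> p (\<phi> p u) \<in> ?S"
      using that phi_T by (intro span_neg) (auto simp: horizontal_def)
    moreover have "(\<Sum>i<s. \<eta> i p u *\<^sub>R \<xi> i p) \<in> ?S" using X by (intro span_sum span_scale) auto
    ultimately have "- \<phi> p (\<phi> p u) + (\<Sum>i<s. \<eta> i p u *\<^sub>R \<xi> i p) \<in> ?S" by (rule span_add)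
    then show ?thesis by (simp add: phi_phi[OF that(1)])
  qed
  moreover have "?S \<subseteq> T p"
  proof (rule span_minimal)
    have "E a p \<in> T p" if "a < 2 * n" for a
      using EH span_base[of "E a p" "(\<lambda>a. E a p) ` {..<2 * n}"] that horizontal_iff by blast
    then show "(\<lambda>a. adapted_frame E a p) ` {..<DIM('e)} \<subseteq> T p"
      using xi_T by (auto simp: adapted_frame_def DIM_eq)
  qed (rule subspace_tangent_space)
  ultimately show ?thesis by blast
qed

lemma phi_VF: "X \<in> VF \<Longrightarrow> on_fields \<phi> X \<in> VF"
  using S_unfolded unfolding endomorphism_field_def by auto

lemma eta_CF: "i < s \<Longrightarrow> X \<in> VF \<Longrightarrow> form_on_fields (\<eta> i) X \<in> CF"
  using S_unfolded unfolding one_form_def by auto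

lemma horizontal_rank: "\<exists>S. finite S \<and> independent S \<and> card S = 2 * n \<and> span S = H q"
proof -
  obtain X :: "'e \<Rightarrow> 'a vfield" where "\<And>i. X i \<in> VF" and X: "span ((\<lambda>i. X i q) ` Basis) = T q"
    using exists_spanning_fields[of q] by blast
  obtain S where S: "S \<subseteq> H q" "independent S" "H q \<subseteq> span S" "card S = dim (H q)"
    using basis_exists[of "H q"] by blast
  have "S \<subseteq> span ((\<lambda>i. X i q) ` Basis)" using S(1) X by (auto simp: horizontal_iff)
  then have "finite S" using independent_span_bound[OF _ S(2), of "(\<lambda>i. X i q) ` Basis"] by simp
  moreover have "span S = H q" using S(3) span_minimal[OF S(1) subspace_H] by (rule subset_antisym[rotated])
  ultimately show ?thesis using S dim_horizontal by (auto simp: horizontal_def)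
qed

lemma exists_horizontal_frame: "\<exists>E. local_orthonormal_frame A g H (2 * n) p E"
proof -
  obtain X :: "'e \<Rightarrow> 'a vfield" where X: "\<And>i. X i \<in> VF" "span ((\<lambda>i. X i p) ` Basis) = T p"
    using exists_spanning_fields[of p] by blast
  let ?Y = "\<lambda>i. on_fields \<phi> (X i)"
  have Y: "?Y i \<in> sections A H" for i
    using phi_VF[OF X(1)] VF_T[OF X(1)] by (auto simp: sections_def on_fields_def horizontal_def)
  have "H p = span ((\<lambda>i. ?Y i p) ` Basis)"
  proof
    have "subspace {u \<in> T p. \<phi> p u \<in> span ((\<lambda>i. ?Y i p) ` Basis)}"
      by (auto simp: subspace_def T_intros phi_add phi_scale phi_zero span_add span_scale span_zero)
    then have "span ((\<lambda>i. X i p) ` Basis) \<subseteq> {u \<in> T p. \<phi> p u \<in> span ((\<lambda>i. ?Y i p) ` Basis)}"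
      using VF_T[OF X(1)] by (intro span_minimal) (auto simp: on_fields_def intro: span_base)
    then show "H p \<subseteq> span ((\<lambda>i. ?Y i p) ` Basis)" unfolding X(2) by (auto simp: horizontal_def)
    show "span ((\<lambda>i. ?Y i p) ` Basis) \<subseteq> H p"
      by (rule span_minimal[OF _ subspace_H]) (use Y in \<open>auto simp: sections_def\<close>)
  qed
  then show ?thesis
    by (intro exists_local_orthonormal_frame[OF horizontal_rank, of Basis ?Y]) (use Y in auto)
qed

sublocale framed_manifold A g
proof
  fix q
  obtain E where E: "local_orthonormal_frame A g H (2 * n) q E" using exists_horizontal_frame by blast
  note E' = local_orthonormal_frameD[OF E]
  have o: "orthonormal_at q DIM('e) (adapted_frame E)"
    by (rule adapted_frame_orthonormal[OF E'(1)]) (use E'(2) in \<open>auto simp: sections_def\<close>)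
  show "\<exists>S. finite S \<and> independent S \<and> card S = DIM('e) \<and> span S = T q"
    using orthonormal_independent[OF o] adapted_frame_span[of E q] E'(3) card_image[OF orthonormal_inj_on[OF o]]
    by (intro exI[of _ "(\<lambda>a. adapted_frame E a q) ` {..<DIM('e)}"]) auto
qed

subsection \<open>Calculus with fields\<close>

abbreviation "ph \<equiv> on_fields \<phi>"
abbreviation "et i \<equiv> form_on_fields (\<eta> i)"
abbreviation "br \<equiv> lie_bracket A"
abbreviation "dd \<equiv> dir_deriv"
abbreviation "nb \<equiv> char_connection s \<phi> \<xi> \<eta> g nabla_g"

lemma G_add: "X \<in> VF \<Longrightarrow> Y \<in> VF \<Longrightarrow> Z \<in> VF \<Longrightarrow> G (X + Y) Z p = G X Z p + G Y Z p"
  and G_diff: "X \<in> VF \<Longrightarrow> Y \<in> VF \<Longrightarrow> Z \<in> VF \<Longrightarrow> G (X - Y) Z p = G X Z p - G Y Z p"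
  and G_minus: "X \<in> VF \<Longrightarrow> Z \<in> VF \<Longrightarrow> G (- X) Z p = - G X Z p"
  and G_fscale: "X \<in> VF \<Longrightarrow> Z \<in> VF \<Longrightarrow> G (f \<cdot>\<^sub>v X) Z p = f p * G X Z p"
  and G_commute: "X \<in> VF \<Longrightarrow> Y \<in> VF \<Longrightarrow> G X Y p = G Y X p"
  and G_zero: "Z \<in> VF \<Longrightarrow> G 0 Z p = 0"
  by (simp_all add: bilin_on_fields_def VF_T g_add g_diff g_minus g_scale fscale_def g_zero g_sym)

lemma G_add2: "X \<in> VF \<Longrightarrow> Y \<in> VF \<Longrightarrow> Z \<in> VF \<Longrightarrow> G Z (X + Y) p = G Z X p + G Z Y p"
  and G_diff2: "X \<in> VF \<Longrightarrow> Y \<in> VF \<Longrightarrow> Z \<in> VF \<Longrightarrow> G Z (X - Y) p = G Z X p - G Z Y p"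
  and G_minus2: "X \<in> VF \<Longrightarrow> Z \<in> VF \<Longrightarrow> G Z (- X) p = - G Z X p"
  and G_zero2: "Z \<in> VF \<Longrightarrow> G Z 0 p = 0"
  by (simp_all only: G_commute[of Z _ p] VF_add VF_diff VF_uminus VF_zero G_add G_diff G_minus G_zero)

lemma G_fscale2: "X \<in> VF \<Longrightarrow> Z \<in> VF \<Longrightarrow> f \<in> CF \<Longrightarrow> G Z (f \<cdot>\<^sub>v X) p = f p * G Z X p"
  by (simp only: G_commute[of Z _ p] VF_fscale G_fscale)

lemma VF_eqI_G:
  assumes "X \<in> VF" "Y \<in> VF" "\<And>Z p. Z \<in> VF \<Longrightarrow> G X Z p = G Y Z p"
  shows "X = Y"
proof
  fix p
  have d: "X - Y \<in> VF" using assms VF_diff by blast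
  have "G (X - Y) (X - Y) p = 0" using assms d by (simp add: G_diff)
  then have "(X - Y) p = 0" using g_pos[OF VF_T[OF d], of p] by (force simp: bilin_on_fields_def)
  then show "X p = Y p" by simp
qed

lemma ph_add: "X \<in> VF \<Longrightarrow> Y \<in> VF \<Longrightarrow> ph (X + Y) = ph X + ph Y"
  and ph_fscale: "X \<in> VF \<Longrightarrow> ph (f \<cdot>\<^sub>v X) = f \<cdot>\<^sub>v ph X"
  and ph_minus: "X \<in> VF \<Longrightarrow> ph (- X) = - ph X"
  and ph_xi: "i < s \<Longrightarrow> ph (\<xi> i) = 0"
  and ph_zero: "ph 0 = 0"
  by (auto simp: on_fields_def fscale_def fun_eq_iff VF_T phi_add phi_scale phi_minus phi_xi phi_zero)

lemma ph_diff: "X \<in> VF \<Longrightarrow> Y \<in> VF \<Longrightarrow> ph (X - Y) = ph X - ph Y"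
  using ph_add[OF _ VF_uminus, of X Y] ph_minus[of Y] by simp

lemma G_ph: "X \<in> VF \<Longrightarrow> Y \<in> VF \<Longrightarrow> G (ph X) Y p = - G X (ph Y) p"
  by (simp add: bilin_on_fields_def on_fields_def phi_skew VF_T)

lemma G_xi: "i < s \<Longrightarrow> X \<in> VF \<Longrightarrow> G (\<xi> i) X p = et i X p"
  by (simp add: bilin_on_fields_def form_on_fields_def g_xi VF_T)

lemma G_xi2: "i < s \<Longrightarrow> X \<in> VF \<Longrightarrow> G X (\<xi> i) p = et i X p"
  using G_xi G_commute xi_VF by metis

lemma et_ph: "i < s \<Longrightarrow> X \<in> VF \<Longrightarrow> et i (ph X) p = 0"
  and et_xi: "i < s \<Longrightarrow> j < s \<Longrightarrow> et i (\<xi> j) p = (if i = j then 1 else 0)"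
  and et_minus: "i < s \<Longrightarrow> X \<in> VF \<Longrightarrow> et i (- X) p = - et i X p"
  and et_add: "i < s \<Longrightarrow> X \<in> VF \<Longrightarrow> Y \<in> VF \<Longrightarrow> et i (X + Y) p = et i X p + et i Y p"
  and et_fscale: "i < s \<Longrightarrow> X \<in> VF \<Longrightarrow> et i (f \<cdot>\<^sub>v X) p = f p * et i X p"
  by (simp_all add: form_on_fields_def on_fields_def fscale_def eta_phi eta_xi VF_T eta_add eta_minus eta_scale)

lemma et_diff: "i < s \<Longrightarrow> X \<in> VF \<Longrightarrow> Y \<in> VF \<Longrightarrow> et i (X - Y) p = et i X p - et i Y p"
  using et_add[OF _ _ VF_uminus, of i X Y p] et_minus[of i Y p] by simp

lemma ph_ph: "X \<in> VF \<Longrightarrow> ph (ph X) = - X + (\<Sum>i<s. et i X \<cdot>\<^sub>v \<xi> i)"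
proof (rule ext)
  fix p assume "X \<in> VF"
  then show "ph (ph X) p = (- X + (\<Sum>i<s. et i X \<cdot>\<^sub>v \<xi> i)) p"
    by (simp add: fun_eq_iff on_fields_def form_on_fields_def fscale_def sum_fun_apply phi_phi VF_T)
qed

lemma G_ph_ph: "X \<in> VF \<Longrightarrow> Y \<in> VF \<Longrightarrow> G (ph X) (ph Y) p = G X Y p - (\<Sum>i<s. et i X p * et i Y p)"
  by (simp add: bilin_on_fields_def on_fields_def form_on_fields_def g_phi_phi VF_T)

lemma dEta: "j < s \<Longrightarrow> X \<in> VF \<Longrightarrow> Y \<in> VF \<Longrightarrow>
    2 * G X (ph Y) p = dd X (et j Y) p - dd Y (et j X) p - et j (br X Y) p"
  using S_unfolded by (simp add: bilin_on_fields_def fundamental_form_def ext_deriv_def on_fields_def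
      form_on_fields_def)

lemma LC_affine: "affine_connection A nabla_g"
  and LC_torsion: "X \<in> VF \<Longrightarrow> Y \<in> VF \<Longrightarrow> nabla_g X Y - nabla_g Y X = br X Y"
  and LC_metric: "X \<in> VF \<Longrightarrow> Y \<in> VF \<Longrightarrow> Z \<in> VF \<Longrightarrow>
    dd X (G Y Z) = (\<lambda>p. G (nabla_g X Y) Z p + G Y (nabla_g X Z) p)"
  using LC unfolding levi_civita_connection_def by auto

sublocale lc: affine_manifold A nabla_g
  by standard (rule LC_affine)

lemmas fields = VF_add VF_diff VF_uminus VF_zero VF_fscale VF_bracket xi_VF phi_VF lc.D_VF
lemmas funs = g_CF eta_CF dir_deriv_CF CF_add CF_diff CF_mult CF_uminus CF_const

subsection \<open>Invariance of the structure under the Reeb fields\<close>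

text \<open>Invariance of \<eta>_i under the Reeb flow: d\<eta>_i(\<xi>_j, X) = 2 g(\<xi>_j, \<phi>
  X) = 2 \<eta>_j(\<phi> X) = 0, and \<eta>_i(\<xi>_j) is constant.\<close>

lemma xi_eta:
  assumes "i < s" "j < s" "X \<in> VF"
  shows "dd (\<xi> j) (et i X) = et i (br (\<xi> j) X)"
proof
  fix p
  have "et i (\<xi> j) = (\<lambda>p. if i = j then 1 else 0)" using et_xi assms by blast
  then have "dd X (et i (\<xi> j)) p = 0" using dir_deriv_const[OF assms(3)] by simp
  then show "dd (\<xi> j) (et i X) p = et i (br (\<xi> j) X) p"
    using dEta[of i "\<xi> j" X p] assms by (simp add: fields G_xi et_ph)
qed

lemma vanishI:
  assumes "W \<in> VF" "ph W = 0" "\<And>i p. i < s \<Longrightarrow> et i W p = 0"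
  shows "W = 0"
proof (rule ext)
  fix p
  have W: "W p \<in> T p" using assms VF_T by blast
  have "\<phi> p (W p) = 0" using assms(2) by (metis on_fields_def zero_fun_apply)
  then have "0 = - W p + (\<Sum>i<s. \<eta> i p (W p) *\<^sub>R \<xi> i p)" using phi_phi[OF W] by (simp add: phi_zero)
  then show "W p = 0 p" using assms(3) by (simp add: form_on_fields_def)
qed

text \<open>As \<phi> \<xi> = 0 and d\<eta>(\<xi>, X) = 0, normality at (\<xi>, X) says that \<phi>
  annihilates the difference of the two sides. The \<eta>-components of that difference vanish by
  \<open>xi_eta\<close>.\<close>

lemma br_xi_ph:
  assumes j: "j < s" and X: "X \<in> VF"
  shows "br (\<xi> j) (ph X) = ph (br (\<xi> j) X)"
proof -
  let ?W = "ph (br (\<xi> j) X) - br (\<xi> j) (ph X)"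
  note f = fields j X
  have e: "ext_deriv A (\<eta> i) (\<xi> j) X = (\<lambda>p. 0)" if "i < s" for i
  proof
    fix p
    show "ext_deriv A (\<eta> i) (\<xi> j) X p = 0"
      using dEta[of i "\<xi> j" X p] that f
      by (simp add: ext_deriv_def form_on_fields_def[symmetric] G_xi et_ph)
        (simp add: form_on_fields_def)
  qed
  have "normality_tensor A s \<phi> \<xi> \<eta> (\<xi> j) X = 0"
    using S_unfolded f by auto
  moreover have "br 0 Y = 0" if "Y \<in> VF" for Y
    using bracket_swap[of 0 Y] bracket_zero[OF that] by simp
  moreover have "(\<Sum>i<s. ext_deriv A (\<eta> i) (\<xi> j) X \<cdot>\<^sub>v \<xi> i) = 0"
    by (rule sum.neutral) (auto simp: e fscale_def fun_eq_iff)
  ultimately have "ph (ph (br (\<xi> j) X)) - ph (br (\<xi> j) (ph X)) = 0"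
    using f by (simp add: normality_tensor_def nijenhuis_def ph_xi ph_zero)
  then have phW: "ph ?W = 0" using f by (simp add: ph_diff)
  have etW: "et i ?W p = 0" if "i < s" for i p
  proof -
    have "et i (ph X) = (\<lambda>p. 0)" using et_ph[OF that X] by blast
    then have "et i (br (\<xi> j) (ph X)) p = 0"
      using xi_eta[OF that j, of "ph X"] dir_deriv_const[OF xi_VF[OF j], of 0 p] f by simp
    then show ?thesis using that f by (simp add: et_diff et_ph)
  qed
  have "?W \<in> VF" using f by simp
  then have "?W = 0" by (rule vanishI[OF _ phW etW])
  then show ?thesis by simp
qed

text \<open>The Lie derivative commutes with d and annihilates \<eta>_j, hence also F = d\<eta>_j /
  2; carried out here with the bracket formula for d\<eta>_j and the Jacobi identity.\<close>

lemma xi_F: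
  assumes j: "j < s" and X: "X \<in> VF" and Y: "Y \<in> VF"
  shows "dd (\<xi> j) (G X (ph Y)) p = G (br (\<xi> j) X) (ph Y) p + G X (ph (br (\<xi> j) Y)) p"
proof -
  let ?x = "\<xi> j"
  note f = fields funs j X Y
  have e: "et j (br ?x Z) = dd ?x (et j Z)" if "Z \<in> VF" for Z using xi_eta[OF j j that] by simp
  have "2 * dd ?x (G X (ph Y)) p = dd ?x (\<lambda>p. 2 * G X (ph Y) p) p"
    by (rule dir_deriv_cmult[symmetric]) (use f in simp_all)
  also have "(\<lambda>p. 2 * G X (ph Y) p) = (\<lambda>p. dd X (et j Y) p - dd Y (et j X) p - et j (br X Y) p)"
    using dEta[OF j X Y] by blast
  also have "dd ?x \<dots> p = dd ?x (dd X (et j Y)) p - dd ?x (dd Y (et j X)) p - et j (br ?x (br X Y)) p"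
    using f by (simp add: dir_deriv_diff e)
  also have "\<dots> = 2 * G (br ?x X) (ph Y) p + 2 * G X (ph (br ?x Y)) p"
  proof -
    have "et j (br ?x (br X Y)) p = et j (br (br ?x X) Y) p + et j (br X (br ?x Y)) p"
      unfolding Jacobi[OF xi_VF[OF j] X Y] using f by (intro et_add) simp_all
    moreover have "2 * G (br ?x X) (ph Y) p =
        dd (br ?x X) (et j Y) p - dd Y (dd ?x (et j X)) p - et j (br (br ?x X) Y) p"
      using dEta[OF j _ Y, of "br ?x X" p] f e[OF X] by simp
    moreover have "2 * G X (ph (br ?x Y)) p =
        dd X (dd ?x (et j Y)) p - dd (br ?x Y) (et j X) p - et j (br X (br ?x Y)) p"
      using dEta[OF j X, of "br ?x Y" p] f e[OF Y] by simp
    ultimately show ?thesis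
      using dir_deriv_bracket[OF eta_CF[OF j Y], of ?x X p] dir_deriv_bracket[OF eta_CF[OF j X], of ?x Y p]
      by linarith
  qed
  finally show ?thesis by simp
qed

text \<open>The metric is g(\<phi> X, \<phi> Y) plus the sum of the \<eta>_i(X) \<eta>_i(Y), and F,
  \<phi> and the \<eta>_i are all invariant under the Reeb flow.\<close>

lemma Killing:
  assumes j: "j < s" and X: "X \<in> VF" and Y: "Y \<in> VF"
  shows "dd (\<xi> j) (G X Y) p = G (br (\<xi> j) X) Y p + G X (br (\<xi> j) Y) p"
proof -
  let ?x = "\<xi> j"
  note f = fields funs j X Y
  have "G X Y = (\<lambda>p. G (ph X) (ph Y) p + (\<Sum>i<s. et i X p * et i Y p))"
    using G_ph_ph[OF X Y] by auto
  then have "dd ?x (G X Y) p = dd ?x (\<lambda>p. G (ph X) (ph Y) p + (\<Sum>i<s. et i X p * et i Y p)) p" by simp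
  also have "\<dots> = dd ?x (G (ph X) (ph Y)) p + dd ?x (\<lambda>p. \<Sum>i<s. et i X p * et i Y p) p"
    by (rule dir_deriv_add) (use f in \<open>auto intro!: CF_sum\<close>)
  also have "dd ?x (\<lambda>p. \<Sum>i<s. et i X p * et i Y p) p = (\<Sum>i<s. dd ?x (\<lambda>p. et i X p * et i Y p) p)"
    unfolding dir_deriv_def by (rule tangent_sum[OF VF_T[OF xi_VF[OF j]]]) (use f in auto)
  also have "\<dots> = (\<Sum>i<s. et i X p * et i (br ?x Y) p + et i Y p * et i (br ?x X) p)"
    by (intro sum.cong refl) (use f xi_eta in \<open>simp add: dir_deriv_mult\<close>)
  also have "dd ?x (G (ph X) (ph Y)) p = G (ph (br ?x X)) (ph Y) p + G (ph X) (ph (br ?x Y)) p"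
    using f by (simp add: xi_F br_xi_ph)
  finally show ?thesis
    using f by (simp add: G_ph_ph sum.distrib algebra_simps)
qed

text \<open>The Killing property makes g(\<nabla>_X \<xi>, Y), for the Levi-Civita connection, skew
  in X and Y, so d\<eta>_j(X, Y) is twice this form; it is also 2 F(X, Y) = - 2 g(\<phi> X,
  Y).\<close>

lemma LC_xi:
  assumes j: "j < s" and X: "X \<in> VF"
  shows "nabla_g X (\<xi> j) = - ph X"
proof (rule VF_eqI_G)
  note f = fields funs j X
  show "nabla_g X (\<xi> j) \<in> VF" "- ph X \<in> VF" using f by simp_all
  fix Y p assume Y: "Y \<in> VF"
  let ?x = "\<xi> j"
  have br: "br U V = nabla_g U V - nabla_g V U" if "U \<in> VF" "V \<in> VF" for U V
    using LC_torsion[OF that] by simp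
  have k: "G (nabla_g X ?x) Y p + G X (nabla_g Y ?x) p = 0"
    using Killing[OF j X Y, of p] LC_metric[of ?x X Y] br[of ?x X] br[of ?x Y] f Y
    by (simp add: G_diff G_diff2)
  have e: "et j Z = G Z ?x" if "Z \<in> VF" for Z using G_xi2[OF j that] by auto
  have "2 * G X (ph Y) p = G (nabla_g X ?x) Y p - G X (nabla_g Y ?x) p"
    using dEta[OF j X Y, of p] f Y br[OF X Y]
    by (simp add: e LC_metric G_diff G_commute[of Y "nabla_g X ?x"])
  then show "G (nabla_g X ?x) Y p = G (- ph X) Y p"
    using k f Y by (simp add: G_minus G_ph)
qed

subsection \<open>The characteristic connection\<close>

text \<open>Half the torsion, with the sums over \<open>i\<close> absorbed into \<open>etb\<close> and \<open>xib\<close>.\<close>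

definition etb :: "'a vfield \<Rightarrow> 'a \<Rightarrow> real" where "etb X = (\<lambda>p. \<Sum>i<s. et i X p)"
definition xib :: "'a vfield" where "xib = (\<Sum>i<s. \<xi> i)"
definition tau :: "'a vfield \<Rightarrow> 'a vfield \<Rightarrow> 'a vfield" where
  "tau X Y = G X (ph Y) \<cdot>\<^sub>v xib - etb X \<cdot>\<^sub>v ph Y + etb Y \<cdot>\<^sub>v ph X"

lemma etb_CF: "X \<in> VF \<Longrightarrow> etb X \<in> CF"
  unfolding etb_def by (intro CF_sum eta_CF) auto

lemma xib_VF: "xib \<in> VF"
  unfolding xib_def by (intro VF_sum xi_VF) auto

lemma nb_eq: "nb X Y = nabla_g X Y + tau X Y"
proof (rule ext)
  fix p
  have "((1 / 2) *\<^sub>R char_torsion s \<phi> \<xi> \<eta> g X Y) p = (\<Sum>i<s. G X (ph Y) p *\<^sub>R \<xi> i p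
      - et i X p *\<^sub>R ph Y p + et i Y p *\<^sub>R ph X p)"
    unfolding char_torsion_def scaleR_fun_def[of _ "_ :: 'a vfield"] sum_fun_apply
    by (simp add: sum_fun_apply fscale_def bilin_on_fields_def fundamental_form_def on_fields_def)
  also have "\<dots> = tau X Y p"
    by (simp add: tau_def xib_def etb_def fscale_def sum_fun_apply sum.distrib sum_subtractf
        scaleR_sum_right scaleR_sum_left)
  finally show "nb X Y p = (nabla_g X Y + tau X Y) p" by (simp add: char_connection_def)
qed

lemma tau_VF: "X \<in> VF \<Longrightarrow> Y \<in> VF \<Longrightarrow> tau X Y \<in> VF"
  unfolding tau_def by (intro VF_add VF_diff VF_fscale g_CF etb_CF phi_VF xib_VF)

lemma etb_simps:
  "X \<in> VF \<Longrightarrow> Y \<in> VF \<Longrightarrow> etb (X + Y) p = etb X p + etb Y p"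
  "X \<in> VF \<Longrightarrow> etb (f \<cdot>\<^sub>v X) p = f p * etb X p"
  "X \<in> VF \<Longrightarrow> etb (ph X) p = 0"
  "j < s \<Longrightarrow> etb (\<xi> j) p = 1"
  by (simp_all add: etb_def et_add et_fscale et_ph et_xi sum.distrib sum_distrib_left)

lemma G_xib: "X \<in> VF \<Longrightarrow> G xib X p = etb X p"
proof -
  assume X: "X \<in> VF"
  have "G xib X p = (\<Sum>i<s. g p (\<xi> i p) (X p))"
    unfolding bilin_on_fields_def xib_def
    by (subst sum_fun_apply, rule g_sum) (use xi_T VF_T X in auto)
  then show ?thesis using X by (simp add: etb_def g_xi VF_T form_on_fields_def)
qed

text \<open>This is the 3-form F(X, Y) \<eta>(Z) + F(Y, Z) \<eta>(X) + F(Z, X) \<eta>(Y) with \<eta>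
  the sum of the \<eta>_i. Identities for \<open>tau\<close> are checked by pairing with a field and
  reading them off here.\<close>

lemma G_tau:
  assumes "X \<in> VF" "Y \<in> VF" "Z \<in> VF"
  shows "G (tau X Y) Z p = G X (ph Y) p * etb Z p + etb X p * G Y (ph Z) p - etb Y p * G X (ph Z) p"
  unfolding tau_def using assms
  by (simp add: G_add G_diff G_fscale fields funs etb_CF xib_VF G_xib G_ph)

lemma F_skew: "X \<in> VF \<Longrightarrow> Y \<in> VF \<Longrightarrow> G Y (ph X) p = - G X (ph Y) p"
  using G_ph[of X Y p] G_commute[of "ph X" Y p] by (simp add: phi_VF)

lemma tau_swap:
  assumes "X \<in> VF" "Y \<in> VF"
  shows "tau X Y - tau Y X = 2 *\<^sub>R tau X Y"
proof -
  have "tau Y X = - tau X Y"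
    by (rule VF_eqI_G)
       (use assms F_skew[of X Y] in \<open>simp_all add: tau_VF fields G_minus G_tau\<close>)
  then show ?thesis by (simp add: scaleR_2)
qed

lemma nb_affine: "affine_connection A nb"
proof -
  have 1: "tau (X + Y) Z = tau X Z + tau Y Z" "tau Z (X + Y) = tau Z X + tau Z Y"
    if "X \<in> VF" "Y \<in> VF" "Z \<in> VF" for X Y Z
    by (rule VF_eqI_G; use that in \<open>simp add: tau_VF VF_add G_add G_add2 G_tau etb_simps phi_VF ph_add algebra_simps\<close>)+
  have 2: "tau (f \<cdot>\<^sub>v X) Z = f \<cdot>\<^sub>v tau X Z" "tau Z (f \<cdot>\<^sub>v X) = f \<cdot>\<^sub>v tau Z X"
    if "X \<in> VF" "f \<in> CF" "Z \<in> VF" for X f Z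
    by (rule VF_eqI_G; use that in \<open>simp add: tau_VF VF_fscale G_fscale G_fscale2 G_tau etb_simps phi_VF ph_fscale algebra_simps\<close>)+
  show ?thesis
    unfolding affine_connection_def nb_eq
    by (auto simp: fields tau_VF lc.D_add1 lc.D_add2 lc.D_fscale1 lc.D_fscale2 1 2 fscale_add algebra_simps)
qed

sublocale nb: affine_manifold A nb
  by standard (rule nb_affine)

text \<open>Half the torsion contributes \<phi> X, which cancels the - \<phi> X of the Levi-Civita
  connection.\<close>

lemma nb_xi:
  assumes "j < s" "X \<in> VF"
  shows "nb X (\<xi> j) = 0"
proof -
  have "tau X (\<xi> j) = ph X"
    by (rule VF_eqI_G) 
       (use assms in \<open>simp_all add: tau_VF fields G_tau etb_simps ph_xi G_zero2 G_ph G_xi et_ph\<close>)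
  then show ?thesis using assms by (simp add: nb_eq LC_xi)
qed

lemma nb_metric:
  assumes "X \<in> VF" "Y \<in> VF" "Z \<in> VF"
  shows "dd X (G Y Z) p = G (nb X Y) Z p + G Y (nb X Z) p"
proof -
  have "G (tau X Y) Z p + G (tau X Z) Y p = 0"
    using assms F_skew[of Y Z p] by (simp add: G_tau)
  moreover have "G (tau X Z) Y p = G Y (tau X Z) p"
    using assms by (intro G_commute tau_VF)
  ultimately show ?thesis
    using assms by (simp add: LC_metric nb_eq G_add G_add2 fields tau_VF)
qed

lemma nb_torsion:
  assumes "X \<in> VF" "Y \<in> VF"
  shows "nb X Y - nb Y X = br X Y + 2 *\<^sub>R tau X Y"
  unfolding nb_eq tau_swap[OF assms, symmetric] LC_torsion[OF assms, symmetric] by simp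

lemma nb_eta:
  assumes "i < s" "X \<in> VF" "Y \<in> VF"
  shows "et i (nb X Y) = dd X (et i Y)"
proof
  fix p
  have "et i Y = G Y (\<xi> i)" using G_xi2 assms by auto
  then show "et i (nb X Y) p = dd X (et i Y) p"
    using nb_metric[of X Y "\<xi> i" p] assms by (simp add: xi_VF nb_xi G_zero2 G_xi2 nb.D_VF)
qed

text \<open>The torsion formula with \<nabla>_Y \<xi> = 0; the torsion of (\<xi>, Y) is - 2 \<phi>
  Y.\<close>

lemma nb_xi_left:
  assumes "j < s" "Y \<in> VF"
  shows "nb (\<xi> j) Y = br (\<xi> j) Y - 2 *\<^sub>R ph Y"
proof -
  have "tau (\<xi> j) Y = - ph Y"
    by (rule VF_eqI_G)
       (use assms in \<open>simp_all add: tau_VF fields G_tau etb_simps G_xi et_ph G_minus G_ph\<close>)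
  then show ?thesis
    using nb_torsion[of "\<xi> j" Y] assms by (simp add: xi_VF nb_xi)
qed

subsection \<open>Horizontal fields\<close>

abbreviation "HF \<equiv> sections A H"

lemma HF_iff: "X \<in> HF \<longleftrightarrow> X \<in> VF \<and> (\<forall>i<s. et i X = (\<lambda>p. 0))"
  using VF_T by (auto simp: sections_def horizontal_iff form_on_fields_def fun_eq_iff)

lemma HF_VF: "X \<in> HF \<Longrightarrow> X \<in> VF"
  by (simp add: HF_iff)

lemma HF_et: "X \<in> HF \<Longrightarrow> i < s \<Longrightarrow> et i X = (\<lambda>p. 0)"
  by (simp add: HF_iff)

lemma HF_etb: "X \<in> HF \<Longrightarrow> etb X = (\<lambda>p. 0)"
  by (simp add: HF_et etb_def)

lemma HF_ph: "X \<in> VF \<Longrightarrow> ph X \<in> HF"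
  by (auto simp: HF_iff phi_VF et_ph)

lemma HF_minus: "X \<in> HF \<Longrightarrow> - X \<in> HF"
  by (auto simp: HF_iff VF_uminus et_minus)

lemma HF_nb: "U \<in> VF \<Longrightarrow> X \<in> HF \<Longrightarrow> nb U X \<in> HF"
  using dir_deriv_const[of U 0] by (auto simp: HF_iff nb.D_VF nb_eta)

lemma HF_br_xi: "j < s \<Longrightarrow> X \<in> HF \<Longrightarrow> br (\<xi> j) X \<in> HF"
  using dir_deriv_const[OF xi_VF, of j 0] by (auto simp: HF_iff fields xi_eta[symmetric])

lemma ph_ph_HF: "X \<in> HF \<Longrightarrow> ph (ph X) = - X"
proof -
  assume X: "X \<in> HF"
  have "(\<Sum>i<s. et i X \<cdot>\<^sub>v \<xi> i) = 0"
    by (rule sum.neutral) (use X in \<open>auto simp: HF_et fscale_def fun_eq_iff\<close>)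
  then show ?thesis using ph_ph[OF HF_VF[OF X]] by simp
qed

lemma tau_HF:
  assumes "X \<in> HF" "Y \<in> HF"
  shows "tau X Y = G X (ph Y) \<cdot>\<^sub>v xib"
  unfolding tau_def HF_etb[OF assms(1)] HF_etb[OF assms(2)] by (rule ext) (simp add: fscale_def)

lemma G_xib_HF: "X \<in> HF \<Longrightarrow> G (f \<cdot>\<^sub>v xib) X p = 0"
  using HF_etb[of X] by (simp add: G_fscale xib_VF HF_VF G_xib)

lemma nb_torsion_HF:
  assumes X: "X \<in> HF" and Y: "Y \<in> HF"
  shows "nb X Y - nb Y X = br X Y + (\<lambda>p. 2 * G X (ph Y) p) \<cdot>\<^sub>v xib"
  unfolding nb_torsion[OF HF_VF[OF X] HF_VF[OF Y]] tau_HF[OF X Y]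
  by (rule ext) (simp add: fscale_def scaleR_fun_def[of _ "_ :: 'a vfield"])

text \<open>The horizontal projection, built from \<phi> so that smoothness and linearity are
  immediate; \<open>hor_part_eq\<close> identifies it with the definite description
  \<open>hor_part\<close>.\<close>

definition hp :: "'a vfield \<Rightarrow> 'a vfield" where "hp X = - ph (ph X)"

lemma hp_HF: "X \<in> VF \<Longrightarrow> hp X \<in> HF"
  unfolding hp_def by (intro HF_minus HF_ph phi_VF)

lemma hp_id: "X \<in> HF \<Longrightarrow> hp X = X"
  by (simp add: hp_def ph_ph_HF)

lemma hp_decomp: "X \<in> VF \<Longrightarrow> X = hp X + (\<Sum>i<s. et i X \<cdot>\<^sub>v \<xi> i)"
  by (simp add: hp_def ph_ph)

lemma hp_add: "X \<in> VF \<Longrightarrow> Y \<in> VF \<Longrightarrow> hp (X + Y) = hp X + hp Y"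
  by (simp add: hp_def ph_add phi_VF)

lemma hp_vertical: "X \<in> VF \<Longrightarrow> ph X = 0 \<Longrightarrow> hp X = 0"
  by (simp add: hp_def ph_zero)

text \<open>Uniqueness behind the description: a vector d that is both horizontal and vertical
  satisfies 0 = \<phi> (\<phi> d) = - d.\<close>

lemma hor_part_eq:
  assumes X: "X \<in> VF"
  shows "hor_part A \<phi> X = hp X"
proof (rule ext)
  fix p
  have V: "X p - hp X p = (\<Sum>i<s. \<eta> i p (X p) *\<^sub>R \<xi> i p)"
    using arg_cong[OF hp_decomp[OF X], of "\<lambda>Y. Y p"]
    by (simp add: sum_fun_apply fscale_def form_on_fields_def algebra_simps)
  have v: "X p - hp X p \<in> vertical A \<phi> p"
    unfolding vertical_def ker_phi V by (intro span_sum span_scale span_base imageI)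
  have h: "hp X p \<in> H p" using hp_HF[OF X] by (simp add: sections_def)
  have u: "w = hp X p" if w: "w \<in> H p" "X p - w \<in> vertical A \<phi> p" for w
  proof -
    have wT: "w \<in> T p" "hp X p \<in> T p" using w h by (simp_all add: horizontal_iff)
    let ?d = "w - hp X p"
    have "?d = (X p - hp X p) - (X p - w)" by simp
    moreover have "subspace (vertical A \<phi> p)" unfolding vertical_def ker_phi by (rule subspace_span)
    ultimately have "?d \<in> vertical A \<phi> p"
      using subspace_diff w(2) \<open>X p - hp X p \<in> vertical A \<phi> p\<close> by metis
    then have "\<phi> p ?d = 0" by (simp add: vertical_def)
    moreover have d: "?d \<in> H p" by (rule subspace_diff[OF subspace_H w(1) h])
    ultimately have "0 = - ?d + (\<Sum>i<s. \<eta> i p ?d *\<^sub>R \<xi> i p)"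
      using phi_phi[of ?d p] by (simp add: phi_zero horizontal_iff)
    also have "(\<Sum>i<s. \<eta> i p ?d *\<^sub>R \<xi> i p) = 0"
      by (rule sum.neutral) (use d in \<open>simp add: horizontal_iff\<close>)
    finally have "?d = 0" by (simp only: add_0_right neg_0_equal_iff_equal)
    then show ?thesis by (rule eq_iff_diff_eq_0[THEN iffD2])
  qed
  show "hor_part A \<phi> X p = hp X p"
    unfolding hor_part_def
  proof (rule the_equality)
    show "hp X p \<in> H p \<and> X p - hp X p \<in> vertical A \<phi> p" using h v ..
  qed (use u in blast)
qed

subsection \<open>The transverse connection\<close>

abbreviation "tc \<equiv> transverse_connection A \<phi> nabla_g"

text \<open>The transverse connection is given separately on the two parts of U, so each part is
  compared with \<nabla> and the results are added: the horizontal part needs no correction, each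
  Reeb component contributes 2 \<phi> Y.\<close>

lemma tc_eq:
  assumes U: "U \<in> VF" and Y: "Y \<in> HF"
  shows "tc U Y = nb U Y + (\<lambda>p. 2 * etb U p) \<cdot>\<^sub>v ph Y"
proof -
  note YV = HF_VF[OF Y]
  \<comment> \<open>The defect between the claimed formula and the projected Lie bracket. It is
    additive, so its vanishing on vertical fields reduces to multiples of a single Reeb
    field.\<close>
  define L where "L V = nb V Y + (\<lambda>p. 2 * etb V p) \<cdot>\<^sub>v ph Y - hp (br V Y)" for V
  have L_add: "L (V + W) = L V + L W" if "V \<in> VF" "W \<in> VF" for V W
  proof -
    have "(\<lambda>p. 2 * etb (V + W) p) \<cdot>\<^sub>v ph Y = (\<lambda>p. 2 * etb V p) \<cdot>\<^sub>v ph Y + (\<lambda>p. 2 * etb W p) \<cdot>\<^sub>v ph Y"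
      using that by (intro HOL.ext[where f = "_ \<cdot>\<^sub>v _"]) (simp add: fscale_def etb_simps algebra_simps)
    then show ?thesis
      using that YV by (simp add: L_def nb.D_add1 bracket_add hp_add VF_bracket)
  qed
  have L_xi: "L (f \<cdot>\<^sub>v \<xi> i) = 0" if "i < s" "f \<in> CF" for f i
  proof -
    have "hp (br (f \<cdot>\<^sub>v \<xi> i) Y) = f \<cdot>\<^sub>v br (\<xi> i) Y"
    proof -
      \<comment> \<open>The derivative of f multiplies the vertical \<open>\<xi> i\<close> and
        disappears under \<open>hp\<close>.\<close>
      have "br (f \<cdot>\<^sub>v \<xi> i) Y = f \<cdot>\<^sub>v br (\<xi> i) Y + (- (dd Y f \<cdot>\<^sub>v \<xi> i))"
        using that YV by (simp add: bracket_fscale fields)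
      moreover have "hp (- (dd Y f \<cdot>\<^sub>v \<xi> i)) = 0"
      proof (rule hp_vertical)
        have "dd Y f \<cdot>\<^sub>v 0 = 0" by (auto simp: fscale_def)
        then show "ph (- (dd Y f \<cdot>\<^sub>v \<xi> i)) = 0"
          using that YV by (simp add: ph_minus fields funs ph_fscale ph_xi)
      qed (use that YV in \<open>simp add: fields funs\<close>)
      moreover have "hp (f \<cdot>\<^sub>v br (\<xi> i) Y) = f \<cdot>\<^sub>v br (\<xi> i) Y"
        using sections_fscale[OF subspace_H that(2) HF_br_xi[OF that(1) Y]] by (rule hp_id)
      moreover have "hp (f \<cdot>\<^sub>v br (\<xi> i) Y + (- (dd Y f \<cdot>\<^sub>v \<xi> i))) =
          hp (f \<cdot>\<^sub>v br (\<xi> i) Y) + hp (- (dd Y f \<cdot>\<^sub>v \<xi> i))"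
        using that YV by (intro hp_add fields funs) auto
      ultimately show ?thesis by (simp only: add_0_right)
    qed
    moreover have "(\<lambda>p. 2 * etb (f \<cdot>\<^sub>v \<xi> i) p) = (\<lambda>p. 2 * f p)"
      using that by (simp add: etb_simps xi_VF)
    moreover have "nb (f \<cdot>\<^sub>v \<xi> i) Y = f \<cdot>\<^sub>v (br (\<xi> i) Y - 2 *\<^sub>R ph Y)"
      using that YV by (simp add: nb.D_fscale1 xi_VF nb_xi_left)
    ultimately have "L (f \<cdot>\<^sub>v \<xi> i) =
        f \<cdot>\<^sub>v (br (\<xi> i) Y - 2 *\<^sub>R ph Y) + (\<lambda>p. 2 * f p) \<cdot>\<^sub>v ph Y - f \<cdot>\<^sub>v br (\<xi> i) Y"
      by (simp add: L_def)
    also have "\<dots> = 0"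
      by (rule ext) (simp add: fscale_def scaleR_fun_def[of _ "_ :: 'a vfield"] scaleR_diff_right)
    finally show ?thesis .
  qed
  have L_sum: "L (\<Sum>i\<in>I. X i) = 0" if "finite I" "\<And>i. i \<in> I \<Longrightarrow> X i \<in> VF \<and> L (X i) = 0"
    for I :: "nat set" and X
    using that
  proof (induction I rule: finite_induct)
    case empty
    have "L 0 = 0" using L_add[OF VF_zero VF_zero] by simp
    then show ?case by (simp only: sum.empty)
  next
    case (insert i I)
    have "L (X i + sum X I) = L (X i) + L (sum X I)"
      using insert.prems by (intro L_add VF_sum) auto
    also have "L (X i) = 0" using insert.prems by blast
    also have "L (sum X I) = 0" using insert by blast
    also have "(0 :: 'a vfield) + 0 = 0" by (rule add_0_right)
    finally have "L (X i + sum X I) = 0" .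
    then show ?case by (simp only: sum.insert[OF insert.hyps])
  qed
  let ?V = "\<Sum>i<s. et i U \<cdot>\<^sub>v \<xi> i"
  have V: "?V \<in> VF" by (intro VF_sum VF_fscale eta_CF xi_VF U) auto
  have "L ?V = 0" by (rule L_sum) (use U in \<open>auto simp: fields funs L_xi\<close>)
  then have hV: "hp (br ?V Y) = nb ?V Y + (\<lambda>p. 2 * etb ?V p) \<cdot>\<^sub>v ph Y" by (simp add: L_def)
  have U': "hp U \<in> HF" by (rule hp_HF[OF U])
  note U'V = HF_VF[OF U']
  have "nabla_g (hp U) Y + tau (hp U) Y = nb (hp U) Y" by (simp add: nb_eq)
  then have "hp (nabla_g (hp U) Y) + hp (tau (hp U) Y) = hp (nb (hp U) Y)"
    using hp_add[of "nabla_g (hp U) Y" "tau (hp U) Y"] U'V YV by (simp add: fields tau_VF)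
  moreover have "hp (nb (hp U) Y) = nb (hp U) Y" by (rule hp_id[OF HF_nb[OF U'V Y]])
  \<comment> \<open>On horizontal arguments \<open>tau\<close> is a multiple of the vertical
    \<open>xib\<close>, so the Levi-Civita and the characteristic connection have the same
    horizontal part.\<close>
  moreover have "hp (tau (hp U) Y) = 0"
  proof (rule hp_vertical)
    show "tau (hp U) Y \<in> VF" by (rule tau_VF[OF U'V YV])
    have "\<phi> p (xib p) = 0" for p
    proof -
      have "xib p \<in> span ((\<lambda>i. \<xi> i p) ` {..<s})"
        unfolding xib_def by (subst sum_fun_apply) (intro span_sum span_base imageI)
      then show ?thesis using ker_phi[of p] by blast
    qed
    then have "ph xib = 0" by (auto simp: on_fields_def fun_eq_iff)
    moreover have "f \<cdot>\<^sub>v 0 = 0" for f by (auto simp: fscale_def)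
    ultimately show "ph (tau (hp U) Y) = 0"
      by (simp add: tau_HF[OF U' Y] ph_fscale xib_VF)
  qed
  ultimately have 1: "hp (nabla_g (hp U) Y) = nb (hp U) Y" by simp
  have ver: "ver_part A \<phi> U = ?V"
    using hp_decomp[OF U] by (simp add: ver_part_def hor_part_eq[OF U] algebra_simps)
  have "tc U Y = nb (hp U) Y + (nb ?V Y + (\<lambda>p. 2 * etb ?V p) \<cdot>\<^sub>v ph Y)"
    unfolding transverse_connection_def hor_part_eq[OF U] ver
    using U'V YV V by (simp add: hor_part_eq fields 1 hV)
  also have "\<dots> = nb (hp U + ?V) Y + (\<lambda>p. 2 * etb (hp U + ?V) p) \<cdot>\<^sub>v ph Y"
    using nb.D_add1[OF U'V V YV] etb_simps(1)[OF U'V V] HF_etb[OF U'] by (simp add: add.assoc)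
  finally show ?thesis using hp_decomp[OF U] by simp
qed

lemma tc_HF: "X \<in> HF \<Longrightarrow> Y \<in> HF \<Longrightarrow> tc X Y = nb X Y"
  using tc_eq[OF HF_VF, of X Y] HF_etb[of X] by (simp add: fscale_def fun_eq_iff)

lemma et_br_HF:
  assumes "j < s" "X \<in> HF" "Y \<in> HF"
  shows "et j (br X Y) p = - 2 * G X (ph Y) p"
  using dEta[OF assms(1) HF_VF[OF assms(2)] HF_VF[OF assms(3)], of p] assms
  by (simp add: HF_et dir_deriv_const HF_VF)

text \<open>In horizontal directions the two connections agree on horizontal fields, and \<nabla>
  preserves these, so the iterated derivatives coincide. Only the derivative along [X, Z] differs;
  it enters with a minus sign, which reverses that of \<eta>_i [X, Z].\<close>

lemma tc_curvature:
  assumes X: "X \<in> HF" and Z: "Z \<in> HF" and W: "W \<in> HF"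
  shows "curvature A tc X Z W = nb.R X Z W + (\<lambda>p. 4 * real s * G X (ph Z) p) \<cdot>\<^sub>v ph W"
proof -
  note V = HF_VF[OF X] HF_VF[OF Z] HF_VF[OF W]
  have "etb (br X Z) = (\<lambda>p. - 2 * real s * G X (ph Z) p)"
    unfolding etb_def using et_br_HF[OF _ X Z] by (auto simp: fun_eq_iff)
  then have "tc (br X Z) W = nb (br X Z) W - (\<lambda>p. 4 * real s * G X (ph Z) p) \<cdot>\<^sub>v ph W"
    using tc_eq[OF VF_bracket[OF V(1,2)] W] by (auto simp: fscale_def)
  then show ?thesis
    using X Z W V by (simp add: curvature_def tc_HF HF_nb algebra_simps)
qed

subsection \<open>The covariant derivative of the f-structure\<close>

text \<open>This is \<open>g ((\<nabla>\<^sub>X \<phi>) Y) Z\<close>, with \<open>\<phi>\<close> moved across \<open>g\<close> by skewness.\<close>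

definition dphi :: "'a vfield \<Rightarrow> 'a vfield \<Rightarrow> 'a vfield \<Rightarrow> 'a \<Rightarrow> real" where
  "dphi X Y Z p = G (nb X (ph Y)) Z p + G (nb X Y) (ph Z) p"

text \<open>Differentiate g(\<phi> Y, Z) = - g(Y, \<phi> Z) along X with a metric
  connection.\<close>

lemma dphi_skew:
  assumes "X \<in> VF" "Y \<in> VF" "Z \<in> VF"
  shows "dphi X Y Z p = - dphi X Z Y p"
proof -
  have "G (ph Y) Z = (\<lambda>p. - G Y (ph Z) p)" using G_ph assms by blast
  then have "dd X (G (ph Y) Z) p = - dd X (G Y (ph Z)) p"
    using assms by (simp add: dir_deriv_uminus fields funs)
  then show ?thesis
    unfolding dphi_def
    using assms nb_metric[of X "ph Y" Z p] nb_metric[of X Y "ph Z" p]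
      G_commute[of "ph Y" "nb X Z" p] G_commute[of Y "nb X (ph Z)" p]
    by (simp add: fields nb.D_VF)
qed

text \<open>Differentiating \<phi>^2 = - 1 on horizontal fields shows that \<nabla>_X \<phi>
  anticommutes with \<phi>; moving \<phi> across g absorbs the sign.\<close>

lemma dphi_ph:
  assumes "X \<in> VF" "Y \<in> HF" "Z \<in> HF"
  shows "dphi X (ph Y) Z p = dphi X Y (ph Z) p"
  unfolding dphi_def using assms
  by (simp add: ph_ph_HF nb.D_uminus2 HF_VF G_minus G_minus2 nb.D_VF)

lemma bracket_uminus2: "X \<in> VF \<Longrightarrow> Y \<in> VF \<Longrightarrow> br X (- Y) = - br X Y"
  using bracket_add(2)[OF _ VF_uminus, of Y Y X] bracket_zero[of X]
  by (intro minus_unique[symmetric]) simp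

lemma Jacobi_cyclic:
  assumes "X \<in> VF" "Y \<in> VF" "Z \<in> VF"
  shows "br (br X Y) Z + br (br Y Z) X + br (br Z X) Y = 0"
proof -
  have "br (br Y Z) X = - br X (br Y Z)" by (rule bracket_swap)
  moreover have "br (br Z X) Y = br Y (br X Z)"
    using bracket_swap[of "br Z X" Y] bracket_swap[of Z X] bracket_uminus2[of Y "br X Z"] assms
    by (simp add: fields)
  ultimately show ?thesis using Jacobi[OF assms] by simp
qed

text \<open>The cyclic sum is \<open>dF\<close>, which vanishes because \<open>2F = d\<eta>\<close>; the torsion does not
  contribute since it is vertical on horizontal fields.\<close>

lemma dphi_cyclic:
  assumes X: "X \<in> HF" and Y: "Y \<in> HF" and Z: "Z \<in> HF"
  shows "dphi X Z Y p + dphi Y X Z p + dphi Z Y X p = 0"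
proof -
  \<comment> \<open>All \<eta>_j have the same differential 2 F, so index 0 serves for the whole
    computation.\<close>
  have j: "0 < s" using s_ge_1 by simp
  \<comment> \<open>Each instance holds halves of two different \<open>dphi\<close> terms. In the
    cyclic sum the halves recombine, the derivatives of \<eta> cancel in pairs, and what remains is
    the Jacobi identity.\<close>
  have step: "2 * (G (nb U (ph W)) V p + G (nb V U) (ph W) p) =
      - dd U (et 0 (br V W)) p + dd W (et 0 (br U V)) p + et 0 (br (br U V) W) p"
    if U: "U \<in> HF" and V: "V \<in> HF" and W: "W \<in> HF" for U V W
  proof -
    note f = HF_VF[OF U] HF_VF[OF V] HF_VF[OF W] fields funs nb.D_VF
    have "(\<lambda>p. 2 * G V (ph W) p) = (\<lambda>p. - et 0 (br V W) p)"
      using et_br_HF[OF j V W] by auto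
    then have "2 * dd U (G V (ph W)) p = - dd U (et 0 (br V W)) p"
      using dir_deriv_cmult[of U "G V (ph W)" 2 p] dir_deriv_uminus[of U "et 0 (br V W)" p] f j by simp
    then have 1: "2 * (G (nb U V) (ph W) p + G V (nb U (ph W)) p) = - dd U (et 0 (br V W)) p"
      using nb_metric[of U V "ph W" p] f by simp
    have 2: "2 * G (br U V) (ph W) p = - dd W (et 0 (br U V)) p - et 0 (br (br U V) W) p"
      using dEta[OF j, of "br U V" W p] HF_et[OF W j] dir_deriv_const[of "br U V" 0 p] f by simp
    have "G (nb U V - nb V U) (ph W) p = G (br U V) (ph W) p"
      unfolding nb_torsion_HF[OF U V] using f
      by (simp add: G_add G_xib_HF[OF HF_ph] xib_VF)
    then have 3: "G (br U V) (ph W) p = G (nb U V) (ph W) p - G (nb V U) (ph W) p"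
      using f by (simp add: G_diff)
    show ?thesis using 1 2 3 G_commute[of V "nb U (ph W)" p] f by simp
  qed
  note f = HF_VF[OF X] HF_VF[OF Y] HF_VF[OF Z] fields
  have "et 0 (br (br X Y) Z + br (br Y Z) X + br (br Z X) Y) p = 0"
    unfolding Jacobi_cyclic[OF f(1-3)] using eta_zero[OF j] by (simp add: form_on_fields_def)
  then have "et 0 (br (br X Y) Z) p + et 0 (br (br Y Z) X) p + et 0 (br (br Z X) Y) p = 0"
    using f j by (simp add: et_add)
  then show ?thesis
    unfolding dphi_def using step[OF X Y Z] step[OF Y Z X] step[OF Z X Y] by simp
qed

lemma dphi_tensorial1:
  assumes "Y \<in> VF" "Z \<in> VF"
  shows "tensorial p (\<lambda>X. dphi X Y Z p)"
  unfolding tensorial_def dphi_def using assms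
  by (simp add: nb.D_add1 nb.D_fscale1 G_add G_fscale fields nb.D_VF algebra_simps)

lemma dphi_tensorial2:
  assumes "X \<in> VF" "Z \<in> VF"
  shows "tensorial p (\<lambda>Y. dphi X Y Z p)"
  unfolding tensorial_def dphi_def using assms
  by (simp add: nb.D_add2 nb.D_fscale2 G_add G_fscale fields funs nb.D_VF ph_add ph_fscale G_ph algebra_simps)

lemma orthonormal_ph:
  assumes E: "orthonormal_at p m E" and H: "\<And>a. a < m \<Longrightarrow> E a \<in> HF"
  shows "orthonormal_at p m (\<lambda>a. ph (E a))"
proof -
  have "G (ph (E a)) (ph (E b)) p = G (E a) (E b) p" if "a < m" "b < m" for a b
    using G_ph_ph[OF HF_VF HF_VF] H that by (simp add: HF_et)
  then show ?thesis
    using E by (simp add: orthonormal_at_def bilin_on_fields_def phi_VF)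
qed

lemma span_ph:
  assumes E: "orthonormal_at p (2 * n) E" and H: "\<And>a. a < 2 * n \<Longrightarrow> E a \<in> HF"
  shows "span ((\<lambda>a. ph (E a) p) ` {..<2 * n}) = H p"
proof -
  obtain S where S: "finite S" "card S = 2 * n" "span S = H p" using horizontal_rank[of p] by blast
  show ?thesis
    using orthonormal_spans[OF orthonormal_ph[OF E H] _ S(1,2)] HF_ph[OF HF_VF[OF H]] S(3)
    by (auto simp: sections_def)
qed

text \<open>Write Y = \<phi> Z. By \<open>dphi_ph\<close> the summand becomes
  \<open>dphi e (ph e) Z\<close>, and this is symmetric under exchanging e and \<phi> e. Replacing
  the frame by its image under \<phi> preserves the trace but, as \<phi>^2 = - 1, also reverses its
  sign.\<close>

lemma dphi_trace:
  assumes E: "local_orthonormal_frame A g H (2 * n) p E" and Y: "Y \<in> HF"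
  shows "(\<Sum>b<2 * n. dphi (E b) (E b) Y p) = 0"
proof -
  note E' = local_orthonormal_frameD[OF E]
  note EV = HF_VF[OF E'(2)]
  define Z where "Z = ph (- Y)"
  have Z: "Z \<in> HF" unfolding Z_def using Y HF_VF by (intro HF_ph VF_uminus) auto
  note ZV = HF_VF[OF Z]
  have YZ: "Y = ph Z" unfolding Z_def using ph_ph_HF[OF HF_minus[OF Y]] by simp
  \<comment> \<open>In the cyclic sum the term with Z in front vanishes: it is unchanged when \<phi>
    moves to the other slot, yet skew in these two slots.\<close>
  have swap: "dphi (E b) (ph (E b)) Z p = dphi (ph (E b)) (E b) Z p" if b: "b < 2 * n" for b
  proof -
    note f = EV[OF b] E'(2)[OF b] HF_ph[OF EV[OF b]] phi_VF Z ZV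
    have "dphi Z (E b) (ph (E b)) p = dphi Z (ph (E b)) (E b) p" using f by (simp add: dphi_ph)
    moreover have "dphi Z (E b) (ph (E b)) p = - dphi Z (ph (E b)) (E b) p" using f by (intro dphi_skew) simp_all
    moreover have "dphi (ph (E b)) Z (E b) p = - dphi (ph (E b)) (E b) Z p" using f by (intro dphi_skew) simp_all
    ultimately show ?thesis using dphi_cyclic[of "E b" Z "ph (E b)" p] f by simp
  qed
  have "(\<Sum>b<2 * n. dphi (ph (E b)) (E b) Z p) = (\<Sum>b<2 * n. dphi (ph (ph (E b))) (ph (E b)) Z p)"
  proof (rule trace_independent[OF _ _ E'(1) orthonormal_ph[OF E'(1,2)], of "\<lambda>X Y. dphi (ph X) Y Z p"])
    show "tensorial p (\<lambda>Y. dphi (ph X) Y Z p)" if "X \<in> VF" for X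
      using that ZV by (intro dphi_tensorial2 phi_VF)
    show "tensorial p (\<lambda>X. dphi (ph X) Y Z p)" if "Y \<in> VF" for Y
      using dphi_tensorial1[OF that ZV, of p] by (simp add: tensorial_def ph_add ph_fscale phi_VF)
    show "span ((\<lambda>a. E a p) ` {..<2 * n}) = span ((\<lambda>a. ph (E a) p) ` {..<2 * n})"
      using span_ph[OF E'(1,2)] E'(3) by simp
  qed
  also have "\<dots> = (\<Sum>b<2 * n. - dphi (E b) (ph (E b)) Z p)"
  proof (rule sum.cong[OF refl])
    fix b assume "b \<in> {..<2 * n}"
    then show "dphi (ph (ph (E b))) (ph (E b)) Z p = - dphi (E b) (ph (E b)) Z p"
      using E'(2)[of b] EV[of b] ZV
      by (simp add: dphi_def ph_ph_HF nb.D_uminus1 phi_VF G_minus nb.D_VF HF_VF VF_uminus nb.D_uminus2)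
  qed
  also have "\<dots> = - (\<Sum>b<2 * n. dphi (ph (E b)) (E b) Z p)"
    using swap by (simp add: sum_negf)
  finally have "(\<Sum>b<2 * n. dphi (ph (E b)) (E b) Z p) = 0" by simp
  then have "(\<Sum>b<2 * n. dphi (E b) (ph (E b)) Z p) = 0" using swap by simp
  moreover have "dphi (E b) (E b) Y p = dphi (E b) (ph (E b)) Z p" if "b < 2 * n" for b
    unfolding YZ using dphi_ph[OF EV[OF that] E'(2)[OF that] Z] by simp
  ultimately show ?thesis by simp
qed

subsection \<open>Invariance of the characteristic connection under the Reeb fields\<close>

text \<open>The Lie derivative of the connection along \<open>\<xi> j\<close>.\<close>

definition lie_nb :: "nat \<Rightarrow> 'a vfield \<Rightarrow> 'a vfield \<Rightarrow> 'a vfield" where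
  "lie_nb j Z W = br (\<xi> j) (nb Z W) - nb (br (\<xi> j) Z) W - nb Z (br (\<xi> j) W)"

lemma lie_nb_VF: "j < s \<Longrightarrow> Z \<in> VF \<Longrightarrow> W \<in> VF \<Longrightarrow> lie_nb j Z W \<in> VF"
  unfolding lie_nb_def by (intro VF_diff VF_bracket nb.D_VF xi_VF)

text \<open>Apply \<xi> to the metric identity for \<nabla>_Z and commute the two derivatives; by
  the Killing property only the two \<open>lie_nb\<close> terms survive.\<close>

lemma lie_nb_skew:
  assumes j: "j < s" and Z: "Z \<in> VF" and W: "W \<in> VF" and Y: "Y \<in> VF"
  shows "G (lie_nb j Z W) Y p = - G (lie_nb j Z Y) W p"
proof -
  let ?x = "\<xi> j"
  note f = fields funs nb.D_VF j Z W Y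
  have "dd Z (G W Y) = (\<lambda>p. G (nb Z W) Y p + G W (nb Z Y) p)"
    using nb_metric[OF Z W Y] by blast
  then have 1: "dd ?x (dd Z (G W Y)) p = dd ?x (G (nb Z W) Y) p + dd ?x (G W (nb Z Y)) p"
    using f by (simp add: dir_deriv_add)
  have "dd ?x (G W Y) = (\<lambda>p. G (br ?x W) Y p + G W (br ?x Y) p)"
    using Killing[OF j W Y] by blast
  then have 2: "dd Z (dd ?x (G W Y)) p = dd Z (G (br ?x W) Y) p + dd Z (G W (br ?x Y)) p"
    using f by (simp add: dir_deriv_add)
  have c: "G (lie_nb j Z Y) W p = G W (lie_nb j Z Y) p"
    by (rule G_commute[OF lie_nb_VF[OF j Z Y] W])
  have 3: "G (lie_nb j Z W) Y p = G (br ?x (nb Z W)) Y p - G (nb (br ?x Z) W) Y p - G (nb Z (br ?x W)) Y p"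
    and 4: "G W (lie_nb j Z Y) p = G W (br ?x (nb Z Y)) p - G W (nb (br ?x Z) Y) p - G W (nb Z (br ?x Y)) p"
    using f by (simp_all add: lie_nb_def G_diff G_diff2)
  have "dd (br ?x Z) (G W Y) p = dd ?x (dd Z (G W Y)) p - dd Z (dd ?x (G W Y)) p"
    using f by (intro dir_deriv_bracket) simp
  moreover have "dd ?x (G (nb Z W) Y) p = G (br ?x (nb Z W)) Y p + G (nb Z W) (br ?x Y) p"
    and "dd ?x (G W (nb Z Y)) p = G (br ?x W) (nb Z Y) p + G W (br ?x (nb Z Y)) p"
    using f by (intro Killing; simp)+
  moreover have "dd Z (G (br ?x W) Y) p = G (nb Z (br ?x W)) Y p + G (br ?x W) (nb Z Y) p"
    and "dd Z (G W (br ?x Y)) p = G (nb Z W) (br ?x Y) p + G W (nb Z (br ?x Y)) p"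
    and "dd (br ?x Z) (G W Y) p = G (nb (br ?x Z) W) Y p + G W (nb (br ?x Z) Y) p"
    using f by (intro nb_metric; simp)+
  ultimately show ?thesis using 1 2 3 4 c by linarith
qed

text \<open>The antisymmetric part comes from the Lie derivative of the torsion. It vanishes against
  a horizontal Y: the torsion of horizontal fields is a multiple of \<open>xib\<close>, and
  bracketing with \<xi> keeps such a multiple orthogonal to horizontal fields. The remaining
  brackets cancel by Jacobi.\<close>

lemma lie_nb_sym:
  assumes j: "j < s" and Z: "Z \<in> HF" and W: "W \<in> HF" and Y: "Y \<in> HF"
  shows "G (lie_nb j Z W) Y p = G (lie_nb j W Z) Y p"
proof -
  let ?x = "\<xi> j"
  note V = HF_VF[OF Z] HF_VF[OF W] HF_VF[OF Y]
  note f = fields funs nb.D_VF j V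
  have tor: "G (nb U U') Y p - G (nb U' U) Y p = G (br U U') Y p" if "U \<in> HF" "U' \<in> HF" for U U'
  proof -
    have "G (nb U U' - nb U' U) Y p = G (br U U') Y p"
      unfolding nb_torsion_HF[OF that]
      using that HF_VF f by (simp add: G_add G_xib_HF[OF Y] xib_VF)
    then show ?thesis using that HF_VF f by (simp add: G_diff)
  qed
  \<comment> \<open>The Killing property applied to g(h \<open>xib\<close>, Y) = 0, where the
    bracket of \<xi> with Y is again horizontal.\<close>
  have brxib: "G (br ?x (h \<cdot>\<^sub>v xib)) Y p = 0" if "h \<in> CF" for h
  proof -
    have "G (h \<cdot>\<^sub>v xib) Y = (\<lambda>p. 0)" using G_xib_HF[OF Y] by blast
    then have "dd ?x (G (h \<cdot>\<^sub>v xib) Y) p = 0" using dir_deriv_const[of ?x 0 p] f by simp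
    then show ?thesis
      using Killing[OF j, of "h \<cdot>\<^sub>v xib" Y p] G_xib_HF[OF HF_br_xi[OF j Y]] f that
      by (simp add: xib_VF)
  qed
  have "(\<lambda>p. 2 * G Z (ph W) p) \<in> CF" using f by simp
  note h = this brxib[OF this]
  have "br ?x (nb Z W) - br ?x (nb W Z) = br ?x (nb Z W - nb W Z)"
    using bracket_add(2)[of "nb Z W" "- nb W Z" ?x] bracket_uminus2[of ?x "nb W Z"] f by simp
  also have "\<dots> = br ?x (br Z W) + br ?x ((\<lambda>p. 2 * G Z (ph W) p) \<cdot>\<^sub>v xib)"
    unfolding nb_torsion_HF[OF Z W] using f h by (intro bracket_add(2)) (simp_all add: xib_VF)
  finally have "G (br ?x (nb Z W) - br ?x (nb W Z)) Y p =
      G (br ?x (br Z W) + br ?x ((\<lambda>p. 2 * G Z (ph W) p) \<cdot>\<^sub>v xib)) Y p" by simp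
  then have "G (br ?x (nb Z W)) Y p - G (br ?x (nb W Z)) Y p = G (br ?x (br Z W)) Y p"
    using f h by (simp add: G_diff G_add xib_VF)
  moreover have "G (br ?x (br Z W)) Y p = G (br (br ?x Z) W) Y p + G (br Z (br ?x W)) Y p"
    unfolding Jacobi[OF xi_VF[OF j] V(1,2)] using f by (intro G_add) simp_all
  ultimately show ?thesis
    using tor[OF HF_br_xi[OF j Z] W] tor[OF Z HF_br_xi[OF j W]] f
    by (simp add: lie_nb_def G_diff)
qed

text \<open>Symmetry in the first two slots and skewness in the last two, applied alternately six
  times, return the expression with the opposite sign, as in the uniqueness proof for the
  Levi-Civita connection.\<close>

lemma lie_nb_zero:
  assumes "j < s" "Z \<in> HF" "W \<in> HF" "Y \<in> HF"
  shows "G (lie_nb j Z W) Y p = 0"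
proof -
  note sk = lie_nb_skew[OF assms(1) HF_VF HF_VF HF_VF]
  show ?thesis
    using sk[OF assms(2,3,4), of p] sk[OF assms(4,2,3), of p] sk[OF assms(3,4,2), of p]
      lie_nb_sym[OF assms(1) assms(2,4,3), of p] lie_nb_sym[OF assms(1) assms(4,3,2), of p]
      lie_nb_sym[OF assms(1) assms(3,2,4), of p] by linarith
qed

subsection \<open>Ricci curvature\<close>

lemma R_xi3: "j < s \<Longrightarrow> U \<in> VF \<Longrightarrow> Z \<in> VF \<Longrightarrow> nb.R U Z (\<xi> j) = 0"
  by (simp add: curvature_def nb_xi nb.D_zero2 VF_bracket)

text \<open>By \<open>nb_eta\<close>, \<eta>_j turns \<nabla> into the derivative of functions,
  which has no curvature.\<close>

lemma G_R_xi:
  assumes "j < s" "U \<in> VF" "Z \<in> VF" "W \<in> VF"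
  shows "G (nb.R U Z W) (\<xi> j) p = 0"
proof -
  note f = assms fields funs nb.D_VF
  show ?thesis
    using f dir_deriv_bracket[of "et j W" U Z p]
    by (simp add: G_xi2 nb.R_VF curvature_def et_diff nb_eta)
qed

lemma G_R_hor:
  assumes U: "U \<in> VF" and Z: "Z \<in> VF" and W: "W \<in> VF" and V: "V \<in> VF"
  shows "G (nb.R U Z W) V p = G (nb.R U Z W) (hp V) p"
proof -
  let ?R = "nb.R U Z W"
  have RV: "?R \<in> VF" using U Z W by (rule nb.R_VF)
  have "(\<Sum>i<s. et i V \<cdot>\<^sub>v \<xi> i) \<in> VF" by (intro VF_sum VF_fscale eta_CF xi_VF V) auto
  then have "G ?R V p = G ?R (hp V) p + G ?R (\<Sum>i<s. et i V \<cdot>\<^sub>v \<xi> i) p"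
    using arg_cong[OF hp_decomp[OF V], of "\<lambda>V. G ?R V p"] RV HF_VF[OF hp_HF[OF V]]
    by (simp add: G_add2)
  moreover have "G (\<Sum>i<s. et i V \<cdot>\<^sub>v \<xi> i) ?R p = 0"
  proof -
    have t: "tensorial p (\<lambda>X. G X ?R p)"
      using RV by (simp add: tensorial_def G_add G_fscale)
    have "G (\<Sum>i<s. et i V \<cdot>\<^sub>v \<xi> i) ?R p = (\<Sum>i<s. et i V p * G (\<xi> i) ?R p)"
      by (rule tensorial_sum[OF t]) (use V in \<open>auto simp: eta_CF xi_VF\<close>)
    also have "\<dots> = 0"
      by (rule sum.neutral) (use G_R_xi[OF _ U Z W] G_commute[OF xi_VF RV] in auto)
    finally show ?thesis .
  qed
  ultimately show ?thesis
    using G_commute[OF RV \<open>(\<Sum>i<s. et i V \<cdot>\<^sub>v \<xi> i) \<in> VF\<close>] by simp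
qed

text \<open>Substituting \<nabla>_\<xi> = L_\<xi> - 2 \<phi> into the curvature leaves the Lie
  derivative of the connection, which vanishes against Y, and the commutator of \<nabla>_Z with 2
  \<phi>.\<close>

lemma R_xi1:
  assumes j: "j < s" and Z: "Z \<in> HF" and W: "W \<in> HF" and Y: "Y \<in> HF"
  shows "G (nb.R (\<xi> j) Z W) Y p = 2 * dphi Z W Y p"
proof -
  let ?x = "\<xi> j"
  note V = HF_VF[OF Z] HF_VF[OF W] HF_VF[OF Y]
  note f = fields funs nb.D_VF j V
  have nbx: "nb ?x U = br ?x U - ph U - ph U" if "U \<in> VF" for U
    using nb_xi_left[OF j that] by (simp only: scaleR_2 diff_diff_eq)
  have D_diff: "nb Z (U - U') = nb Z U - nb Z U'" if "U \<in> VF" "U' \<in> VF" for U U'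
    using nb.D_add2[OF V(1) that(1) VF_uminus[OF that(2)]] nb.D_uminus2[OF V(1) that(2)] by simp
  let ?L = "lie_nb j Z W" and ?P = "nb Z (ph W)" and ?N = "ph (nb Z W)"
  have VV: "?L \<in> VF" "?P \<in> VF" "?N \<in> VF" using f lie_nb_VF by simp_all
  have "nb Z (nb ?x W) = nb Z (br ?x W) - ?P - ?P"
    unfolding nbx[OF V(2)] using f by (simp only: D_diff VF_diff)
  then have "nb.R ?x Z W = ?L + (?P - ?N) + (?P - ?N)"
    unfolding curvature_def lie_nb_def using f by (simp only: nbx) (simp add: algebra_simps)
  then have "G (nb.R ?x Z W) Y p = G ?L Y p + (G ?P Y p - G ?N Y p) + (G ?P Y p - G ?N Y p)"
    using VV V by (simp only: G_add G_diff VF_add VF_diff)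
  then show ?thesis
    using lie_nb_zero[OF j Z W Y, of p] f by (simp add: G_ph dphi_def)
qed

text \<open>The frame that the definition of the transverse Ricci tensor selects at \<open>p\<close>.\<close>

definition EH :: "'a \<Rightarrow> nat \<Rightarrow> 'a vfield" where
  "EH p = (SOME E. local_orthonormal_frame A g H (2 * n) p E)"

text \<open>Traces the characteristic curvature over the frame of the transverse Ricci tensor, so
  that both Ricci tensors become sums over the same 2 n fields.\<close>

definition hric :: "'a \<Rightarrow> 'a vfield \<Rightarrow> 'a vfield \<Rightarrow> real" where
  "hric p U V = (\<Sum>b<2 * n. G (nb.R U (EH p b) (EH p b)) V p)"

lemma EH: "local_orthonormal_frame A g H (2 * n) p (EH p)"
  unfolding EH_def using exists_horizontal_frame by (rule someI_ex)

lemma EH_HF: "b < 2 * n \<Longrightarrow> EH p b \<in> HF"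
  using local_orthonormal_frameD(2)[OF EH] .

lemma EH_VF: "b < 2 * n \<Longrightarrow> EH p b \<in> VF"
  using EH_HF HF_VF by blast

text \<open>The chosen tangent frame may be exchanged for \<open>EH p\<close> completed by the Reeb
  fields, and R(U, \<xi>_i) \<xi>_i = 0.\<close>

lemma ricci_nb:
  assumes U: "U \<in> VF" and V: "V \<in> VF"
  shows "ricci A g T DIM('e) nb U V p = hric p U V"
proof -
  define E where "E = (SOME E. local_orthonormal_frame A g T DIM('e) p E)"
  have E: "local_orthonormal_frame A g T DIM('e) p E"
    unfolding E_def using exists_tangent_frame by (rule someI_ex)
  let ?F = "adapted_frame (EH p)"
  let ?Q = "\<lambda>Z W. G (nb.R U Z W) V p"
  note H' = local_orthonormal_frameD[OF EH]
  have F: "orthonormal_at p DIM('e) ?F"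
    by (rule adapted_frame_orthonormal[OF H'(1)]) (use EH_HF in \<open>auto simp: sections_def\<close>)
  have split: "(\<Sum>a<2 * n + s. h a) = (\<Sum>a<2 * n. h a) + (\<Sum>a\<in>{2 * n..<2 * n + s}. h a)"
    for h :: "nat \<Rightarrow> real"
  proof -
    have u: "{..<2 * n + s} = {..<2 * n} \<union> {2 * n..<2 * n + s}" by auto
    show ?thesis unfolding u by (rule sum.union_disjoint) auto
  qed
  have "ricci A g T DIM('e) nb U V p = (\<Sum>a<DIM('e). ?Q (E a) (E a))"
    by (simp add: ricci_def Let_def E_def)
  also have "\<dots> = (\<Sum>a<DIM('e). ?Q (?F a) (?F a))"
  proof (rule trace_independent[where Q = ?Q, OF _ _ local_orthonormal_frameD(1)[OF E] F])
    show "tensorial p (\<lambda>W. ?Q Z W)" if "Z \<in> VF" for Z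
      using that U V by (simp add: tensorial_def nb.R_add3 nb.R_fscale3 nb.R_VF G_add G_fscale)
    show "tensorial p (\<lambda>Z. ?Q Z W)" if "W \<in> VF" for W
      using that U V by (simp add: tensorial_def nb.R_add2 nb.R_fscale2 nb.R_VF G_add G_fscale)
    show "span ((\<lambda>a. E a p) ` {..<DIM('e)}) = span ((\<lambda>a. ?F a p) ` {..<DIM('e)})"
      using local_orthonormal_frameD(3)[OF E] adapted_frame_span[of "EH p" p] H'(3) by simp
  qed
  also have "\<dots> = (\<Sum>a<2 * n. ?Q (?F a) (?F a)) + (\<Sum>a\<in>{2 * n..<2 * n + s}. ?Q (?F a) (?F a))"
    unfolding DIM_eq by (rule split)
  also have "\<dots> = hric p U V + 0"
  proof (rule arg_cong2[where f = "(+)"])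
    show "(\<Sum>a<2 * n. ?Q (?F a) (?F a)) = hric p U V"
      by (simp add: hric_def adapted_frame_def)
    show "(\<Sum>a\<in>{2 * n..<2 * n + s}. ?Q (?F a) (?F a)) = 0"
      by (rule sum.neutral) (use U V in \<open>auto simp: adapted_frame_def R_xi3 xi_VF G_zero\<close>)
  qed
  finally show ?thesis by simp
qed

text \<open>In 4 s F(X, e) g(\<phi> e, Y) both factors \<phi> are moved off e, so two signs cancel,
  and Parseval yields 4 s g(\<phi> X, \<phi> Y) = 4 s g(X, Y). Hence the positive sign of the
  Einstein constant.\<close>

lemma transverse_ricci_eq:
  assumes X: "X \<in> HF" and Y: "Y \<in> HF"
  shows "transverse_ricci A n \<phi> g nabla_g X Y p = hric p X Y + 4 * real s * G X Y p"
proof -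
  note V = HF_VF[OF X] HF_VF[OF Y]
  let ?E = "EH p"
  have t: "G (curvature A tc X (?E b) (?E b)) Y p =
      G (nb.R X (?E b) (?E b)) Y p + 4 * real s * (g p (ph X p) (?E b p) * g p (?E b p) (ph Y p))"
    if b: "b < 2 * n" for b
  proof -
    have "G X (ph (?E b)) p * G (ph (?E b)) Y p = g p (ph X p) (?E b p) * g p (?E b p) (ph Y p)"
      using G_ph[OF V(1) EH_VF[OF b], of p] G_ph[OF EH_VF[OF b] V(2), of p]
      by (simp add: bilin_on_fields_def)
    then show ?thesis
      using tc_curvature[OF X EH_HF[OF b] EH_HF[OF b]] V EH_VF[OF b]
      by (simp add: G_add G_fscale nb.R_VF fields funs)
  qed
  have "ph X p \<in> H p" using HF_ph[OF V(1)] by (simp add: sections_def)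
  then have "(\<Sum>b<2 * n. g p (ph X p) (?E b p) * g p (?E b p) (ph Y p)) = g p (ph X p) (ph Y p)"
    using local_orthonormal_frameD[OF EH] VF_T[OF phi_VF[OF V(2)]] by (intro parseval) auto
  also have "\<dots> = G X Y p"
    using G_ph_ph[OF V, of p] X by (simp add: bilin_on_fields_def HF_et)
  finally have p: "(\<Sum>b<2 * n. g p (ph X p) (?E b p) * g p (?E b p) (ph Y p)) = G X Y p" .
  have "transverse_ricci A n \<phi> g nabla_g X Y p = (\<Sum>b<2 * n. G (curvature A tc X (?E b) (?E b)) Y p)"
    by (simp add: transverse_ricci_def ricci_def Let_def EH_def)
  also have "\<dots> = hric p X Y + 4 * real s * G X Y p"
    using t p by (simp add: hric_def sum.distrib sum_distrib_left[symmetric])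
  finally show ?thesis .
qed

lemma hric_xi:
  assumes "j < s" "Y \<in> HF"
  shows "hric p (\<xi> j) Y = 0"
  unfolding hric_def
  using dphi_trace[OF EH assms(2), of p] assms EH_HF
  by (simp add: R_xi1 sum_distrib_left[symmetric])

text \<open>The slot of V loses its vertical part because curvature values are horizontal, the slot
  of U by linearity and \<open>hric_xi\<close>. The latter asks for a horizontal second argument, so
  V is treated before U.\<close>

lemma hric_hor:
  assumes U: "U \<in> VF" and V: "V \<in> VF"
  shows "hric p U V = hric p (hp U) (hp V)"
proof -
  note hV = hp_HF[OF V] HF_VF[OF hp_HF[OF V]]
  have t: "tensorial p (\<lambda>U. hric p U (hp V))"
    unfolding tensorial_def hric_def using hV EH_VF
    by (simp add: nb.R_add1 nb.R_fscale1 nb.R_VF G_add G_fscale sum.distrib sum_distrib_left)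
  have S: "(\<Sum>i<s. et i U \<cdot>\<^sub>v \<xi> i) \<in> VF" by (intro VF_sum VF_fscale eta_CF xi_VF U) auto
  have "hric p U V = hric p U (hp V)"
    unfolding hric_def by (intro sum.cong refl G_R_hor U V EH_VF) auto
  also have "\<dots> = hric p (hp U + (\<Sum>i<s. et i U \<cdot>\<^sub>v \<xi> i)) (hp V)" using hp_decomp[OF U] by simp
  also have "\<dots> = hric p (hp U) (hp V) + hric p (\<Sum>i<s. et i U \<cdot>\<^sub>v \<xi> i) (hp V)"
    by (rule tensorial_add[OF t HF_VF[OF hp_HF[OF U]] S])
  also have "hric p (\<Sum>i<s. et i U \<cdot>\<^sub>v \<xi> i) (hp V) = (\<Sum>i<s. et i U p * hric p (\<xi> i) (hp V))"
    by (rule tensorial_sum[OF t]) (use U in \<open>auto simp: eta_CF xi_VF\<close>)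
  also have "\<dots> = 0" by (rule sum.neutral) (use hric_xi hV in auto)
  finally show ?thesis by simp
qed

lemma ricci_flat_iff:
  "ricci_flat A g nb \<longleftrightarrow> transverse_kaehler_einstein A n \<phi> g nabla_g (4 * real s)"
proof -
  have "ricci_flat A g nb \<longleftrightarrow> (\<forall>U\<in>VF. \<forall>V\<in>VF. \<forall>p. hric p U V = 0)"
    by (simp add: ricci_flat_def ricci_nb)
  also have "\<dots> \<longleftrightarrow> (\<forall>X\<in>HF. \<forall>Y\<in>HF. \<forall>p. hric p X Y = 0)"
    using hric_hor hp_HF HF_VF by metis
  also have "\<dots> \<longleftrightarrow> transverse_kaehler_einstein A n \<phi> g nabla_g (4 * real s)"
    by (simp add: transverse_kaehler_einstein_def transverse_ricci_eq)
  finally show ?thesis .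
qed

end

theorem theorem3p17:
  fixes A :: "('a::{t2_space, second_countable_topology}, 'e::euclidean_space) atlas"
    and n s :: nat
    and \<phi> :: "'a \<Rightarrow> 'a tvec \<Rightarrow> 'a tvec"
    and \<xi> :: "nat \<Rightarrow> 'a vfield"
    and \<eta> :: "nat \<Rightarrow> 'a \<Rightarrow> 'a tvec \<Rightarrow> real"
    and g :: "'a \<Rightarrow> 'a tvec \<Rightarrow> 'a tvec \<Rightarrow> real"
    and nabla_g :: "'a vfield \<Rightarrow> 'a vfield \<Rightarrow> 'a vfield"
  assumes "S_manifold A n s \<phi> \<xi> \<eta> g"
    and "levi_civita_connection A g nabla_g"
  shows "ricci_flat A g (char_connection s \<phi> \<xi> \<eta> g nabla_g)
    \<longleftrightarrow> transverse_kaehler_einstein A n \<phi> g nabla_g (4 * real s)"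
proof -
  interpret S_manifold_connection A g n s \<phi> \<xi> \<eta> nabla_g
    using assms by unfold_locales (auto simp: S_manifold_def metric_f_manifold_def)
  show ?thesis by (rule ricci_flat_iff)
qed

end
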